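(* Let $n \geq 7$ be an integer with $n \equiv 1$ or $5 \pmod 6$. Then $$D(4n) \;\geq\; 2n + \min\{ D(2n),\, 2n-7 \}.$$
   Context: A Steiner quadruple system of order $m$, SQS$(m)$, is a pair $(Q,B)$ where $Q$ is a set of $m$ points and $B$ is a collection of $4$-subsets (blocks) of $Q$ such that every $3$-subset of $Q$ is contained in exactly one block of $B$; such systems exist iff $m \equiv 2$ or $4 \pmod 6$. Several SQS$(m)$ on the same point set $Q$ are pairwise disjoint if no $4$-subset of $Q$ is a block of two of them. $D(m)$ denotes the largest number of pairwise disjoint SQS$(m)$ on a common $m$-point set. *)

theory Defs
  imports Main
begin

definition is_SQS :: "'a set \<Rightarrow> 'a set set \<Rightarrow> bool" where
  "is_SQS Q B \<longleftrightarrow> finite Q \<and>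
     (\<forall>b\<in>B. b \<subseteq> Q \<and> card b = 4) \<and>
     (\<forall>T. T \<subseteq> Q \<and> card T = 3 \<longrightarrow> (\<exists>!b. b \<in> B \<and> T \<subseteq> b))"

definition disjoint_SQS_family :: "'a set \<Rightarrow> 'a set set set \<Rightarrow> bool" where
  "disjoint_SQS_family Q F \<longleftrightarrow>
     (\<forall>B\<in>F. is_SQS Q B) \<and> (\<forall>B1\<in>F. \<forall>B2\<in>F. B1 \<noteq> B2 \<longrightarrow> B1 \<inter> B2 = {})"

definition D :: "nat \<Rightarrow> nat" where
  "D m = Max {card F | F. disjoint_SQS_family {..<m} F}"

end

theory Submission
  imports Defs
begin

text \<open>
  Take two copies, left and right, of \<open>Q = \<int>\<^sub>n \<times> {0, 1}\<close>. There are two sources of quadruple systems on the \<open>4 n\<close>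
  points. Lindner's construction twists one \<open>SQS(2n)\<close> on \<open>Q\<close> by a permutation \<open>\<alpha>\<close> of \<open>Q\<close>: three points of one side are
  completed on the other side, and \<open>x, y\<close> on the left form a block with \<open>\<alpha> x, \<alpha> y\<close> on the right. The \<open>2 n\<close>
  permutations \<open>\<alpha>\<close> form a Latin square in which, moreover, the images of every pair are distinct, so the resulting
  systems are disjoint. The doubling construction puts a system \<open>A\<^sub>j\<close> on both sides and joins the pairs of colour \<open>c\<close> on
  the left with those of colour \<open>c + j\<close> on the right, for a one-factorization of the complete graph on \<open>Q\<close> with colours
  modulo \<open>2 n - 1\<close>; disjoint \<open>A\<^sub>j\<close> and distinct \<open>j\<close> give disjoint systems. The one-factorization is chosen such that
  the permutations \<open>\<alpha>\<close> change the colour of a pair only by \<open>-2, \<dots>, 3\<close>. Hence a doubling system whose \<open>j\<close> avoids these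
  six shifts has no block in common with the Lindner systems, which leaves \<open>2 n - 7\<close> values of \<open>j\<close>.

  Lindner's construction needs some \<open>SQS(2n)\<close>, so Hanani's existence theorem is proved as well, by recursions through
  candelabra systems.
\<close>

section \<open>Quadruple systems as exact covers of triples, and Steiner skeins\<close>

section \<open>Exact covers of triples\<close>

section \<open>Exact covers of triples by quadruples\<close>

text \<open>A Lindner block has one, two or three points on the left, a doubling block four, two or
  none. So the two sources can meet only in a block with two points on each side, and there it
  matters how far a permutation moves the colour of a pair. Within one copy of Z_n a pair has its
  difference as an invariant, across the copies its sum. Translating one copy by t and the other by
  -t keeps both; this gives n permutations that keep the copies and n that exchange them. If both
  families kept the sum, one permutation could send some mixed pair to x', y' and another one to y',
  x'. Therefore the family that keeps the copies adds 1 to the sum. The price is that a mixed pair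
  may pass to the next sum, so neighbouring sums must have neighbouring colours; this dictates the
  numbering of the colours, and it is where the shift 3 comes from. The hypothesis on n says that n
  is odd and that 2n is 2 or 4 modulo 6. The existence of an SQS(2n) is the longer half of the
  proof, because no single recursion reaches all orders.\<close>

definition triples :: "'a set \<Rightarrow> 'a set set" where
  "triples X = {T. T \<subseteq> X \<and> card T = 3}"

text \<open>The carrier is a set of triples instead of a point set. Full systems, systems with a
  hole and candelabra systems are then instances of one notion, and pieces with disjoint carriers
  simply add up.\<close>

definition exact :: "'a set set \<Rightarrow> 'a set set \<Rightarrow> bool" where
  "exact \<T> B \<longleftrightarrow> (\<forall>b\<in>B. card b = 4 \<and> triples b \<subseteq> \<T>) \<and>
     (\<forall>T\<in>\<T>. card T = 3 \<and> (\<exists>!b. b \<in> B \<and> T \<subseteq> b))"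

lemma card3_obtain:
  assumes "card T = 3"
  obtains p q r where "T = {p, q, r}" "p \<noteq> q" "p \<noteq> r" "q \<noteq> r"
  using assms by (auto simp: card_Suc_eq numeral_3_eq_3)

lemma triple_mem_triples [simp]:
  "p \<noteq> q \<Longrightarrow> p \<noteq> r \<Longrightarrow> q \<noteq> r \<Longrightarrow> {p, q, r} \<in> triples X \<longleftrightarrow> p \<in> X \<and> q \<in> X \<and> r \<in> X"
  by (auto simp: triples_def)

lemma triple_in_card4:
  assumes "card b = 4" "x \<in> b"
  obtains T where "T \<in> triples b" "x \<in> T"
proof -
  have "finite b" using assms(1) card.infinite by fastforce
  then have "card (b - {x}) = 3" using assms by simp
  then obtain p q r where pqr: "b - {x} = {p, q, r}" "p \<noteq> q" "p \<noteq> r" "q \<noteq> r"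
    by (rule card3_obtain)
  then have "x \<noteq> p" "x \<noteq> q" "p \<in> b" "q \<in> b" by auto
  then have "{x, p, q} \<in> triples b" using pqr assms(2) by simp
  then show thesis using that by blast
qed

lemma triples_mono: "X \<subseteq> Y \<Longrightarrow> triples X \<subseteq> triples Y"
  by (auto simp: triples_def)

lemma card4_subset_iff:
  assumes "card b = 4"
  shows "b \<subseteq> Q \<longleftrightarrow> triples b \<subseteq> triples Q"
proof
  assume *: "triples b \<subseteq> triples Q"
  show "b \<subseteq> Q"
  proof
    fix x assume "x \<in> b"
    then obtain T where "T \<in> triples b" "x \<in> T" using triple_in_card4 assms by metis
    then show "x \<in> Q" using * by (auto simp: triples_def)
  qed
qed (rule triples_mono)

lemma is_SQS_iff_exact: "is_SQS Q B \<longleftrightarrow> finite Q \<and> exact (triples Q) B"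
proof -
  have "(\<forall>b\<in>B. b \<subseteq> Q \<and> card b = 4) \<longleftrightarrow> (\<forall>b\<in>B. card b = 4 \<and> triples b \<subseteq> triples Q)"
    using card4_subset_iff by blast
  then show ?thesis unfolding is_SQS_def exact_def by (auto simp: triples_def)
qed

lemma exactD_unique:
  "exact \<T> B \<Longrightarrow> b \<in> B \<Longrightarrow> b' \<in> B \<Longrightarrow> T \<subseteq> b \<Longrightarrow> T \<subseteq> b' \<Longrightarrow> card T = 3 \<Longrightarrow> b = b'"
  unfolding exact_def triples_def by blast

text \<open>All triples of a block lie in the carrier of the piece it comes from, so pieces with
  disjoint carriers cannot compete for a triple.\<close>

lemma exact_UN:
  assumes ex: "\<And>i. i \<in> I \<Longrightarrow> exact (\<T> i) (B i)"
    and disj: "\<And>i j. i \<in> I \<Longrightarrow> j \<in> I \<Longrightarrow> i \<noteq> j \<Longrightarrow> \<T> i \<inter> \<T> j = {}"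
  shows "exact (\<Union>i\<in>I. \<T> i) (\<Union>i\<in>I. B i)"
  unfolding exact_def
proof (intro conjI ballI)
  fix b assume "b \<in> (\<Union>i\<in>I. B i)"
  then obtain i where "i \<in> I" "b \<in> B i" by blast
  with ex[of i] show "card b = 4" "triples b \<subseteq> (\<Union>i\<in>I. \<T> i)"
    unfolding exact_def by blast+
next
  fix T assume "T \<in> (\<Union>i\<in>I. \<T> i)"
  then obtain i where i: "i \<in> I" "T \<in> \<T> i" by blast
  with ex[of i] show c: "card T = 3" unfolding exact_def by blast
  from i ex[of i] obtain b where b: "b \<in> B i" "T \<subseteq> b" unfolding exact_def by blast
  have "b' = b" if "j \<in> I" "b' \<in> B j" "T \<subseteq> b'" for j b'
  proof -
    have "T \<in> \<T> j" using that c ex[of j] unfolding exact_def triples_def by blast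
    then have "j = i" using disj[of i j] i that by blast
    then show ?thesis using exactD_unique[OF ex[of i]] i b c that by blast
  qed
  then show "\<exists>!b. b \<in> (\<Union>i\<in>I. B i) \<and> T \<subseteq> b" using i b by blast
qed

lemma exact_Un:
  assumes "exact \<T>\<^sub>1 B\<^sub>1" "exact \<T>\<^sub>2 B\<^sub>2" "\<T>\<^sub>1 \<inter> \<T>\<^sub>2 = {}"
  shows "exact (\<T>\<^sub>1 \<union> \<T>\<^sub>2) (B\<^sub>1 \<union> B\<^sub>2)"
proof -
  have "exact (\<Union>i\<in>UNIV. if i then \<T>\<^sub>1 else \<T>\<^sub>2) (\<Union>i\<in>UNIV. if i then B\<^sub>1 else B\<^sub>2)"
    using assms by (intro exact_UN) auto
  then show ?thesis by (simp add: UNIV_bool Un_commute)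
qed

lemma exact_image:
  assumes ex: "exact \<T> B" and inj: "inj_on h (\<Union>\<T>)"
  shows "exact ((`) h ` \<T>) ((`) h ` B)"
proof -
  have sub: "b \<subseteq> \<Union>\<T>" if "b \<in> B" for b
  proof
    fix x assume "x \<in> b"
    moreover have "card b = 4" "triples b \<subseteq> \<T>" using that ex unfolding exact_def by blast+
    ultimately show "x \<in> \<Union>\<T>" using triple_in_card4[of b x] by blast
  qed
  show ?thesis unfolding exact_def
  proof (intro conjI ballI)
    fix b' assume "b' \<in> (`) h ` B"
    then obtain b where b: "b \<in> B" "b' = h ` b" by blast
    have i: "inj_on h b" using inj sub[OF b(1)] inj_on_subset by blast
    show "card b' = 4" using b ex card_image[OF i] unfolding exact_def by auto
    show "triples b' \<subseteq> (`) h ` \<T>"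
    proof
      fix T' assume "T' \<in> triples b'"
      then obtain T where T: "T \<subseteq> b" "T' = h ` T" "card T' = 3"
        using b unfolding triples_def by (auto simp: subset_image_iff)
      have "card T = 3" using card_image[OF inj_on_subset[OF i T(1)]] T by simp
      then have "T \<in> triples b" using T by (simp add: triples_def)
      moreover have "triples b \<subseteq> \<T>" using ex b unfolding exact_def by simp
      ultimately show "T' \<in> (`) h ` \<T>" using T by blast
    qed
  next
    fix T' assume "T' \<in> (`) h ` \<T>"
    then obtain T where T: "T \<in> \<T>" "T' = h ` T" by blast
    have iT: "inj_on h T" by (rule inj_on_subset[OF inj]) (use T in blast)
    have cT: "card T = 3" using T ex unfolding exact_def by blast
    show "card T' = 3" using cT T card_image[OF iT] by simp
    obtain b where b: "b \<in> B" "T \<subseteq> b" using T ex unfolding exact_def by blast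
    show "\<exists>!b'. b' \<in> (`) h ` B \<and> T' \<subseteq> b'"
    proof (intro ex1I[of _ "h ` b"] conjI)
      show "h ` b \<in> (`) h ` B" "T' \<subseteq> h ` b" using b T by auto
      fix c' assume c': "c' \<in> (`) h ` B \<and> T' \<subseteq> c'"
      then obtain c where c: "c \<in> B" "c' = h ` c" by blast
      have "T \<subseteq> c"
      proof
        fix x assume "x \<in> T"
        then have "h x \<in> h ` c" using c c' T by blast
        then obtain y where "y \<in> c" "h x = h y" by blast
        moreover have "y \<in> \<Union>\<T>" "x \<in> \<Union>\<T>" using sub[OF c(1)] \<open>y \<in> c\<close> T \<open>x \<in> T\<close> by blast+
        ultimately show "x \<in> c" using inj by (metis inj_onD)
      qed
      then show "c' = h ` b" using exactD_unique[OF ex c(1) b(1) _ b(2) cT] c by simp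
    qed
  qed
qed

text \<open>Used to punch a hole into a system: by uniqueness no other block contains a triple of
  \<open>b\<close>.\<close>

lemma exact_remove:
  assumes ex: "exact \<T> B" and "b \<in> B"
  shows "exact (\<T> - triples b) (B - {b})"
proof -
  have cb: "card b = 4" "triples b \<subseteq> \<T>" using assms unfolding exact_def by blast+
  show ?thesis unfolding exact_def
  proof (intro conjI ballI)
    fix c assume c: "c \<in> B - {b}"
    then show "card c = 4" using ex unfolding exact_def by blast
    show "triples c \<subseteq> \<T> - triples b"
    proof
      fix T assume T: "T \<in> triples c"
      have "T \<in> \<T>" using T c ex unfolding exact_def by blast
      moreover have "T \<notin> triples b"
        using exactD_unique[OF ex, of b c T] T c \<open>b \<in> B\<close> unfolding triples_def by auto
      ultimately show "T \<in> \<T> - triples b" by simp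
    qed
  next
    fix T assume T: "T \<in> \<T> - triples b"
    then show 3: "card T = 3" using ex unfolding exact_def by blast
    obtain c where c: "c \<in> B" "T \<subseteq> c" using T ex unfolding exact_def by blast
    then have "c \<noteq> b" using T 3 unfolding triples_def by auto
    moreover have "d = c" if "d \<in> B" "T \<subseteq> d" for d
      using exactD_unique[OF ex that(1) c(1) that(2) c(2) 3] .
    ultimately show "\<exists>!c. c \<in> B - {b} \<and> T \<subseteq> c" using c by blast
  qed
qed

text \<open>A totally symmetric partial ternary operation \<open>f\<close> with \<open>f p q (f p q r) = r\<close>
  is the same thing as an exact cover: its blocks are the sets \<open>{p, q, r, f p q r}\<close>.\<close>

lemma exact_skein:
  assumes dist: "\<And>p q r. A p q r \<Longrightarrow> distinct [p, q, r, f p q r]"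
    and sym1: "\<And>p q r. A p q r \<Longrightarrow> A q p r \<and> f q p r = f p q r"
    and sym2: "\<And>p q r. A p q r \<Longrightarrow> A p r q \<and> f p r q = f p q r"
    and inv: "\<And>p q r. A p q r \<Longrightarrow> A p q (f p q r) \<and> f p q (f p q r) = r"
  shows "exact {{p, q, r} | p q r. A p q r} {{p, q, r, f p q r} | p q r. A p q r}"
proof -
  \<comment> \<open>Read as a relation of four arguments, the operation is invariant under the three
    adjacent transpositions, hence under all permutations of a block.\<close>
  define R where "R p q r s \<longleftrightarrow> A p q r \<and> f p q r = s" for p q r s
  have s12: "R p q r s = R q p r s" for p q r s unfolding R_def using sym1 by metis
  have s23: "R p q r s = R p r q s" for p q r s unfolding R_def using sym2 by metis
  have s34: "R p q r s = R p q s r" for p q r s unfolding R_def using inv by metis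
  have perm: "A x y z \<and> {x, y, z, f x y z} = {p, q, r, f p q r}"
    if A: "A p q r" and xyz: "{x, y, z} \<subseteq> {p, q, r, f p q r}" "distinct [x, y, z]" for p q r x y z
  proof -
    define s where "s = f p q r"
    have d: "distinct [p, q, r, s]" using dist[OF A] s_def by simp
    have R: "R p q r s" using A by (simp add: R_def s_def)
    have "card ({p, q, r, s} - {x, y, z}) = 1"
      using d xyz card_Diff_subset[of "{x, y, z}" "{p, q, r, s}"] by (simp add: s_def[symmetric])
    then obtain t where "{p, q, r, s} - {x, y, z} = {t}" by (rule card_1_singletonE)
    then have t: "{x, y, z, t} = {p, q, r, s}" "t \<notin> {x, y, z}" using xyz s_def by auto
    \<comment> \<open>The facts \<open>e1\<close>, \<open>e2\<close> and \<open>e3\<close> bring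
      \<open>x\<close>, \<open>y\<close> and \<open>z\<close> to the front one after the other; the
      last argument is then forced to be \<open>t\<close>.\<close>
    have "R q p r s" "R r p q s" "R s p q r"
      using R s12[of p q r s] s23[of p q r s] s12[of p r q s] s34[of p q r s] s23[of p q s r] s12[of p s q r]
      by simp_all
    then have e1: "\<exists>a b c. R u a b c \<and> {u, a, b, c} = {p, q, r, s}" if "u = p \<or> u = q \<or> u = r \<or> u = s" for u
      using that R by (elim disjE; fastforce)
    have x: "x = p \<or> x = q \<or> x = r \<or> x = s" using t by auto
    obtain a b c where 1: "R x a b c" "{x, a, b, c} = {p, q, r, s}" using e1[OF x] by (elim exE conjE)
    have "R x b a c" "R x c a b"
      using 1(1) s23[of x a b c] s34[of x a b c] s23[of x a c b] by simp_all
    then have e2: "\<exists>d e. R x u d e \<and> {x, u, d, e} = {x, a, b, c}" if "u = a \<or> u = b \<or> u = c" for u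
      using that 1(1) by (elim disjE; fastforce)
    have y: "y = a \<or> y = b \<or> y = c" using t(1) 1(2) xyz(2) by auto
    obtain d e where 2: "R x y d e" "{x, y, d, e} = {x, a, b, c}" using e2[OF y] by (elim exE conjE)
    have "R x y e d" using 2(1) s34[of x y d e] by simp
    then have e3: "\<exists>w. R x y u w \<and> {x, y, u, w} = {x, y, d, e}" if "u = d \<or> u = e" for u
      using that 2(1) by (elim disjE; fastforce)
    have z: "z = d \<or> z = e" using t(1) 1(2) 2(2) xyz(2) by auto
    obtain w where 3: "R x y z w" "{x, y, z, w} = {x, y, d, e}" using e3[OF z] by (elim exE conjE)
    have "{x, y, z, w} = {x, y, z, t}" using t(1) 1(2) 2(2) 3(2) by (simp only:)
    then have "t \<in> {x, y, z, w}" by simp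
    then have "R x y z t" using t(2) 3(1) by auto
    then have "A x y z" "f x y z = t" by (simp_all add: R_def)
    then show ?thesis using t(1) s_def by simp
  qed
  show ?thesis unfolding exact_def
  proof (intro conjI ballI)
    fix b assume "b \<in> {{p, q, r, f p q r} | p q r. A p q r}"
    then obtain p q r where b: "b = {p, q, r, f p q r}" "A p q r" by blast
    show "card b = 4" using dist[OF b(2)] b(1) by simp
    show "triples b \<subseteq> {{p, q, r} | p q r. A p q r}"
    proof
      fix T assume "T \<in> triples b"
      then have T: "T \<subseteq> b" "card T = 3" by (auto simp: triples_def)
      obtain x y z where xyz: "T = {x, y, z}" "x \<noteq> y" "x \<noteq> z" "y \<noteq> z" using card3_obtain[OF T(2)] by metis
      then have "A x y z" using perm[OF b(2), of x y z] T b(1) by simp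
      then show "T \<in> {{p, q, r} | p q r. A p q r}" using xyz by blast
    qed
  next
    fix T assume "T \<in> {{p, q, r} | p q r. A p q r}"
    then obtain p q r where T: "T = {p, q, r}" "A p q r" by blast
    show "card T = 3" using T dist[OF T(2)] by simp
    show "\<exists>!b. b \<in> {{p, q, r, f p q r} | p q r. A p q r} \<and> T \<subseteq> b"
    proof (intro ex1I[of _ "{p, q, r, f p q r}"] conjI)
      show "{p, q, r, f p q r} \<in> {{p, q, r, f p q r} | p q r. A p q r}" using T by blast
      show "T \<subseteq> {p, q, r, f p q r}" using T by blast
      fix b assume "b \<in> {{p, q, r, f p q r} | p q r. A p q r} \<and> T \<subseteq> b"
      then obtain x y z where b: "b = {x, y, z, f x y z}" "A x y z" "T \<subseteq> b" by blast
      show "b = {p, q, r, f p q r}" using perm[OF b(2), of p q r] b(1,3) T(1) dist[OF T(2)] by simp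
    qed
  qed
qed

lemma is_SQS_skein:
  assumes "finite X"
    and "\<And>p q r. p \<in> X \<Longrightarrow> q \<in> X \<Longrightarrow> r \<in> X \<Longrightarrow> distinct [p, q, r] \<Longrightarrow>
      f p q r \<in> X - {p, q, r} \<and> f q p r = f p q r \<and> f p r q = f p q r \<and> f p q (f p q r) = r"
  shows "is_SQS X {{p, q, r, f p q r} | p q r. {p, q, r} \<subseteq> X \<and> distinct [p, q, r]}"
proof -
  define A where "A p q r \<longleftrightarrow> {p, q, r} \<subseteq> X \<and> distinct [p, q, r]" for p q r
  have "exact {{p, q, r} | p q r. A p q r} {{p, q, r, f p q r} | p q r. A p q r}"
  proof (rule exact_skein)
    fix p q r assume a: "A p q r"
    then have F: "f p q r \<in> X" "f p q r \<noteq> p" "f p q r \<noteq> q" "f p q r \<noteq> r"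
        "f q p r = f p q r" "f p r q = f p q r" "f p q (f p q r) = r"
      using assms(2)[of p q r] by (simp_all add: A_def)
    have "distinct [p, q, r]" using a by (simp add: A_def)
    then show "distinct [p, q, r, f p q r]" using F(2-4) by auto
    show "A q p r \<and> f q p r = f p q r" using F(5) a unfolding A_def by auto
    show "A p r q \<and> f p r q = f p q r" using F(6) a unfolding A_def by auto
    show "A p q (f p q r) \<and> f p q (f p q r) = r"
      using F(1-4,7) a unfolding A_def by auto
  qed
  moreover have "{{p, q, r} | p q r. A p q r} = triples X"
    unfolding triples_def A_def by (auto elim!: card3_obtain)
  ultimately show ?thesis using assms(1) by (simp add: is_SQS_iff_exact A_def)
qed

text \<open>The operation yields the fourth point of the block through three points; it is symmetric
  because a block is a set. Membership in \<open>B\<close> is recorded because later the skeins of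
  disjoint systems have to be told apart.\<close>

lemma is_SQS_obtain_skein:
  assumes "is_SQS X B"
  shows "\<exists>f. \<forall>p\<in>X. \<forall>q\<in>X. \<forall>r\<in>X. distinct [p, q, r] \<longrightarrow>
      f p q r \<in> X - {p, q, r} \<and> f q p r = f p q r \<and> f p r q = f p q r \<and> f p q (f p q r) = r \<and>
      {p, q, r, f p q r} \<in> B"
proof -
  have ex: "exact (triples X) B" using assms is_SQS_iff_exact by blast
  define f where "f p q r = (THE s. distinct [p, q, r, s] \<and> {p, q, r, s} \<in> B)" for p q r
  have uniq: "s = s'" if "distinct [p, q, r, s]" "{p, q, r, s} \<in> B" "distinct [p, q, r, s']" "{p, q, r, s'} \<in> B"
    for p q r s s'
  proof -
    have "{p, q, r, s} = {p, q, r, s'}"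
      by (rule exactD_unique[OF ex that(2,4), of "{p, q, r}"]) (use that in auto)
    moreover have "s \<in> {p, q, r, s}" by simp
    ultimately have "s \<in> {p, q, r, s'}" by (simp only:)
    then show ?thesis using that(1) by auto
  qed
  have exi: "\<exists>s. distinct [p, q, r, s] \<and> {p, q, r, s} \<in> B \<and> s \<in> X"
    if "p \<in> X" "q \<in> X" "r \<in> X" "distinct [p, q, r]" for p q r
  proof -
    have "{p, q, r} \<in> triples X" using that by simp
    then obtain b where b: "b \<in> B" "{p, q, r} \<subseteq> b" using ex unfolding exact_def by blast
    then have c: "card b = 4" and bX: "b \<subseteq> X" using assms unfolding is_SQS_def by auto
    have "card (b - {p, q, r}) = 1" using b c that card_Diff_subset[of "{p, q, r}" b] by auto
    then obtain s where s: "b - {p, q, r} = {s}" by (rule card_1_singletonE)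
    then have "b = {p, q, r, s}" using b by auto
    then show ?thesis using s b bX that by auto
  qed
  have f: "distinct [p, q, r, f p q r] \<and> {p, q, r, f p q r} \<in> B \<and> f p q r \<in> X"
    if "p \<in> X" "q \<in> X" "r \<in> X" "distinct [p, q, r]" for p q r
  proof -
    have "\<exists>s. distinct [p, q, r, s] \<and> {p, q, r, s} \<in> B \<and> s \<in> X" using that by (rule exi)
    then obtain s where s: "distinct [p, q, r, s]" "{p, q, r, s} \<in> B" "s \<in> X" by (elim exE conjE)
    have "f p q r = s" unfolding f_def using s uniq by (intro the_equality) blast+
    then show ?thesis using s by simp
  qed
  have fI: "s = f p q r" if "{p, q, r, s} \<in> B" "distinct [p, q, r, s]" for p q r s
    unfolding f_def using that uniq[of p q r] by (intro the_equality[symmetric]) blast+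
  show ?thesis
  proof (intro exI[of _ f] ballI impI)
    fix p q r assume *: "p \<in> X" "q \<in> X" "r \<in> X" "distinct [p, q, r]"
    note F = f[OF *]
    have "f p q r = f q p r" using F by (intro fI) (auto simp: insert_commute)
    moreover have "f p q r = f p r q" using F by (intro fI) (auto simp: insert_commute)
    moreover have "r = f p q (f p q r)" using F by (intro fI) (auto simp: insert_commute)
    ultimately show "f p q r \<in> X - {p, q, r} \<and> f q p r = f p q r \<and> f p r q = f p q r \<and>
        f p q (f p q r) = r \<and> {p, q, r, f p q r} \<in> B"
      using F by auto
  qed
qed

lemma is_SQS_image:
  assumes "is_SQS Q B" "inj_on h Q"
  shows "is_SQS (h ` Q) ((`) h ` B)"
proof -
  have ex: "exact (triples Q) B" "finite Q" using assms is_SQS_iff_exact by blast+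
  have "\<Union>(triples Q) \<subseteq> Q" by (auto simp: triples_def)
  then have "exact ((`) h ` triples Q) ((`) h ` B)"
    using exact_image[OF ex(1)] assms(2) inj_on_subset by blast
  moreover have "(`) h ` triples Q = triples (h ` Q)"
  proof (intro set_eqI iffI)
    fix T assume "T \<in> (`) h ` triples Q"
    then obtain U where U: "T = h ` U" "U \<subseteq> Q" "card U = 3" by (auto simp: triples_def)
    then have "card T = 3" using card_image[OF inj_on_subset[OF assms(2) U(2)]] by simp
    then show "T \<in> triples (h ` Q)" using U by (auto simp: triples_def)
  next
    fix T assume "T \<in> triples (h ` Q)"
    then obtain U where U: "T = h ` U" "U \<subseteq> Q" "card T = 3"
      unfolding triples_def by (auto simp: subset_image_iff)
    then have "card U = 3" using card_image[OF inj_on_subset[OF assms(2) U(2)]] by simp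
    then show "T \<in> (`) h ` triples Q" using U by (auto simp: triples_def)
  qed
  ultimately show ?thesis using ex(2) by (simp add: is_SQS_iff_exact)
qed

definition has_SQS :: "nat \<Rightarrow> bool" where
  "has_SQS v \<longleftrightarrow> (\<exists>B. is_SQS {..<v} B)"

lemma has_SQS_iff:
  assumes "finite Q" "card Q = v"
  shows "has_SQS v \<longleftrightarrow> (\<exists>B. is_SQS Q B)"
proof -
  obtain h where h: "bij_betw h {..<v} Q"
    using ex_bij_betw_nat_finite[OF assms(1)] assms(2) by (auto simp: atLeast0LessThan)
  show ?thesis
  proof
    assume "has_SQS v"
    then show "\<exists>B. is_SQS Q B"
      using h is_SQS_image unfolding has_SQS_def bij_betw_def by metis
  next
    assume "\<exists>B. is_SQS Q B"
    moreover have "bij_betw (inv_into {..<v} h) Q {..<v}" by (rule bij_betw_inv_into[OF h])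
    ultimately show "has_SQS v"
      using is_SQS_image unfolding has_SQS_def bij_betw_def by metis
  qed
qed

section \<open>Candelabra systems: doubling, filling of groups, inflation\<close>

section \<open>Candelabra systems\<close>

section \<open>Recursive constructions of Steiner quadruple systems\<close>

text \<open>Every point is replaced by a fibre of two points. Two points of one fibre are completed
  by the other point in the fibre of the third. Three points in different fibres are completed over
  the given block so that the four first coordinates add up to zero modulo 2.\<close>

lemma has_SQS_double:
  assumes "has_SQS v"
  shows "has_SQS (2 * v)"
proof -
  obtain B where "is_SQS {..<v} B" using assms has_SQS_def by blast
  from is_SQS_obtain_skein[OF this] obtain q where q0: "\<forall>x\<in>{..<v}. \<forall>y\<in>{..<v}. \<forall>z\<in>{..<v}. distinct [x, y, z] \<longrightarrow>
      q x y z \<in> {..<v} - {x, y, z} \<and> q y x z = q x y z \<and> q x z y = q x y z \<and> q x y (q x y z) = z \<and>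
      {x, y, z, q x y z} \<in> B" by (elim exE)
  note q = q0[rule_format]
  define f :: "bool \<times> nat \<Rightarrow> bool \<times> nat \<Rightarrow> bool \<times> nat \<Rightarrow> bool \<times> nat" where
    "f = (\<lambda>(s, x) (t, y) (u, z). if x = y then (\<not> u, z) else if x = z then (\<not> t, y)
       else if y = z then (\<not> s, x) else ((s \<noteq> t) \<noteq> u, q x y z))"
  have "is_SQS (UNIV \<times> {..<v}) {{p, q, r, f p q r} | p q r. {p, q, r} \<subseteq> UNIV \<times> {..<v} \<and> distinct [p, q, r]}"
  proof (rule is_SQS_skein)
    fix p q' r :: "bool \<times> nat"
    assume *: "p \<in> UNIV \<times> {..<v}" "q' \<in> UNIV \<times> {..<v}" "r \<in> UNIV \<times> {..<v}" "distinct [p, q', r]"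
    obtain s x where p: "p = (s, x)" by fastforce
    obtain t y where qq: "q' = (t, y)" by fastforce
    obtain u z where r: "r = (u, z)" by fastforce
    show "f p q' r \<in> UNIV \<times> {..<v} - {p, q', r} \<and> f q' p r = f p q' r \<and> f p r q' = f p q' r \<and>
        f p q' (f p q' r) = r"
    proof (cases "distinct [x, y, z]")
      case True
      then show ?thesis using q[of x y z] * unfolding p qq r f_def by auto
    next
      case False
      then show ?thesis using * unfolding p qq r f_def by auto
    qed
  qed simp
  then show ?thesis by (subst has_SQS_iff[of "UNIV \<times> {..<v}"]) auto
qed

text \<open>Index 0 is reserved for the stem, so that the sets \<open>gpts {i} g s\<close>, a group
  together with the stem, intersect exactly in the stem.\<close>

definition gpts :: "nat set \<Rightarrow> nat \<Rightarrow> nat \<Rightarrow> (nat \<times> int) set" where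
  "gpts I g s = I \<times> {0..<int g} \<union> {0} \<times> {0..<int s}"

definition cross :: "nat set \<Rightarrow> nat \<Rightarrow> nat \<Rightarrow> (nat \<times> int) set set" where
  "cross I g s = {T \<in> triples (gpts I g s). \<not> (\<exists>i\<in>I. T \<subseteq> gpts {i} g s)}"

text \<open>\<open>has_CQS g k s\<close> says that a candelabra system of type \<open>(g\<^sup>k : s)\<close> exists; the stem is
  \<open>{0} \<times> {0..<s}\<close> and the groups are \<open>{i} \<times> {0..<g}\<close> for \<open>1 \<le> i \<le> k\<close>.\<close>

definition has_CQS :: "nat \<Rightarrow> nat \<Rightarrow> nat \<Rightarrow> bool" where
  "has_CQS g k s \<longleftrightarrow> (\<exists>B. exact (cross {1..k} g s) B)"

text \<open>One transposition is enough: the block through three of the prescribed points becomes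
  \<open>S\<close> when its fourth point \<open>d\<close> is exchanged with the remaining prescribed
  point \<open>e\<close>.\<close>

lemma SQS_with_block:
  assumes "has_SQS v" "finite Q" "card Q = v" "S \<subseteq> Q" "card S = 4"
  obtains B where "is_SQS Q B" "S \<in> B"
proof -
  obtain B where B: "is_SQS Q B" using assms has_SQS_iff by blast
  have "finite S" using assms(5) card.infinite by fastforce
  then obtain e where e: "e \<in> S" using assms(5) by fastforce
  have c3: "card (S - {e}) = 3" using e assms(5) \<open>finite S\<close> by simp
  have "S - {e} \<subseteq> Q" using assms(4) by blast
  then obtain b where b: "b \<in> B" "S - {e} \<subseteq> b" using B c3 unfolding is_SQS_def by blast
  then have cb: "card b = 4" "b \<subseteq> Q" using B unfolding is_SQS_def by auto
  then have "finite b" using card.infinite by fastforce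
  then have "card (b - (S - {e})) = 1" using b c3 cb \<open>finite S\<close> by (simp add: card_Diff_subset)
  then obtain d where d: "b - (S - {e}) = {d}" by (rule card_1_singletonE)
  define h where "h = (\<lambda>x. if x = d then e else if x = e then d else x)"
  have inj: "inj h" by (auto simp: inj_def h_def)
  have dQ: "d \<in> Q" "e \<in> Q" "d \<in> b" "d \<notin> S - {e}" using d cb e assms(4) by auto
  have hQ: "h ` Q \<subseteq> Q" using dQ by (auto simp: h_def)
  then have "h ` Q = Q" using \<open>finite Q\<close> card_image[OF inj_on_subset[OF inj, of Q]]
    by (intro card_subset_eq) auto
  moreover have "h ` b = S"
  proof -
    have "b = insert d (S - {e})" using d b by blast
    moreover have "h ` (S - {e}) = S - {e}" using dQ by (force simp: h_def)
    ultimately show ?thesis using e by (auto simp: h_def)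
  qed
  ultimately show thesis using is_SQS_image[OF B inj_on_subset[OF inj subset_UNIV]] b that by force
qed

lemma card_gpts:
  assumes "finite I" "0 \<notin> I"
  shows "card (gpts I g s) = card I * g + s"
proof -
  have "I \<times> {0..<int g} \<inter> {0} \<times> {0..<int s} = {}" using assms(2) by blast
  then have "card (gpts I g s) = card (I \<times> {0..<int g}) + card ({0 :: nat} \<times> {0..<int s})"
    unfolding gpts_def using assms(1) by (intro card_Un_disjoint) simp_all
  then show ?thesis by (simp add: card_cartesian_product)
qed

lemma triples_small:
  assumes "finite X" "card X < 3"
  shows "triples X = {}"
proof -
  have "card T \<noteq> 3" if "T \<subseteq> X" for T using card_mono[OF assms(1) that] assms(2) by simp
  then show ?thesis by (simp add: triples_def)
qed

text \<open>Each group is filled together with the stem. A triple of the stem would then be covered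
  once per group; therefore a stem of four points is arranged to be a block of every filling,
  removed there, and added back once. A stem of two points has no triples.\<close>

lemma has_CQS_fill:
  assumes "has_CQS g k s" "has_SQS (g + s)" "s = 2 \<or> s = 4" "k \<ge> 1"
  shows "has_SQS (k * g + s)"
proof -
  let ?I = "{1..k}" and ?S = "{0} \<times> {0..<int s} :: (nat \<times> int) set"
  obtain B0 where B0: "exact (cross ?I g s) B0" using assms has_CQS_def by blast
  have ex_hole: "\<exists>B. exact (triples (gpts {i} g s) - triples ?S) B" if "i \<ge> 1" for i
  proof -
    have Q: "finite (gpts {i} g s)" "card (gpts {i} g s) = g + s" "?S \<subseteq> gpts {i} g s"
      using that card_gpts[of "{i}" g s] by (auto simp: gpts_def)
    show ?thesis
    proof (cases "s = 2")
      case True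
      then have "triples ?S = {}" by (intro triples_small) (simp_all add: card_cartesian_product)
      then show ?thesis using assms(2) has_SQS_iff[OF Q(1,2)] is_SQS_iff_exact[of "gpts {i} g s"] by auto
    next
      case False
      then have "card ?S = 4" using assms(3) by (simp add: card_cartesian_product)
      then obtain B where "is_SQS (gpts {i} g s) B" "?S \<in> B"
        using SQS_with_block[OF assms(2) Q] by blast
      then show ?thesis using exact_remove[of _ B ?S] is_SQS_iff_exact[of "gpts {i} g s" B] by blast
    qed
  qed
  have exS: "\<exists>B. exact (triples ?S) B"
  proof (cases "s = 2")
    case True
    then have "triples ?S = {}" by (intro triples_small) (simp_all add: card_cartesian_product)
    then have "exact (triples ?S) {}" by (simp add: exact_def)
    then show ?thesis by blast
  next
    case False
    then have "card ?S = 4" using assms(3) by (simp add: card_cartesian_product)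
    then have "exact (triples ?S) {?S}" by (auto simp: exact_def triples_def)
    then show ?thesis by blast
  qed
  define B1 where "B1 i = (SOME B. exact (triples (gpts {i} g s) - triples ?S) B)" for i
  have B1: "exact (triples (gpts {i} g s) - triples ?S) (B1 i)" if "i \<ge> 1" for i
    unfolding B1_def by (rule someI_ex[OF ex_hole[OF that]])
  obtain B2 where B2: "exact (triples ?S) B2" using exS by blast
  have int: "gpts {i} g s \<inter> gpts {j} g s \<subseteq> ?S" if "i \<noteq> j" for i j
    using that by (auto simp: gpts_def)
  have "exact (\<Union>i\<in>?I. triples (gpts {i} g s) - triples ?S) (\<Union>i\<in>?I. B1 i)"
  proof (rule exact_UN)
    fix i j assume "i \<in> ?I" "j \<in> ?I" "i \<noteq> j"
    then show "(triples (gpts {i} g s) - triples ?S) \<inter> (triples (gpts {j} g s) - triples ?S) = {}"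
      using int[of i j] unfolding triples_def by blast
  qed (use B1 in auto)
  then have "exact ((\<Union>i\<in>?I. triples (gpts {i} g s) - triples ?S) \<union> triples ?S) ((\<Union>i\<in>?I. B1 i) \<union> B2)"
    by (rule exact_Un[OF _ B2]) blast
  moreover have "(\<Union>i\<in>?I. triples (gpts {i} g s) - triples ?S) \<union> triples ?S = (\<Union>i\<in>?I. triples (gpts {i} g s))"
  proof -
    have "triples ?S \<subseteq> triples (gpts {1} g s)" by (rule triples_mono) (auto simp: gpts_def)
    then show ?thesis using assms(4) by fastforce
  qed
  ultimately have "exact (\<Union>i\<in>?I. triples (gpts {i} g s)) ((\<Union>i\<in>?I. B1 i) \<union> B2)" by simp
  then have "exact (cross ?I g s \<union> (\<Union>i\<in>?I. triples (gpts {i} g s))) (B0 \<union> ((\<Union>i\<in>?I. B1 i) \<union> B2))"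
    by (rule exact_Un[OF B0]) (auto simp: cross_def triples_def)
  moreover have "cross ?I g s \<union> (\<Union>i\<in>?I. triples (gpts {i} g s)) = triples (gpts ?I g s)"
  proof -
    have "gpts {i} g s \<subseteq> gpts ?I g s" if "i \<in> ?I" for i
      using that by (auto simp: gpts_def)
    then show ?thesis unfolding cross_def triples_def by blast
  qed
  moreover have "finite (gpts ?I g s)" by (auto simp: gpts_def)
  ultimately have "is_SQS (gpts ?I g s) (B0 \<union> ((\<Union>i\<in>?I. B1 i) \<union> B2))"
    by (simp add: is_SQS_iff_exact)
  then show ?thesis using has_SQS_iff[OF \<open>finite (gpts ?I g s)\<close>, of "k * g + s"] card_gpts[of ?I g s] by auto
qed

text \<open>The blocks are the sections with sum zero modulo \<open>g\<close>: values at three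
  points of \<open>b\<close> force the value at the fourth.\<close>

lemma exact_transversal:
  fixes b :: "nat set" and g :: nat
  assumes cb: "card b = 4" and g: "g > 0"
  shows "exact {T \<in> triples (b \<times> {0..<int g}). card (fst ` T) = 3}
     {(\<lambda>x. (x, a x)) ` b | a. a ` b \<subseteq> {0..<int g} \<and> int g dvd (\<Sum>x\<in>b. a x)}"
    (is "exact ?T ?B")
  unfolding exact_def
proof (intro conjI ballI)
  have fb: "finite b" using cb card.infinite by fastforce
  fix B assume "B \<in> ?B"
  then obtain a where a: "B = (\<lambda>x. (x, a x)) ` b" "a ` b \<subseteq> {0..<int g}" by blast
  have inj: "inj_on (\<lambda>x. (x, a x)) X" for X by (auto simp: inj_on_def)
  show "card B = 4" using a(1) card_image[OF inj] cb by simp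
  show "triples B \<subseteq> ?T"
  proof
    fix T assume "T \<in> triples B"
    then have T: "T \<subseteq> B" "card T = 3" by (auto simp: triples_def)
    have "inj_on fst B" unfolding a(1) by (auto simp: inj_on_def)
    then have "card (fst ` T) = 3" using T card_image inj_on_subset by metis
    moreover have "T \<subseteq> b \<times> {0..<int g}" using T a by auto
    ultimately show "T \<in> ?T" using T by (simp add: triples_def)
  qed
next
  have fb: "finite b" using cb card.infinite by fastforce
  fix T assume T: "T \<in> ?T"
  then show "card T = 3" by (auto simp: triples_def)
  have T3: "card T = 3" "T \<subseteq> b \<times> {0..<int g}" "card (fst ` T) = 3" using T by (auto simp: triples_def)
  have fT: "finite T" using T3(1) card.infinite by fastforce
  have injT: "inj_on fst T" using T3 fT by (simp add: eq_card_imp_inj_on)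
  define t where "t = fst ` T"
  have tb: "t \<subseteq> b" "finite t" using T3(2) fT by (auto simp: t_def)
  define c where "c x = snd (the_inv_into T fst x)" for x
  have cT: "c x = y" if "(x, y) \<in> T" for x y
    using the_inv_into_f_f[OF injT that] by (simp add: c_def)
  have "card (b - t) = 1" using tb T3(3) cb card_Diff_subset[OF tb(2,1)] by (simp add: t_def)
  then obtain w where w: "b - t = {w}" by (rule card_1_singletonE)
  then have bt: "b = insert w t" "w \<notin> t" using tb by auto
  define a where "a x = (if x = w then (- (\<Sum>x\<in>t. c x)) mod int g else c x)" for x
  have sa: "(\<Sum>x\<in>b. a x) = (- (\<Sum>x\<in>t. c x)) mod int g + (\<Sum>x\<in>t. c x)"
  proof -
    have "(\<Sum>x\<in>t. a x) = (\<Sum>x\<in>t. c x)" using bt(2) by (intro sum.cong) (auto simp: a_def)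
    then show ?thesis using bt tb(2) by (simp add: a_def)
  qed
  then have dvd: "int g dvd (\<Sum>x\<in>b. a x)"
    by (metis add.inverse_inverse diff_minus_eq_add mod_0_imp_dvd mod_diff_left_eq diff_self mod_0 add.commute mod_add_left_eq add.right_inverse)
  have rng: "a ` b \<subseteq> {0..<int g}"
  proof
    fix y assume "y \<in> a ` b"
    then obtain x where x: "x \<in> b" "y = a x" by blast
    show "y \<in> {0..<int g}"
    proof (cases "x = w")
      case True then show ?thesis using x g by (simp add: a_def)
    next
      case False
      then have "x \<in> t" using x bt by auto
      then obtain z where z: "(x, z) \<in> T" by (auto simp: t_def)
      then show ?thesis using x False cT[OF z] T3(2) by (auto simp: a_def)
    qed
  qed
  have Tsub: "T \<subseteq> (\<lambda>x. (x, a x)) ` b"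
  proof
    fix p assume "p \<in> T"
    then obtain x y where p: "p = (x, y)" "(x, y) \<in> T" by (cases p) auto
    then have "x \<in> t" by (force simp: t_def)
    then have "x \<noteq> w" "x \<in> b" using bt by auto
    then show "p \<in> (\<lambda>x. (x, a x)) ` b" using p cT[OF p(2)] by (auto simp: a_def)
  qed
  show "\<exists>!B. B \<in> ?B \<and> T \<subseteq> B"
  proof (intro ex1I[of _ "(\<lambda>x. (x, a x)) ` b"] conjI)
    show "(\<lambda>x. (x, a x)) ` b \<in> ?B" using dvd rng by blast
    show "T \<subseteq> (\<lambda>x. (x, a x)) ` b" by (rule Tsub)
    fix B assume B: "B \<in> ?B \<and> T \<subseteq> B"
    then obtain a' where a': "B = (\<lambda>x. (x, a' x)) ` b" "a' ` b \<subseteq> {0..<int g}" "int g dvd (\<Sum>x\<in>b. a' x)" by blast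
    have on_t: "a' x = c x" if "x \<in> t" for x
    proof -
      have "x \<in> fst ` T" using that by (simp add: t_def)
      then obtain y where "(x, y) \<in> T" by force
      then show ?thesis using cT B a'(1) by fastforce
    qed
    have "(\<Sum>x\<in>b. a' x) = a' w + (\<Sum>x\<in>t. c x)" using bt tb(2) on_t by simp
    then have "int g dvd a' w + (\<Sum>x\<in>t. c x)" using a'(3) by simp
    then have "a' w mod int g = (- (\<Sum>x\<in>t. c x)) mod int g"
      by (simp add: mod_eq_dvd_iff)
    moreover have "0 \<le> a' w" "a' w < int g" using a'(2) bt(1) by auto
    ultimately have "a' w = a w" by (simp add: a_def)
    then have "a' x = a x" if "x \<in> b" for x using that bt on_t by (auto simp: a_def)
    then show "B = (\<lambda>x. (x, a x)) ` b" unfolding a'(1) by (intro image_cong) auto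
  qed
qed

text \<open>This copies a system with groups 1, 2, 3 onto any three groups with the same
  stem.\<close>

lemma cross_image:
  assumes \<phi>: "bij_betw \<phi> I J" and "0 \<notin> I" "0 \<notin> J"
  defines "h \<equiv> \<lambda>(x, a). (if x = 0 then 0 else \<phi> x, a)"
  shows "inj_on h (gpts I g s)" "(`) h ` cross I g s = cross J g s"
proof -
  have \<phi>0: "\<phi> i \<noteq> 0" if "i \<in> I" for i using \<phi> that assms(3) by (auto simp: bij_betw_def)
  have \<phi>i: "inj_on \<phi> I" "\<phi> ` I = J" using \<phi> by (auto simp: bij_betw_def)
  show inj: "inj_on h (gpts I g s)"
  proof (rule inj_onI)
    fix p p' assume p: "p \<in> gpts I g s" "p' \<in> gpts I g s" "h p = h p'"
    obtain x a x' a' where [simp]: "p = (x, a)" "p' = (x', a')" by fastforce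
    have x: "x = 0 \<or> x \<in> I" "x' = 0 \<or> x' \<in> I" using p(1,2) by (auto simp: gpts_def)
    have a: "a = a'" "(if x = 0 then 0 else \<phi> x) = (if x' = 0 then 0 else \<phi> x')" using p(3) by (simp_all add: h_def)
    have "x = x'"
    proof (cases "x = 0 \<or> x' = 0")
      case True then show ?thesis using x a(2) \<phi>0 by (metis (full_types))
    next
      case False then show ?thesis using x a(2) inj_onD[OF \<phi>i(1)] by simp
    qed
    then show "p = p'" using a(1) by simp
  qed
  have him: "h ` gpts K g s = gpts (\<phi> ` K) g s" if "K \<subseteq> I" for K
  proof -
    have "h ` (K \<times> {0..<int g}) = (\<lambda>(x, a). (\<phi> x, a)) ` (K \<times> {0..<int g})"
      using that assms(2) by (intro image_cong) (auto simp: h_def)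
    also have "\<dots> = (\<phi> ` K) \<times> {0..<int g}" by force
    finally have "h ` (K \<times> {0..<int g}) = (\<phi> ` K) \<times> {0..<int g}" .
    moreover have "h ` ({0} \<times> {0..<int s}) = {0} \<times> {0..<int s}"
    proof -
      have "h ` ({0} \<times> {0..<int s}) = id ` ({0} \<times> {0..<int s})" by (intro image_cong) (auto simp: h_def)
      then show ?thesis by simp
    qed
    ultimately show ?thesis by (simp add: gpts_def image_Un)
  qed
  have sub: "gpts {i} g s \<subseteq> gpts I g s" if "i \<in> I" for i using that by (auto simp: gpts_def)
  have iff: "h ` T \<subseteq> gpts {\<phi> i} g s \<longleftrightarrow> T \<subseteq> gpts {i} g s" if "T \<subseteq> gpts I g s" "i \<in> I" for T i
  proof -
    have "gpts {\<phi> i} g s = h ` gpts {i} g s" using him[of "{i}"] that by simp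
    moreover have "h x \<in> h ` gpts {i} g s \<longleftrightarrow> x \<in> gpts {i} g s" if "x \<in> T" for x
      using inj_on_image_mem_iff[OF inj _ sub[OF \<open>i \<in> I\<close>]] \<open>T \<subseteq> gpts I g s\<close> that by blast
    ultimately show ?thesis by (auto simp: image_subset_iff)
  qed
  show "(`) h ` cross I g s = cross J g s"
  proof (intro set_eqI iffI)
    fix T' assume "T' \<in> (`) h ` cross I g s"
    then obtain T where T: "T' = h ` T" "T \<subseteq> gpts I g s" "card T = 3" "\<not> (\<exists>i\<in>I. T \<subseteq> gpts {i} g s)"
      by (auto simp: cross_def triples_def)
    have "T' \<subseteq> gpts J g s" using him[of I] \<phi>i(2) T by auto
    moreover have "card T' = 3" using card_image[OF inj_on_subset[OF inj T(2)]] T by simp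
    moreover have "\<not> (\<exists>j\<in>J. T' \<subseteq> gpts {j} g s)"
    proof
      assume "\<exists>j\<in>J. T' \<subseteq> gpts {j} g s"
      then obtain i where i: "i \<in> I" "T' \<subseteq> gpts {\<phi> i} g s" using \<phi>i(2) by blast
      then have "T \<subseteq> gpts {i} g s" using iff[OF T(2) i(1)] T(1) by simp
      then show False using T(4) i(1) by blast
    qed
    ultimately show "T' \<in> cross J g s" by (simp add: cross_def triples_def)
  next
    fix T' assume "T' \<in> cross J g s"
    then have T': "T' \<subseteq> gpts J g s" "card T' = 3" "\<not> (\<exists>j\<in>J. T' \<subseteq> gpts {j} g s)"
      by (auto simp: cross_def triples_def)
    have "T' \<subseteq> h ` gpts I g s" using T'(1) him[of I] \<phi>i(2) by simp
    then obtain T where T: "T \<subseteq> gpts I g s" "T' = h ` T" by (auto simp only: subset_image_iff)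
    have "card T = 3" using card_image[OF inj_on_subset[OF inj T(1)]] T T' by simp
    moreover have "\<not> (\<exists>i\<in>I. T \<subseteq> gpts {i} g s)"
    proof
      assume "\<exists>i\<in>I. T \<subseteq> gpts {i} g s"
      then obtain i where i: "i \<in> I" "T \<subseteq> gpts {i} g s" by blast
      then have "T' \<subseteq> gpts {\<phi> i} g s" using iff[OF T(1) i(1)] T(2) by simp
      then show False using T'(3) i(1) \<phi>i(2) by blast
    qed
    ultimately have "T \<in> cross I g s" using T by (simp add: cross_def triples_def)
    then show "T' \<in> (`) h ` cross I g s" using T(2) by (rule image_eqI[rotated])
  qed
qed

text \<open>Two indices of which one is 0 would place the triple inside a group with the
  stem.\<close>

lemma cross_fst:
  assumes "T \<in> cross I g s" "I \<noteq> {}" "0 \<notin> I"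
  shows "card (fst ` T) = 3 \<or> card (fst ` T) = 2 \<and> 0 \<notin> fst ` T"
proof -
  have T: "T \<subseteq> gpts I g s" "card T = 3" "\<And>i. i \<in> I \<Longrightarrow> \<not> T \<subseteq> gpts {i} g s"
    using assms by (auto simp: cross_def triples_def)
  have fT: "finite T" by (rule card_ge_0_finite) (simp add: T(2))
  have nsub: "\<not> fst ` T \<subseteq> {0, i}" if "i \<in> I" for i
  proof
    assume "fst ` T \<subseteq> {0, i}"
    have "T \<subseteq> gpts {i} g s"
    proof (rule subsetI)
      fix p assume p: "p \<in> T"
      then have "fst p \<in> {0, i}" using \<open>fst ` T \<subseteq> {0, i}\<close> by blast
      moreover have "p \<in> gpts I g s" using T(1) p by (rule subsetD)
      ultimately show "p \<in> gpts {i} g s" by (cases p) (auto simp: gpts_def assms(3))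
    qed
    then show False using T(3)[OF \<open>i \<in> I\<close>] by blast
  qed
  have subI: "fst ` T \<subseteq> insert 0 I" using T(1) by (auto simp: gpts_def)
  have le: "card (fst ` T) \<le> 3" using card_image_le[OF fT, of fst] T(2) by simp
  have "card (fst ` T) \<noteq> 0" using T(2) fT by auto
  moreover have "card (fst ` T) \<noteq> 1"
  proof
    assume "card (fst ` T) = 1"
    then obtain i where i: "fst ` T = {i}" by (rule card_1_singletonE)
    show False using nsub[of i] i subI assms(2) nsub by auto
  qed
  moreover have "0 \<notin> fst ` T" if c2: "card (fst ` T) = 2"
  proof
    assume 0: "0 \<in> fst ` T"
    then have "card (fst ` T - {0}) = 1" using c2 by simp
    then obtain i where i: "fst ` T - {0} = {i}" by (rule card_1_singletonE)
    have "fst ` T = insert 0 (fst ` T - {0})" by (rule insert_Diff[OF 0, symmetric])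
    then have "fst ` T \<subseteq> {0, i}" by (simp only: i)
    moreover have "i \<in> fst ` T - {0}" by (simp only: i singletonI)
    then have "i \<in> I" using subI by blast
    ultimately show False using nsub[of i] by simp
  qed
  ultimately show ?thesis using le by linarith
qed

text \<open>Point 0 of the system of order \<open>v\<close> turns into the stem and the other points
  turn into groups. A block through 0 carries a copy of the system with three groups, a block that
  misses 0 carries the transversal blocks of sum zero.\<close>

lemma has_CQS_inflate:
  assumes "has_SQS v" "has_CQS g 3 s" "g > 0" "v \<ge> 2"
  shows "has_CQS g (v - 1) s"
proof -
  let ?I = "{1..v - 1}"
  obtain B0 where B0: "is_SQS {..<v} B0" using assms(1) has_SQS_def by blast
  then have ex0: "exact (triples {..<v}) B0" using is_SQS_iff_exact by blast
  obtain C where C: "exact (cross {1..3} g s) C" using assms(2) has_CQS_def by blast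
  define \<T> where "\<T> b = {T \<in> cross ?I g s. fst ` T \<subseteq> b \<and> (0 \<in> b \<or> card (fst ` T) = 3)}" for b
  have Ine: "?I \<noteq> {}" and I0: "0 \<notin> ?I" using assms(4) by simp_all
  \<comment> \<open>The index triple that decides which block is responsible for \<open>T\<close>. A
    triple over only two groups is given the index 0 in addition, since only blocks through 0 carry
    blocks that meet a group twice.\<close>
  define ext where "ext T = fst ` T \<union> (if card (fst ` T) = 3 then {} else {0})" for T :: "(nat \<times> int) set"
  have ext: "card (ext T) = 3" "ext T \<subseteq> {..<v}" if "T \<in> cross ?I g s" for T
  proof -
    have "card T = 3" using that by (simp add: cross_def triples_def)
    then have "finite T" by (intro card_ge_0_finite) simp
    then show "card (ext T) = 3" using cross_fst[OF that Ine I0] by (auto simp: ext_def)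
    have "T \<subseteq> gpts ?I g s" using that by (simp add: cross_def triples_def)
    then have "fst ` T \<subseteq> {..<v}" using assms(4) by (force simp: gpts_def)
    then show "ext T \<subseteq> {..<v}" using assms(4) by (simp add: ext_def)
  qed
  have mem: "T \<in> \<T> b \<longleftrightarrow> ext T \<subseteq> b" if "T \<in> cross ?I g s" for T b
    using that cross_fst[OF that Ine I0] by (auto simp: \<T>_def ext_def)
  have "\<exists>B. exact (\<T> b) B" if b: "b \<in> B0" for b
  proof -
    have cb: "card b = 4" "b \<subseteq> {..<v}" using B0 b by (auto simp: is_SQS_def)
    show ?thesis
    proof (cases "0 \<in> b")
      case False
      have bI: "b \<subseteq> ?I"
      proof
        fix x assume x: "x \<in> b"
        have "x \<noteq> 0" using x False by metis
        moreover have "x < v" using x cb(2) by blast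
        ultimately show "x \<in> ?I" by auto
      qed
      have "\<T> b = {T \<in> triples (b \<times> {0..<int g}). card (fst ` T) = 3}"
      proof (intro set_eqI iffI)
        fix T assume "T \<in> \<T> b"
        then have T: "T \<subseteq> gpts ?I g s" "card T = 3" "fst ` T \<subseteq> b" "card (fst ` T) = 3"
          using False by (auto simp: \<T>_def cross_def triples_def)
        have "T \<subseteq> b \<times> {0..<int g}"
        proof (rule subsetI)
          fix p assume p: "p \<in> T"
          have "p \<in> gpts ?I g s" using T(1) p by (rule subsetD)
          moreover have "fst p \<in> b" using T(3) p by blast
          moreover have "fst p \<noteq> 0" using \<open>fst p \<in> b\<close> False by metis
          ultimately show "p \<in> b \<times> {0..<int g}" by (cases p) (auto simp: gpts_def)
        qed
        then show "T \<in> {T \<in> triples (b \<times> {0..<int g}). card (fst ` T) = 3}" using T by (simp add: triples_def)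
      next
        fix T assume "T \<in> {T \<in> triples (b \<times> {0..<int g}). card (fst ` T) = 3}"
        then have T: "T \<subseteq> b \<times> {0..<int g}" "card T = 3" "card (fst ` T) = 3" by (auto simp: triples_def)
        have fb: "fst ` T \<subseteq> b" using T(1) by auto
        have "T \<subseteq> gpts ?I g s" using subset_trans[OF T(1) Sigma_mono[OF bI subset_refl]] by (auto simp only: gpts_def)
        moreover have "\<not> T \<subseteq> gpts {i} g s" for i
        proof
          assume "T \<subseteq> gpts {i} g s"
          then have sub: "fst ` T \<subseteq> insert 0 {i}" by (auto simp: gpts_def)
          have "0 \<notin> fst ` T" using fb False by (rule contra_subsetD)
          from iffD1[OF subset_insert[OF this] sub] have "fst ` T \<subseteq> {i}" .
          then show False using T(3) card_mono[of "{i}" "fst ` T"] by simp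
        qed
        ultimately have "T \<in> cross ?I g s" using T(2) by (simp add: cross_def triples_def)
        then show "T \<in> \<T> b" using T(3) fb by (simp add: \<T>_def)
      qed
      then show ?thesis using exact_transversal[OF cb(1) assms(3)] by auto
    next
      case True
      have "finite b" by (rule card_ge_0_finite) (simp add: cb(1))
      then have "card {1..3 :: nat} = card (b - {0})" using cb(1) True by simp
      then obtain \<phi> where \<phi>: "bij_betw \<phi> {1..3 :: nat} (b - {0})"
        using finite_same_card_bij[of "{1..3 :: nat}" "b - {0}"] \<open>finite b\<close> by auto
      have "\<Union>(cross {1..3} g s) \<subseteq> gpts {1..3} g s" by (auto simp: cross_def triples_def)
      then have "exact (cross (b - {0}) g s) ((`) (\<lambda>(x, a). (if x = 0 then 0 else \<phi> x, a)) ` C)"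
        using exact_image[OF C inj_on_subset[OF cross_image(1)[OF \<phi>]]] cross_image(2)[OF \<phi>, of g s] by simp
      moreover have "\<T> b = cross (b - {0}) g s"
      proof -
        have *: "T \<subseteq> gpts (b - {0}) g s \<longleftrightarrow> T \<subseteq> gpts ?I g s \<and> fst ` T \<subseteq> b" for T
        proof -
          have "x < v" if "x \<in> b" for x using that cb(2) by blast
          then have "x \<in> b - {0} \<longleftrightarrow> x \<in> ?I \<and> x \<in> b" for x by fastforce
          then have "p \<in> gpts (b - {0}) g s \<longleftrightarrow> p \<in> gpts ?I g s \<and> fst p \<in> b" for p
            using True by (cases p) (auto simp: gpts_def)
          then show ?thesis by blast
        qed
        have j: "\<phi> 1 \<in> b - {0}" using bij_betwE[OF \<phi>] by simp
        \<comment> \<open>If the index \<open>i\<close> lies outside \<open>b\<close>, then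
          \<open>T\<close> lies in the stem and hence in every \<open>gpts {i} g s\<close>.\<close>
        have **: "(\<exists>i\<in>?I. T \<subseteq> gpts {i} g s) \<longleftrightarrow> (\<exists>i\<in>b - {0}. T \<subseteq> gpts {i} g s)" if "fst ` T \<subseteq> b" for T
        proof
          assume "\<exists>i\<in>?I. T \<subseteq> gpts {i} g s"
          then obtain i where i: "i \<in> ?I" "T \<subseteq> gpts {i} g s" by blast
          show "\<exists>i\<in>b - {0}. T \<subseteq> gpts {i} g s"
          proof (cases "i \<in> b")
            case True then show ?thesis using i by auto
          next
            case False
            have "T \<subseteq> gpts {\<phi> 1} g s"
            proof
              fix p assume p: "p \<in> T"
              then have "fst p \<in> b" "p \<in> gpts {i} g s" using that i by auto
              then show "p \<in> gpts {\<phi> 1} g s" using False by (cases p) (auto simp: gpts_def)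
            qed
            then show ?thesis using j by blast
          qed
        next
          assume "\<exists>i\<in>b - {0}. T \<subseteq> gpts {i} g s"
          moreover have "b - {0} \<subseteq> ?I"
          proof (rule subsetI)
            fix x assume "x \<in> b - {0}"
            moreover from this have "x < v" using cb(2) by blast
            ultimately show "x \<in> ?I" by auto
          qed
          ultimately show "\<exists>i\<in>?I. T \<subseteq> gpts {i} g s" by blast
        qed
        show ?thesis
        proof (rule set_eqI)
          fix T
          show "T \<in> \<T> b \<longleftrightarrow> T \<in> cross (b - {0}) g s"
            using True *[of T] **[of T] by (simp add: \<T>_def cross_def triples_def) metis
        qed
      qed
      ultimately show ?thesis by auto
    qed
  qed
  note exb = this
  have B: "exact (\<T> b) (SOME B. exact (\<T> b) B)" if "b \<in> B0" for b
    by (rule someI_ex[OF exb[OF that]])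
  have "exact (\<Union>b\<in>B0. \<T> b) (\<Union>b\<in>B0. SOME B. exact (\<T> b) B)"
  proof (rule exact_UN)
    fix b b' assume b: "b \<in> B0" "b' \<in> B0" "b \<noteq> b'"
    show "\<T> b \<inter> \<T> b' = {}"
    proof (rule ccontr)
      assume "\<T> b \<inter> \<T> b' \<noteq> {}"
      then obtain T where T: "T \<in> \<T> b" "T \<in> \<T> b'" by blast
      then have c: "T \<in> cross ?I g s" by (simp add: \<T>_def)
      then show False using exactD_unique[OF ex0 b(1,2), of "ext T"] T mem[OF c] ext[OF c] b(3) by blast
    qed
  qed (rule B)
  moreover have "(\<Union>b\<in>B0. \<T> b) = cross ?I g s"
  proof
    show "(\<Union>b\<in>B0. \<T> b) \<subseteq> cross ?I g s" by (auto simp: \<T>_def)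
    show "cross ?I g s \<subseteq> (\<Union>b\<in>B0. \<T> b)"
    proof
      fix T assume T: "T \<in> cross ?I g s"
      then have "ext T \<in> triples {..<v}" using ext by (simp add: triples_def)
      then obtain b where "b \<in> B0" "ext T \<subseteq> b" using ex0 unfolding exact_def by blast
      then show "T \<in> (\<Union>b\<in>B0. \<T> b)" using mem[OF T] by blast
    qed
  qed
  ultimately show ?thesis unfolding has_CQS_def by auto
qed

section \<open>One-factorizations of complete graphs\<close>

section \<open>Quadrupling\<close>

text \<open>A one-factorization of the graph \<open>E\<close>: each colour class is a perfect
  matching. The colour is taken from an edge \<open>z z'\<close>, which avoids naming the set of
  colours.\<close>

definition factorizes :: "'a set \<Rightarrow> ('a \<Rightarrow> 'a \<Rightarrow> bool) \<Rightarrow> ('a \<Rightarrow> 'a \<Rightarrow> 'c) \<Rightarrow> bool" where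
  "factorizes V E \<kappa> \<longleftrightarrow> (\<forall>x\<in>V. \<forall>y\<in>V. E x y \<longrightarrow> x \<noteq> y \<and> E y x \<and> \<kappa> y x = \<kappa> x y) \<and>
     (\<forall>x\<in>V. \<forall>z\<in>V. \<forall>z'\<in>V. E z z' \<longrightarrow> (\<exists>!w. w \<in> V \<and> E x w \<and> \<kappa> x w = \<kappa> z z'))"

lemma factorizes_mate:
  assumes "factorizes V E \<kappa>"
  obtains \<mu> where "\<And>x z z'. x \<in> V \<Longrightarrow> z \<in> V \<Longrightarrow> z' \<in> V \<Longrightarrow> E z z' \<Longrightarrow>
      \<mu> x (\<kappa> z z') \<in> V \<and> E x (\<mu> x (\<kappa> z z')) \<and> \<kappa> x (\<mu> x (\<kappa> z z')) = \<kappa> z z' \<and> \<mu> (\<mu> x (\<kappa> z z')) (\<kappa> z z') = x"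
    "\<And>x y. x \<in> V \<Longrightarrow> y \<in> V \<Longrightarrow> E x y \<Longrightarrow> \<mu> x (\<kappa> x y) = y"
proof -
  define \<mu> where "\<mu> x c = (THE w. w \<in> V \<and> E x w \<and> \<kappa> x w = c)" for x c
  have ex: "\<exists>!w. w \<in> V \<and> E x w \<and> \<kappa> x w = \<kappa> z z'" if "x \<in> V" "z \<in> V" "z' \<in> V" "E z z'" for x z z'
    using assms that unfolding factorizes_def by simp
  have 1: "\<mu> x (\<kappa> z z') \<in> V \<and> E x (\<mu> x (\<kappa> z z')) \<and> \<kappa> x (\<mu> x (\<kappa> z z')) = \<kappa> z z'"
    if "x \<in> V" "z \<in> V" "z' \<in> V" "E z z'" for x z z'
    unfolding \<mu>_def by (rule theI'[OF ex[OF that]])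
  have 2: "\<mu> x (\<kappa> x y) = y" if "x \<in> V" "y \<in> V" "E x y" for x y
    unfolding \<mu>_def by (rule the1_equality[OF ex[OF that(1) that]]) (use that in simp)
  have 3: "\<mu> (\<mu> x (\<kappa> z z')) (\<kappa> z z') = x" if "x \<in> V" "z \<in> V" "z' \<in> V" "E z z'" for x z z'
  proof -
    define w where "w = \<mu> x (\<kappa> z z')"
    have w: "w \<in> V" "E x w" "\<kappa> x w = \<kappa> z z'" using 1[OF that] by (simp_all add: w_def)
    then have "E w x" "\<kappa> w x = \<kappa> z z'" using assms that(1) unfolding factorizes_def by auto
    then show ?thesis using 2[OF w(1) that(1)] by (simp add: w_def)
  qed
  show thesis using that[of \<mu>] 1 2 3 by simp
qed

text \<open>The classical construction: \<open>N\<close> is a point at infinity, finite points are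
  coloured by their sum modulo the odd number \<open>N\<close>, and the edge from \<open>y\<close>
  to infinity takes the colour \<open>2 y\<close> that is still missing at \<open>y\<close>.\<close>

lemma factorizes_complete:
  assumes "even g" "g \<ge> 2"
  shows "\<exists>\<kappa> :: int \<Rightarrow> int \<Rightarrow> int. factorizes {0..<int g} (\<noteq>) \<kappa> \<and> (\<forall>x y. \<kappa> x y = \<kappa> y x)"
proof -
  define N where "N = int g - 1"
  define H where "H = int g div 2"
  have N: "N \<ge> 1" "int g = N + 1" and H: "2 * H = N + 1" using assms by (auto simp: N_def H_def)
  define \<kappa> where "\<kappa> x y = (if x = N then 2 * y mod N else if y = N then 2 * x mod N else (x + y) mod N)" for x y :: int
  have inj: "u = v" if "0 \<le> u" "u < N" "0 \<le> v" "v < N" "N dvd u - v" for u v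
    using that by (metis mod_eq_dvd_iff mod_pos_pos_trivial)
  \<comment> \<open>Since \<open>2 * H = N + 1\<close>, multiplication by \<open>H\<close> inverts
    multiplication by 2 modulo \<open>N\<close>.\<close>
  have half: "N dvd u" if "N dvd 2 * u" for u
  proof -
    have "N dvd H * (2 * u)" using that by simp
    moreover have "H * (2 * u) = (2 * H) * u" by simp
    then have "H * (2 * u) = N * u + u" unfolding H by (simp add: distrib_right)
    ultimately show ?thesis by (metis dvd_add_right_iff dvd_triv_left)
  qed
  have "\<exists>!w. w \<in> {0..<int g} \<and> x \<noteq> w \<and> \<kappa> x w = c" if x: "x \<in> {0..<int g}" and c: "0 \<le> c" "c < N" for x c
  proof -
    show ?thesis
    proof (cases "x = N")
      case True
      have "2 * ((H * c) mod N) mod N = c"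
      proof -
        have "2 * ((H * c) mod N) mod N = (2 * H * c) mod N" by (simp add: mod_mult_right_eq mult.assoc)
        also have "2 * H * c = c + N * c" unfolding H by (simp add: distrib_right)
        finally show ?thesis using c by simp
      qed
      then have "\<kappa> x ((H * c) mod N) = c" using True by (simp add: \<kappa>_def)
      have ex: "(H * c) mod N \<in> {0..<int g} \<and> x \<noteq> (H * c) mod N"
      proof -
        obtain d where d: "d = (H * c) mod N" by simp
        have "0 \<le> d" "d < N" unfolding d using N by simp_all
        then show ?thesis using N True unfolding d[symmetric] by auto
      qed
      have uniq: "w = (H * c) mod N" if w: "w \<in> {0..<int g} \<and> x \<noteq> w \<and> \<kappa> x w = c" for w
      proof -
        have "2 * w mod N = 2 * ((H * c) mod N) mod N" using w True \<open>\<kappa> x ((H * c) mod N) = c\<close> by (simp add: \<kappa>_def)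
        then have "N dvd 2 * (w - (H * c) mod N)" by (simp add: mod_eq_dvd_iff algebra_simps)
        then have "N dvd w - (H * c) mod N" by (rule half)
        then show ?thesis using w True N by (intro inj) auto
      qed
      show ?thesis
        by (rule ex1I, rule conjI[OF conjunct1[OF ex] conjI[OF conjunct2[OF ex] \<open>\<kappa> x ((H * c) mod N) = c\<close>]], rule uniq)
    next
      case False
      then have xN: "0 \<le> x" "x < N" using x N by auto
      show ?thesis
      proof (cases "2 * x mod N = c")
        case True
        have uniq: "w = N" if w: "w \<in> {0..<int g} \<and> x \<noteq> w \<and> \<kappa> x w = c" for w
        proof (rule ccontr)
          assume "w \<noteq> N"
          then have "(x + w) mod N = 2 * x mod N" using w False True by (simp add: \<kappa>_def)
          then have "N dvd w - x" by (simp add: mod_eq_dvd_iff algebra_simps)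
          then have "w = x" using w xN \<open>w \<noteq> N\<close> N by (intro inj) auto
          then show False using w by simp
        qed
        have ex: "N \<in> {0..<int g} \<and> x \<noteq> N \<and> \<kappa> x N = c" using False True N by (simp add: \<kappa>_def)
        show ?thesis by (rule ex1I, rule ex, rule uniq)
      next
        case nc: False
        define w where "w = (c - x) mod N"
        have w: "0 \<le> w" "w < N" using N by (simp_all add: w_def)
        have s: "(x + w) mod N = c" using c by (simp add: w_def mod_add_right_eq)
        have "x \<noteq> w" using nc s by auto
        then have ex: "w \<in> {0..<int g} \<and> x \<noteq> w \<and> \<kappa> x w = c" using w s False N by (simp add: \<kappa>_def)
        have uniq: "w' = w" if w': "w' \<in> {0..<int g} \<and> x \<noteq> w' \<and> \<kappa> x w' = c" for w'
        proof -
          have "w' \<noteq> N" using w' nc False by (auto simp: \<kappa>_def)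
          then have "(x + w') mod N = (x + w) mod N" using w' False s by (simp add: \<kappa>_def)
          then have "N dvd w' - w" by (simp add: mod_eq_dvd_iff)
          then show ?thesis using w w' \<open>w' \<noteq> N\<close> N by (intro inj) auto
        qed
        show ?thesis by (rule ex1I, rule ex, rule uniq)
      qed
    qed
  qed
  note ex = this
  have rng: "0 \<le> \<kappa> z z'" "\<kappa> z z' < N" for z z' using N by (simp_all add: \<kappa>_def)
  have sym: "\<kappa> y x = \<kappa> x y" for x y by (simp add: \<kappa>_def add.commute)
  have "factorizes {0..<int g} (\<noteq>) \<kappa>"
    unfolding factorizes_def using ex[OF _ rng] sym by blast
  then show ?thesis using sym by blast
qed

section \<open>Candelabra systems of type (g^4 : 2) for even g\<close>

section \<open>Quadrupling\<close>

datatype qpoint = Stem bool | Pt bool bool int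

lemma mod_obtain:
  fixes t n :: int
  obtains k where "t mod n = t + n * k"
proof
  show "t mod n = t + n * (- (t div n))" by (simp add: minus_mult_div_eq_mod)
qed

text \<open>The four groups form two halves \<open>h\<close> of two groups each, told apart by the
  bit \<open>e\<close>. A pair inside a group is joined to pairs of the same colour in the other
  group of its half, and to pairs with one point in each group of the opposite half.\<close>

locale quadrupling =
  fixes g :: nat and \<kappa> :: "int \<Rightarrow> int \<Rightarrow> int" and \<mu> :: "int \<Rightarrow> int \<Rightarrow> int" and m :: int
  assumes m: "int g = 2 * m" "m > 0"
    and \<mu>1: "\<And>x z z'. x \<in> {0..<int g} \<Longrightarrow> z \<in> {0..<int g} \<Longrightarrow> z' \<in> {0..<int g} \<Longrightarrow> z \<noteq> z' \<Longrightarrow>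
      \<mu> x (\<kappa> z z') \<in> {0..<int g} \<and> x \<noteq> \<mu> x (\<kappa> z z') \<and> \<kappa> x (\<mu> x (\<kappa> z z')) = \<kappa> z z' \<and>
      \<mu> (\<mu> x (\<kappa> z z')) (\<kappa> z z') = x"
    and \<mu>2: "\<And>x y. x \<in> {0..<int g} \<Longrightarrow> y \<in> {0..<int g} \<Longrightarrow> x \<noteq> y \<Longrightarrow> \<mu> x (\<kappa> x y) = y"
    and \<kappa>s: "\<And>x y. \<kappa> x y = \<kappa> y x"
begin

text \<open>A bijection modulo \<open>g = 2 m\<close> that sends the couple
  \<open>2 k, 2 k + 1\<close> to \<open>k, k + m\<close>. Thus \<open>2 * r z\<close> modulo
  \<open>g\<close> depends on \<open>z div 2\<close> only, and each even residue is attained by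
  exactly two \<open>z\<close>, one for each stem point.\<close>

definition r :: "int \<Rightarrow> int" where "r z = z div 2 + (z mod 2) * m"
definition r' :: "int \<Rightarrow> int" where "r' y = (if y < m then 2 * y else 2 * (y - m) + 1)"

lemma r_range: "z \<in> {0..<int g} \<Longrightarrow> r z \<in> {0..<int g}"
  and r'_range: "y \<in> {0..<int g} \<Longrightarrow> r' y \<in> {0..<int g}"
  and r'_r: "z \<in> {0..<int g} \<Longrightarrow> r' (r z) = z"
  and r_r': "y \<in> {0..<int g} \<Longrightarrow> r (r' y) = y"
proof -
  show "r z \<in> {0..<int g}" "r' (r z) = z" if "z \<in> {0..<int g}"
  proof -
    have d: "0 \<le> z div 2" "z div 2 < m" using that m by auto
    consider "z mod 2 = 0" "z = 2 * (z div 2)" | "z mod 2 = 1" "z = 2 * (z div 2) + 1"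
      using mult_div_mod_eq[of 2 z] by (cases "even z") (auto simp: odd_iff_mod_2_eq_one even_iff_mod_2_eq_zero)
    then have "r z \<in> {0..<int g} \<and> r' (r z) = z"
      by cases (use d m in \<open>auto simp: r_def r'_def\<close>)
    then show "r z \<in> {0..<int g}" "r' (r z) = z" by auto
  qed
  show "r' y \<in> {0..<int g}" "r (r' y) = y" if "y \<in> {0..<int g}"
  proof -
    have "(2 * (y - m) + 1) div 2 = y - m" "(2 * (y - m) + 1) mod 2 = 1" by presburger+
    then show "r' y \<in> {0..<int g}" "r (r' y) = y" using that m by (auto simp: r_def r'_def)
  qed
qed

lemma two_r: "2 * r z mod int g = 2 * (z div 2) mod int g"
proof -
  have "2 * r z = 2 * (z div 2) + (z mod 2) * int g" using m by (simp add: r_def algebra_simps)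
  then show ?thesis by simp
qed

text \<open>Two points \<open>z, z'\<close> of group \<open>(h, e)\<close> and two points
  \<open>x, x'\<close>, one in each group of the opposite half, form a block when
  \<open>x + x' + e = r z + r z'\<close> modulo \<open>g\<close>, with \<open>e\<close> read as 0 or
  1.\<close>

definition pair :: "bool \<Rightarrow> bool \<Rightarrow> int \<Rightarrow> int \<Rightarrow> bool \<Rightarrow> bool \<Rightarrow> int \<Rightarrow> qpoint" where
  "pair h e z z' h' e' x = (if h' = h then Pt h e' (\<mu> x (\<kappa> z z'))
     else Pt h' (\<not> e') ((r z + r z' - of_bool e - x) mod int g))"

text \<open>The equation behind \<open>pair\<close>, solved for \<open>z'\<close>. If the solution
  is \<open>z\<close> itself, a stem point takes its place. It is selected by the parity of
  \<open>z\<close>, by the parity of the coordinate in the group with bit False, and by the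
  half.\<close>

definition trans :: "bool \<Rightarrow> bool \<Rightarrow> int \<Rightarrow> int \<Rightarrow> bool \<Rightarrow> int \<Rightarrow> qpoint" where
  "trans h e\<^sub>1 x y e z = (if (x + y + of_bool e - 2 * r z) mod int g = 0
     then Stem ((odd (if e\<^sub>1 then y else x) \<noteq> odd z) \<noteq> h)
     else Pt (\<not> h) e (r' ((x + y + of_bool e - r z) mod int g)))"

text \<open>The degenerate blocks of \<open>trans\<close>, read from their stem point. For two
  points in different halves the parity test decides which half holds the fourth point. Eliminating
  the unknown coordinate from the rule in \<open>trans\<close> produces the term
  \<open>e\<^sub>1 \<and> e\<^sub>2\<close>, which makes the test symmetric in the two points except
  for the half; hence exactly one half passes.\<close>

definition stem :: "bool \<Rightarrow> bool \<Rightarrow> bool \<Rightarrow> int \<Rightarrow> bool \<Rightarrow> bool \<Rightarrow> int \<Rightarrow> qpoint" where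
  "stem l h\<^sub>1 e\<^sub>1 x\<^sub>1 h\<^sub>2 e\<^sub>2 x\<^sub>2 = (if h\<^sub>1 = h\<^sub>2
     then Pt (\<not> h\<^sub>1) (odd (x\<^sub>1 + x\<^sub>2)) (2 * (((x\<^sub>1 + x\<^sub>2 + of_bool (odd (x\<^sub>1 + x\<^sub>2))) div 2) mod m)
       + of_bool ((l \<noteq> odd (if e\<^sub>1 then x\<^sub>2 else x\<^sub>1)) \<noteq> h\<^sub>1))
     else if l = (((odd x\<^sub>1 \<noteq> odd x\<^sub>2) \<noteq> (e\<^sub>1 \<and> e\<^sub>2)) \<noteq> h\<^sub>1)
     then Pt h\<^sub>1 (\<not> e\<^sub>1) ((2 * r x\<^sub>2 - of_bool e\<^sub>2 - x\<^sub>1) mod int g)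
     else Pt h\<^sub>2 (\<not> e\<^sub>2) ((2 * r x\<^sub>1 - of_bool e\<^sub>1 - x\<^sub>2) mod int g))"

text \<open>Triples with two or more stem points never satisfy \<open>A\<close>, so the last
  equation is a mere default.\<close>

fun f :: "qpoint \<Rightarrow> qpoint \<Rightarrow> qpoint \<Rightarrow> qpoint" where
  "f (Pt h\<^sub>1 e\<^sub>1 x\<^sub>1) (Pt h\<^sub>2 e\<^sub>2 x\<^sub>2) (Pt h\<^sub>3 e\<^sub>3 x\<^sub>3) =
    (if h\<^sub>1 = h\<^sub>2 \<and> e\<^sub>1 = e\<^sub>2 then pair h\<^sub>1 e\<^sub>1 x\<^sub>1 x\<^sub>2 h\<^sub>3 e\<^sub>3 x\<^sub>3
     else if h\<^sub>1 = h\<^sub>3 \<and> e\<^sub>1 = e\<^sub>3 then pair h\<^sub>1 e\<^sub>1 x\<^sub>1 x\<^sub>3 h\<^sub>2 e\<^sub>2 x\<^sub>2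
     else if h\<^sub>2 = h\<^sub>3 \<and> e\<^sub>2 = e\<^sub>3 then pair h\<^sub>2 e\<^sub>2 x\<^sub>2 x\<^sub>3 h\<^sub>1 e\<^sub>1 x\<^sub>1
     else if h\<^sub>1 = h\<^sub>2 then trans h\<^sub>1 e\<^sub>1 x\<^sub>1 x\<^sub>2 e\<^sub>3 x\<^sub>3
     else if h\<^sub>1 = h\<^sub>3 then trans h\<^sub>1 e\<^sub>1 x\<^sub>1 x\<^sub>3 e\<^sub>2 x\<^sub>2
     else trans h\<^sub>2 e\<^sub>2 x\<^sub>2 x\<^sub>3 e\<^sub>1 x\<^sub>1)"
| "f (Stem l) (Pt h\<^sub>1 e\<^sub>1 x\<^sub>1) (Pt h\<^sub>2 e\<^sub>2 x\<^sub>2) = stem l h\<^sub>1 e\<^sub>1 x\<^sub>1 h\<^sub>2 e\<^sub>2 x\<^sub>2"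
| "f (Pt h\<^sub>1 e\<^sub>1 x\<^sub>1) (Stem l) (Pt h\<^sub>2 e\<^sub>2 x\<^sub>2) = stem l h\<^sub>1 e\<^sub>1 x\<^sub>1 h\<^sub>2 e\<^sub>2 x\<^sub>2"
| "f (Pt h\<^sub>1 e\<^sub>1 x\<^sub>1) (Pt h\<^sub>2 e\<^sub>2 x\<^sub>2) (Stem l) = stem l h\<^sub>1 e\<^sub>1 x\<^sub>1 h\<^sub>2 e\<^sub>2 x\<^sub>2"
| "f _ _ _ = Stem True"

fun ok :: "qpoint \<Rightarrow> bool" where
  "ok (Stem l) = True" | "ok (Pt h e x) = (x \<in> {0..<int g})"

fun grp :: "bool \<Rightarrow> bool \<Rightarrow> qpoint \<Rightarrow> bool" where
  "grp h e (Stem l) = True" | "grp h e (Pt h' e' x) = (h' = h \<and> e' = e)"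

definition A :: "qpoint \<Rightarrow> qpoint \<Rightarrow> qpoint \<Rightarrow> bool" where
  "A p q s \<longleftrightarrow> distinct [p, q, s] \<and> ok p \<and> ok q \<and> ok s \<and> \<not> (\<exists>h e. grp h e p \<and> grp h e q \<and> grp h e s)"

lemma pair_sym: "pair h e z z' h' e' x = pair h e z' z h' e' x"
  by (simp add: pair_def \<kappa>s[of z z'] add.commute)

lemma even_g: "even (int g)" using m by simp

lemma mod_g_parity: "(a :: int) mod int g = 0 \<Longrightarrow> even a"
  using even_g by (metis dvd_trans mod_0_imp_dvd)

lemma trans_sym: "trans h True x y e z = trans h False y x e z"
  by (simp add: trans_def add.commute)

lemma stem_sym:
  "stem l h True x h False y = stem l h False y h True x"
  "stem l True e\<^sub>1 x False e\<^sub>2 y = stem l False e\<^sub>2 y True e\<^sub>1 x"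
  by (auto simp: stem_def add.commute)

lemma A_perm: "A p q s \<Longrightarrow> A q p s" "A p q s \<Longrightarrow> A p s q"
  unfolding A_def by auto

lemma f_sym:
  assumes "A p q s"
  shows "f q p s = f p q s" "f p s q = f p q s"
proof -
  have *: "f q p s = f p q s \<and> f p s q = f p q s"
  proof (cases p; cases q; cases s)
    fix h\<^sub>1 e\<^sub>1 x\<^sub>1 h\<^sub>2 e\<^sub>2 x\<^sub>2 h\<^sub>3 e\<^sub>3 x\<^sub>3
    assume [simp]: "p = Pt h\<^sub>1 e\<^sub>1 x\<^sub>1" "q = Pt h\<^sub>2 e\<^sub>2 x\<^sub>2" "s = Pt h\<^sub>3 e\<^sub>3 x\<^sub>3"
    show ?thesis using assms
      by (cases h\<^sub>1; cases h\<^sub>2; cases h\<^sub>3; cases e\<^sub>1; cases e\<^sub>2; cases e\<^sub>3)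
        (simp_all add: A_def ex_bool_eq trans_sym pair_sym[of _ _ x\<^sub>2 x\<^sub>1] pair_sym[of _ _ x\<^sub>3 x\<^sub>1] pair_sym[of _ _ x\<^sub>3 x\<^sub>2])
  next
    fix l h\<^sub>1 e\<^sub>1 x\<^sub>1 h\<^sub>2 e\<^sub>2 x\<^sub>2
    assume "p = Stem l" "q = Pt h\<^sub>1 e\<^sub>1 x\<^sub>1" "s = Pt h\<^sub>2 e\<^sub>2 x\<^sub>2"
    then show ?thesis using assms
      by (cases h\<^sub>1; cases h\<^sub>2; cases e\<^sub>1; cases e\<^sub>2) (simp_all add: A_def ex_bool_eq stem_sym)
  next
    fix l h\<^sub>1 e\<^sub>1 x\<^sub>1 h\<^sub>2 e\<^sub>2 x\<^sub>2
    assume "p = Pt h\<^sub>1 e\<^sub>1 x\<^sub>1" "q = Stem l" "s = Pt h\<^sub>2 e\<^sub>2 x\<^sub>2"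
    then show ?thesis using assms
      by (cases h\<^sub>1; cases h\<^sub>2; cases e\<^sub>1; cases e\<^sub>2) (simp_all add: A_def ex_bool_eq stem_sym)
  next
    fix l h\<^sub>1 e\<^sub>1 x\<^sub>1 h\<^sub>2 e\<^sub>2 x\<^sub>2
    assume "p = Pt h\<^sub>1 e\<^sub>1 x\<^sub>1" "q = Pt h\<^sub>2 e\<^sub>2 x\<^sub>2" "s = Stem l"
    then show ?thesis using assms
      by (cases h\<^sub>1; cases h\<^sub>2; cases e\<^sub>1; cases e\<^sub>2) (simp_all add: A_def ex_bool_eq stem_sym)
  qed (use assms in \<open>auto simp: A_def\<close>)
  then show "f q p s = f p q s" "f p s q = f p q s" by simp_all
qed

lemma mod_g_eq: "x \<in> {0..<int g} \<Longrightarrow> (y - x) mod int g = 0 \<Longrightarrow> y mod int g = x"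
  by (metis atLeastLessThan_iff diff_add_cancel mod_add_left_eq add_0 mod_pos_pos_trivial)

lemma inv_same_group:
  assumes "A (Pt h e x) (Pt h e y) (Pt h\<^sub>3 e\<^sub>3 z)"
  defines "s \<equiv> f (Pt h e x) (Pt h e y) (Pt h\<^sub>3 e\<^sub>3 z)"
  shows "A (Pt h e x) (Pt h e y) s \<and> f (Pt h e x) (Pt h e y) s = Pt h\<^sub>3 e\<^sub>3 z"
  using assms(1) \<mu>1[of z x y] unfolding s_def A_def
  by (auto simp: pair_def mod_simps)

lemma inv_pair:
  assumes "A (Pt h e x) (Pt h\<^sub>2 e\<^sub>2 y) (Pt h e z)"
  defines "s \<equiv> f (Pt h e x) (Pt h\<^sub>2 e\<^sub>2 y) (Pt h e z)"
  shows "A (Pt h e x) (Pt h\<^sub>2 e\<^sub>2 y) s \<and> f (Pt h e x) (Pt h\<^sub>2 e\<^sub>2 y) s = Pt h e z"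
proof -
  have xyz: "x \<in> {0..<int g}" "y \<in> {0..<int g}" "z \<in> {0..<int g}" "x \<noteq> z" "\<not> (h\<^sub>2 = h \<and> e\<^sub>2 = e)"
    using assms(1) by (auto simp: A_def)
  show ?thesis
  proof (cases "h\<^sub>2 = h")
    case True
    then show ?thesis using xyz \<mu>1[of y x z] \<mu>2[of x z] unfolding s_def A_def
      by (auto simp: pair_def)
  next
    case False
    define w where "w = (r x + r z - of_bool e - y) mod int g"
    have w: "w \<in> {0..<int g}" using m by (simp add: w_def)
    have s: "s = Pt h\<^sub>2 (\<not> e\<^sub>2) w" using False xyz by (auto simp: s_def pair_def w_def)
    obtain k where k: "w = r x + r z - of_bool e - y + int g * k" unfolding w_def by (rule mod_obtain)
    have e1: "(y + w + of_bool e - r x) mod int g = r z"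
      using r_range[OF xyz(3)] unfolding k by simp
    have "y + w + of_bool e - 2 * r x = (r z - r x) + int g * k" unfolding k by simp
    then have "(y + w + of_bool e - 2 * r x) mod int g = (r z - r x) mod int g" by (metis mod_mult_self2)
    moreover have "(r z - r x) mod int g \<noteq> 0"
    proof
      assume "(r z - r x) mod int g = 0"
      then have "r z mod int g = r x" using r_range[OF xyz(1)] by (rule mod_g_eq[rotated])
      then have "r z = r x" using r_range[OF xyz(3)] by simp
      then show False using r'_r xyz by metis
    qed
    ultimately have "trans h\<^sub>2 e\<^sub>2 y w e x = Pt h e z"
      using e1 r'_r[OF xyz(3)] False by (simp add: trans_def)
    then show ?thesis using False xyz w unfolding s A_def by auto
  qed
qed

text \<open>Doubling annihilates the summand \<open>(z mod 2) * m\<close> of \<open>r\<close> modulo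
  \<open>g\<close>, so the degenerate equation fixes \<open>z div 2\<close> and leaves the parity of
  \<open>z\<close> free.\<close>

lemma stem_solve:
  assumes "z \<in> {0..<int g}" "(c - 2 * r z) mod int g = 0"
  shows "even c" "(c div 2) mod m = z div 2"
proof -
  show c: "even c" using mod_g_parity[OF assms(2)] by simp
  have "c mod int g = 2 * r z mod int g" using assms(2) by (simp add: mod_eq_dvd_iff mod_0_imp_dvd)
  then have "c mod (2 * m) = 2 * (z div 2) mod (2 * m)" using two_r m by simp
  moreover have "c = 2 * (c div 2)" using c by simp
  ultimately have "2 * ((c div 2) mod m) = 2 * ((z div 2) mod m)"
    by (metis mod_mult_mult1)
  moreover have "0 \<le> z div 2" "z div 2 < m" using assms(1) m by auto
  ultimately show "(c div 2) mod m = z div 2" by simp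
qed

lemma stem_solution:
  assumes "even c" and z_def: "z = 2 * ((c div 2) mod m) + of_bool b"
  shows "z \<in> {0..<int g}" "(c - 2 * r z) mod int g = 0" "odd z = b"
proof -
  define d where "d = (c div 2) mod m"
  have d: "0 \<le> d" "d < m" unfolding d_def using m by simp_all
  show "z \<in> {0..<int g}" "odd z = b" using d m unfolding z_def d_def[symmetric] by auto
  have "z div 2 = d" unfolding z_def d_def[symmetric] by simp
  then have "2 * r z mod int g = 2 * d mod (2 * m)" using two_r[of z] m by simp
  also have "\<dots> = 2 * (c div 2) mod (2 * m)" unfolding d_def by (simp add: mod_mult_mult1)
  also have "\<dots> = c mod int g" using assms(1) m by simp
  finally show "(c - 2 * r z) mod int g = 0" by (simp add: mod_eq_dvd_iff[symmetric] dvd_imp_mod_0)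
qed

lemma parity_sum: "even (x + y + of_bool e :: int) \<longleftrightarrow> (odd y = (odd x \<noteq> e))"
  by (cases e) auto

text \<open>In terms of \<open>r\<close> the fourth point is the reflection
  \<open>w = c - r z\<close>. Its fixed points are exactly the degenerate case, where a stem point
  takes over.\<close>

lemma inv_mates:
  assumes "A (Pt h e\<^sub>1 x) (Pt h e\<^sub>2 y) (Pt h\<^sub>3 e z)" "h\<^sub>3 \<noteq> h" "e\<^sub>2 \<noteq> e\<^sub>1"
  defines "s \<equiv> f (Pt h e\<^sub>1 x) (Pt h e\<^sub>2 y) (Pt h\<^sub>3 e z)"
  shows "A (Pt h e\<^sub>1 x) (Pt h e\<^sub>2 y) s \<and> f (Pt h e\<^sub>1 x) (Pt h e\<^sub>2 y) s = Pt h\<^sub>3 e z"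
proof -
  have xyz: "x \<in> {0..<int g}" "y \<in> {0..<int g}" "z \<in> {0..<int g}"
    using assms(1) by (auto simp: A_def)
  define c where "c = x + y + of_bool e"
  have s: "s = trans h e\<^sub>1 x y e z" using assms by (auto simp: s_def)
  show ?thesis
  proof (cases "(c - 2 * r z) mod int g = 0")
    case True
    define l where "l = ((odd (if e\<^sub>1 then y else x) \<noteq> odd z) \<noteq> h)"
    have sl: "s = Stem l" using True by (simp add: s trans_def c_def l_def)
    have c: "even c" "(c div 2) mod m = z div 2" using stem_solve[OF xyz(3) True] by auto
    then have oe: "odd (x + y) = e" unfolding c_def by (cases e) auto
    have "stem l h e\<^sub>1 x h e\<^sub>2 y = Pt (\<not> h) e (2 * (z div 2) + of_bool (odd z))"
      using c(2) unfolding stem_def oe c_def[symmetric] l_def by auto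
    also have "2 * (z div 2) + of_bool (odd z) = z" by (cases "even z") auto
    finally show ?thesis using sl assms(2,3) xyz by (auto simp: A_def)
  next
    case False
    define w where "w = (c - r z) mod int g"
    have w: "w \<in> {0..<int g}" using m by (simp add: w_def)
    obtain k where k: "w = c - r z + int g * k" unfolding w_def by (rule mod_obtain)
    have sz: "s = Pt h\<^sub>3 e (r' w)" using False assms(2) by (auto simp: s trans_def c_def[symmetric] w_def)
    have "c - 2 * w = - (c - 2 * r z) + int g * (- 2 * k)" unfolding k by simp
    then have "(c - 2 * w) mod int g = (- (c - 2 * r z)) mod int g" by (metis mod_mult_self2)
    then have nz: "(c - 2 * w) mod int g \<noteq> 0" using False by (metis mod_minus_eq add.inverse_inverse minus_zero mod_0)
    have "c - w = r z + int g * (- k)" unfolding k by simp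
    then have "(c - w) mod int g = r z" using r_range[OF xyz(3)] by (metis atLeastLessThan_iff mod_mult_self2 mod_pos_pos_trivial)
    then have "trans h e\<^sub>1 x y e (r' w) = Pt (\<not> h) e z"
      using nz r_r'[OF w] r'_r[OF xyz(3)] by (simp add: trans_def c_def[symmetric])
    then show ?thesis using sz assms(2,3) xyz r'_range[OF w] by (auto simp: A_def)
  qed
qed

lemma inv_mates':
  assumes "A (Pt h e\<^sub>1 x) (Pt h\<^sub>2 e z) (Pt h e\<^sub>3 y)" "h\<^sub>2 \<noteq> h" "e\<^sub>3 \<noteq> e\<^sub>1"
  defines "s \<equiv> f (Pt h e\<^sub>1 x) (Pt h\<^sub>2 e z) (Pt h e\<^sub>3 y)"
  shows "A (Pt h e\<^sub>1 x) (Pt h\<^sub>2 e z) s \<and> f (Pt h e\<^sub>1 x) (Pt h\<^sub>2 e z) s = Pt h e\<^sub>3 y"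
proof -
  have xyz: "x \<in> {0..<int g}" "y \<in> {0..<int g}" "z \<in> {0..<int g}"
    using assms(1) by (auto simp: A_def)
  define c where "c = x + y + of_bool e"
  have s: "s = trans h e\<^sub>1 x y e z" using assms by (auto simp: s_def)
  show ?thesis
  proof (cases "(c - 2 * r z) mod int g = 0")
    case True
    define l where "l = ((odd (if e\<^sub>1 then y else x) \<noteq> odd z) \<noteq> h)"
    have sl: "s = Stem l" using True by (simp add: s trans_def c_def l_def)
    have "even c" using stem_solve[OF xyz(3) True] by auto
    then have "odd y = (odd x \<noteq> e)" unfolding c_def parity_sum .
    \<comment> \<open>Replacing the parity of \<open>y\<close> by that of \<open>x\<close> and
      \<open>e\<close> turns the test in \<open>trans\<close> into the one in
      \<open>stem\<close>.\<close>
    then have L: "l = (((odd x \<noteq> odd z) \<noteq> (e\<^sub>1 \<and> e)) \<noteq> h)" unfolding l_def by auto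
    have "(2 * r z - of_bool e - x - y) mod int g = 0"
      using True mod_minus_eq[of "c - 2 * r z" "int g"] by (simp add: c_def algebra_simps)
    then have "(2 * r z - of_bool e - x) mod int g = y" by (rule mod_g_eq[OF xyz(2)])
    then have "stem l h e\<^sub>1 x h\<^sub>2 e z = Pt h e\<^sub>3 y" using L assms(2,3) unfolding stem_def by auto
    then show ?thesis using sl assms(2,3) xyz by (auto simp: A_def)
  next
    case False
    define w where "w = (c - r z) mod int g"
    have w: "w \<in> {0..<int g}" using m by (simp add: w_def)
    obtain k where k: "w = c - r z + int g * k" unfolding w_def by (rule mod_obtain)
    have sz: "s = Pt h\<^sub>2 e (r' w)" using False assms(2) by (auto simp: s trans_def c_def[symmetric] w_def)
    have "r' w \<noteq> z"
    proof
      assume "r' w = z"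
      then have "w = r z" using r_r'[OF w] by simp
      then have "c - 2 * r z = int g * (- k)" using k by simp
      then show False using False by simp
    qed
    have "r z + w - of_bool e - x = y + int g * k" unfolding k c_def by simp
    then have "(r z + w - of_bool e - x) mod int g = y"
      using xyz(2) by (metis atLeastLessThan_iff mod_mult_self2 mod_pos_pos_trivial)
    then have "pair h\<^sub>2 e z (r' w) h e\<^sub>1 x = Pt h e\<^sub>3 y"
      using r_r'[OF w] assms(2,3) by (auto simp: pair_def)
    then show ?thesis using sz assms(2,3) xyz r'_range[OF w] \<open>r' w \<noteq> z\<close> by (auto simp: A_def)
  qed
qed

text \<open>The bit \<open>E\<close> is forced: \<open>x + y + E\<close> has to be even in order to
  equal \<open>2 * r z\<close> modulo the even number \<open>g\<close>. The stem point then picks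
  one of the two solutions.\<close>

lemma stem_mates:
  assumes "x \<in> {0..<int g}" "y \<in> {0..<int g}" "e\<^sub>2 \<noteq> e\<^sub>1"
  obtains z E where "stem l h e\<^sub>1 x h e\<^sub>2 y = Pt (\<not> h) E z" "z \<in> {0..<int g}"
    "trans h e\<^sub>1 x y E z = Stem l" "stem l h e\<^sub>1 x (\<not> h) E z = Pt h e\<^sub>2 y"
proof -
  define E where "E = odd (x + y)"
  define b where "b = ((l \<noteq> odd (if e\<^sub>1 then y else x)) \<noteq> h)"
  define c where "c = x + y + of_bool E"
  define z where "z = 2 * ((c div 2) mod m) + of_bool b"
  have "even c" unfolding c_def E_def by (cases "even (x + y)") auto
  note z = stem_solution[OF this z_def]
  have par: "odd y = (odd x \<noteq> E)" using \<open>even c\<close> unfolding c_def parity_sum .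
  have 1: "stem l h e\<^sub>1 x h e\<^sub>2 y = Pt (\<not> h) E z"
    unfolding stem_def E_def[symmetric] c_def[symmetric] b_def[symmetric] z_def by simp
  have 2: "trans h e\<^sub>1 x y E z = Stem l"
    using z(2,3) unfolding trans_def c_def[symmetric] b_def by auto
  have "(2 * r z - of_bool E - x - y) mod int g = 0"
    using z(2) mod_minus_eq[of "c - 2 * r z" "int g"] by (simp add: c_def algebra_simps)
  then have "(2 * r z - of_bool E - x) mod int g = y" by (rule mod_g_eq[OF assms(2)])
  then have 3: "stem l h e\<^sub>1 x (\<not> h) E z = Pt h e\<^sub>2 y"
    using z(3) par assms(3) unfolding stem_def b_def by auto
  show thesis by (rule that[OF 1 z(1) 2 3])
qed

text \<open>The condition on \<open>l\<close> puts the fourth point into half \<open>h\<close>. The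
  opposite case is reached by exchanging the two points, see \<open>stem_sym'\<close>.\<close>

lemma stem_cross:
  assumes "x \<in> {0..<int g}" "z \<in> {0..<int g}" "h\<^sub>2 \<noteq> h" "l = (((odd x \<noteq> odd z) \<noteq> (e\<^sub>1 \<and> e\<^sub>2)) \<noteq> h)"
  obtains y where "stem l h e\<^sub>1 x h\<^sub>2 e\<^sub>2 z = Pt h (\<not> e\<^sub>1) y" "y \<in> {0..<int g}"
    "trans h e\<^sub>1 x y e\<^sub>2 z = Stem l" "stem l h e\<^sub>1 x h (\<not> e\<^sub>1) y = Pt h\<^sub>2 e\<^sub>2 z"
    "stem l h (\<not> e\<^sub>1) y h\<^sub>2 e\<^sub>2 z = Pt h e\<^sub>1 x"
proof -
  define y where "y = (2 * r z - of_bool e\<^sub>2 - x) mod int g"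
  define c where "c = x + y + of_bool e\<^sub>2"
  obtain k where k: "y = 2 * r z - of_bool e\<^sub>2 - x + int g * k" unfolding y_def by (rule mod_obtain)
  have y: "y \<in> {0..<int g}" using m by (simp add: y_def)
  have c0: "(c - 2 * r z) mod int g = 0" unfolding c_def k by simp
  have c: "even c" "(c div 2) mod m = z div 2" using stem_solve[OF assms(2) c0] by auto
  have par: "odd y = (odd x \<noteq> e\<^sub>2)" using c(1) unfolding c_def parity_sum .
  have oe: "odd (x + y) = e\<^sub>2" using par by auto
  have 1: "stem l h e\<^sub>1 x h\<^sub>2 e\<^sub>2 z = Pt h (\<not> e\<^sub>1) y" using assms(3,4) by (auto simp: stem_def y_def)
  have 2: "trans h e\<^sub>1 x y e\<^sub>2 z = Stem l"
    using c0 assms(4) par unfolding trans_def c_def[symmetric] by auto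
  have "stem l h e\<^sub>1 x h (\<not> e\<^sub>1) y = Pt (\<not> h) e\<^sub>2 (2 * (z div 2) + of_bool (odd z))"
    using c(2) assms(4) par unfolding stem_def oe c_def[symmetric] by auto
  also have "2 * (z div 2) + of_bool (odd z) = z" by (cases "even z") auto
  finally have 3: "stem l h e\<^sub>1 x h (\<not> e\<^sub>1) y = Pt h\<^sub>2 e\<^sub>2 z" using assms(3) by auto
  have "(2 * r z - of_bool e\<^sub>2 - y) mod int g = x"
    by (rule mod_g_eq[OF assms(1)]) (simp add: k)
  then have 4: "stem l h (\<not> e\<^sub>1) y h\<^sub>2 e\<^sub>2 z = Pt h e\<^sub>1 x" using assms(3,4) par by (auto simp: stem_def)
  show thesis by (rule that[OF 1 y 2 3 4])
qed

lemma stem_sym': "h\<^sub>1 \<noteq> h\<^sub>2 \<Longrightarrow> stem l h\<^sub>1 e\<^sub>1 x h\<^sub>2 e\<^sub>2 y = stem l h\<^sub>2 e\<^sub>2 y h\<^sub>1 e\<^sub>1 x"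
  using stem_sym(2) by (cases h\<^sub>1; cases h\<^sub>2) auto

lemma A_Stem: "A (Stem l) (Pt h\<^sub>1 e\<^sub>1 x) (Pt h\<^sub>2 e\<^sub>2 y) \<longleftrightarrow>
    x \<in> {0..<int g} \<and> y \<in> {0..<int g} \<and> \<not> (h\<^sub>1 = h\<^sub>2 \<and> e\<^sub>1 = e\<^sub>2)"
  by (auto simp: A_def)

lemma inv_Stem1:
  assumes a: "A (Stem l) (Pt h\<^sub>1 e\<^sub>1 x) (Pt h\<^sub>2 e\<^sub>2 y)"
  defines "s \<equiv> f (Stem l) (Pt h\<^sub>1 e\<^sub>1 x) (Pt h\<^sub>2 e\<^sub>2 y)"
  shows "A (Stem l) (Pt h\<^sub>1 e\<^sub>1 x) s \<and> f (Stem l) (Pt h\<^sub>1 e\<^sub>1 x) s = Pt h\<^sub>2 e\<^sub>2 y"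
    and "f (Pt h\<^sub>1 e\<^sub>1 x) (Pt h\<^sub>2 e\<^sub>2 y) s = Stem l" "A (Pt h\<^sub>1 e\<^sub>1 x) (Pt h\<^sub>2 e\<^sub>2 y) s"
proof -
  have xy: "x \<in> {0..<int g}" "y \<in> {0..<int g}" "\<not> (h\<^sub>1 = h\<^sub>2 \<and> e\<^sub>1 = e\<^sub>2)" using a A_Stem by auto
  consider "h\<^sub>1 = h\<^sub>2" | "h\<^sub>2 \<noteq> h\<^sub>1" "l = (((odd x \<noteq> odd y) \<noteq> (e\<^sub>1 \<and> e\<^sub>2)) \<noteq> h\<^sub>1)"
    | "h\<^sub>1 \<noteq> h\<^sub>2" "l = (((odd y \<noteq> odd x) \<noteq> (e\<^sub>2 \<and> e\<^sub>1)) \<noteq> h\<^sub>2)" by auto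
  then have "(A (Stem l) (Pt h\<^sub>1 e\<^sub>1 x) s \<and> f (Stem l) (Pt h\<^sub>1 e\<^sub>1 x) s = Pt h\<^sub>2 e\<^sub>2 y) \<and>
     f (Pt h\<^sub>1 e\<^sub>1 x) (Pt h\<^sub>2 e\<^sub>2 y) s = Stem l \<and> A (Pt h\<^sub>1 e\<^sub>1 x) (Pt h\<^sub>2 e\<^sub>2 y) s"
  proof cases
    case 1
    then have ne: "e\<^sub>2 \<noteq> e\<^sub>1" using xy by auto
    obtain z E where z: "stem l h\<^sub>1 e\<^sub>1 x h\<^sub>1 e\<^sub>2 y = Pt (\<not> h\<^sub>1) E z" "z \<in> {0..<int g}"
      "trans h\<^sub>1 e\<^sub>1 x y E z = Stem l" "stem l h\<^sub>1 e\<^sub>1 x (\<not> h\<^sub>1) E z = Pt h\<^sub>1 e\<^sub>2 y"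
      using stem_mates[OF xy(1,2) ne, of l h\<^sub>1] by metis
    have "s = Pt (\<not> h\<^sub>1) E z" using z(1) 1 by (simp add: s_def)
    then show ?thesis using z 1 ne xy by (auto simp: A_def)
  next
    case 2
    obtain z where z: "stem l h\<^sub>1 e\<^sub>1 x h\<^sub>2 e\<^sub>2 y = Pt h\<^sub>1 (\<not> e\<^sub>1) z" "z \<in> {0..<int g}"
      "trans h\<^sub>1 e\<^sub>1 x z e\<^sub>2 y = Stem l" "stem l h\<^sub>1 e\<^sub>1 x h\<^sub>1 (\<not> e\<^sub>1) z = Pt h\<^sub>2 e\<^sub>2 y"
      using stem_cross[OF xy(1,2) 2] by metis
    have "s = Pt h\<^sub>1 (\<not> e\<^sub>1) z" using z(1) by (simp add: s_def)
    then show ?thesis using z 2(1) xy by (auto simp: A_def)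
  next
    case 3
    obtain z where z: "stem l h\<^sub>2 e\<^sub>2 y h\<^sub>1 e\<^sub>1 x = Pt h\<^sub>2 (\<not> e\<^sub>2) z" "z \<in> {0..<int g}"
      "trans h\<^sub>2 e\<^sub>2 y z e\<^sub>1 x = Stem l" "stem l h\<^sub>2 (\<not> e\<^sub>2) z h\<^sub>1 e\<^sub>1 x = Pt h\<^sub>2 e\<^sub>2 y"
      using stem_cross[OF xy(2,1) 3] by metis
    have "s = Pt h\<^sub>2 (\<not> e\<^sub>2) z" using z(1) stem_sym'[OF 3(1)] by (simp add: s_def)
    then show ?thesis using z(2-4) 3(1) xy stem_sym'[OF 3(1)] by (auto simp: A_def)
  qed
  then show "A (Stem l) (Pt h\<^sub>1 e\<^sub>1 x) s \<and> f (Stem l) (Pt h\<^sub>1 e\<^sub>1 x) s = Pt h\<^sub>2 e\<^sub>2 y"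
    "f (Pt h\<^sub>1 e\<^sub>1 x) (Pt h\<^sub>2 e\<^sub>2 y) s = Stem l" "A (Pt h\<^sub>1 e\<^sub>1 x) (Pt h\<^sub>2 e\<^sub>2 y) s" by blast+
qed

lemma inv_swap:
  assumes "A p q s" "A q p (f q p s) \<and> f q p (f q p s) = s"
  shows "A p q (f p q s) \<and> f p q (f p q s) = s"
  using assms f_sym(1)[OF assms(1)] f_sym(1)[of q p "f p q s"] A_perm(1)[of q p "f p q s"] by simp

lemma inv_f:
  assumes a: "A p q s"
  shows "A p q (f p q s) \<and> f p q (f p q s) = s"
proof (cases p)
  case p: (Stem l)
  obtain h\<^sub>1 e\<^sub>1 x h\<^sub>2 e\<^sub>2 y where "q = Pt h\<^sub>1 e\<^sub>1 x" "s = Pt h\<^sub>2 e\<^sub>2 y"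
    using a p by (cases q; cases s) (auto simp: A_def)
  then show ?thesis using inv_Stem1(1)[of l] a p by simp
next
  case p: (Pt h\<^sub>1 e\<^sub>1 x)
  show ?thesis
  proof (cases q)
    case q: (Stem l)
    obtain h\<^sub>2 e\<^sub>2 y where s: "s = Pt h\<^sub>2 e\<^sub>2 y" using a p q by (cases s) (auto simp: A_def)
    show ?thesis by (rule inv_swap[OF a]) (use inv_Stem1(1)[of l] A_perm(1)[OF a] p q s in simp)
  next
    case q: (Pt h\<^sub>2 e\<^sub>2 y)
    show ?thesis
    proof (cases s)
      case s: (Stem l)
      have "A (Stem l) (Pt h\<^sub>1 e\<^sub>1 x) (Pt h\<^sub>2 e\<^sub>2 y)" using a p q s by (auto simp: A_def)
      from inv_Stem1(2,3)[OF this] show ?thesis using p q s by simp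
    next
      case s: (Pt h\<^sub>3 e\<^sub>3 z)
      note a' = a[unfolded p q s] and a'' = A_perm(1)[OF a, unfolded p q s]
      consider "h\<^sub>2 = h\<^sub>1" "e\<^sub>2 = e\<^sub>1" | "h\<^sub>3 = h\<^sub>1" "e\<^sub>3 = e\<^sub>1" | "h\<^sub>3 = h\<^sub>2" "e\<^sub>3 = e\<^sub>2"
        | "h\<^sub>2 = h\<^sub>1" "h\<^sub>3 \<noteq> h\<^sub>1" "e\<^sub>2 \<noteq> e\<^sub>1" | "h\<^sub>3 = h\<^sub>1" "h\<^sub>2 \<noteq> h\<^sub>1" "e\<^sub>3 \<noteq> e\<^sub>1"
        | "h\<^sub>3 = h\<^sub>2" "h\<^sub>1 \<noteq> h\<^sub>2" "e\<^sub>3 \<noteq> e\<^sub>2" by (cases h\<^sub>1; cases h\<^sub>2; cases h\<^sub>3) auto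
      then show ?thesis
      proof cases
        case 1 then show ?thesis using inv_same_group a' p q s by simp
      next
        case 2 then show ?thesis using inv_pair a' p q s by simp
      next
        case 3 show ?thesis by (rule inv_swap[OF a]) (use 3 inv_pair a'' p q s in simp)
      next
        case 4 then show ?thesis using inv_mates a' p q s by simp
      next
        case 5 then show ?thesis using inv_mates' a' p q s by simp
      next
        case 6 show ?thesis by (rule inv_swap[OF a]) (use 6 inv_mates' a'' p q s in simp)
      qed
    qed
  qed
qed

fun enc :: "qpoint \<Rightarrow> nat \<times> int" where
  "enc (Stem l) = (0, of_bool l)" | "enc (Pt h e x) = (1 + 2 * of_bool h + of_bool e, x)"

lemma inj_enc: "inj enc"
proof (rule injI)
  fix p q assume "enc p = enc q"
  then show "p = q" by (cases p; cases q) (auto simp: of_bool_def split: if_splits)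
qed

lemma enc_gpts: "ok p \<Longrightarrow> enc p \<in> gpts {1..4} g 2"
  by (cases p) (auto simp: gpts_def of_bool_def)

lemma enc_hole: "ok p \<Longrightarrow> enc p \<in> gpts {1 + 2 * of_bool h + of_bool e} g 2 \<longleftrightarrow> grp h e p"
  by (cases p) (auto simp: gpts_def of_bool_def split: if_splits)

lemma enc_surj:
  assumes "a \<in> gpts {1..4} g 2"
  obtains p where "ok p" "a = enc p"
proof -
  obtain i x where a: "a = (i, x)" by fastforce
  then consider "i = 0" "x = 0 \<or> x = 1" | "i = 1" | "i = 2" | "i = 3" | "i = 4" using assms by (force simp: gpts_def)
  moreover have "i \<noteq> 0 \<Longrightarrow> x \<in> {0..<int g}" using assms a by (auto simp: gpts_def)
  ultimately show thesis
    using that[of "Stem (x = 1)"] that[of "Pt False False x"] that[of "Pt False True x"]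
      that[of "Pt True False x"] that[of "Pt True True x"] a by cases auto
qed

lemma holes: "(\<exists>i\<in>{1..4}. P i) \<longleftrightarrow> (\<exists>h e. P (1 + 2 * of_bool h + of_bool e :: nat))"
proof -
  have *: "{1..4} = {4, 3, 2, 1 :: nat}" by auto
  have "1 + 2 * of_bool True + of_bool True = (4 :: nat)" "1 + 2 * of_bool True + of_bool False = (3 :: nat)"
    "1 + 2 * of_bool False + of_bool True = (2 :: nat)" "1 + 2 * of_bool False + of_bool False = (1 :: nat)"
    by simp_all
  then show ?thesis unfolding * ex_bool_eq by (simp only: bex_simps disj_assoc simp_thms)
qed

end

context quadrupling
begin

lemma hole3:
  assumes "ok p" "ok q" "ok s"
  shows "{enc p, enc q, enc s} \<subseteq> gpts {1 + 2 * of_bool h + of_bool e} g 2 \<longleftrightarrow> grp h e p \<and> grp h e q \<and> grp h e s"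
  by (simp only: insert_subset empty_subsetI enc_hole[OF assms(1)] enc_hole[OF assms(2)] enc_hole[OF assms(3)] simp_thms)

theorem has_CQS_quad: "has_CQS g 4 2"
proof -
  have "exact {{p, q, s} | p q s. A p q s} {{p, q, s, f p q s} | p q s. A p q s}"
  proof (rule exact_skein)
    fix p q s assume a: "A p q s"
    show "A q p s \<and> f q p s = f p q s" by (rule conjI[OF A_perm(1)[OF a] f_sym(1)[OF a]])
    show "A p s q \<and> f p s q = f p q s" by (rule conjI[OF A_perm(2)[OF a] f_sym(2)[OF a]])
    show "A p q (f p q s) \<and> f p q (f p q s) = s" by (rule inv_f[OF a])
    have "A p q (f p q s)" "A p s (f p q s)"
      using conjunct1[OF inv_f[OF a]] conjunct1[OF inv_f[OF A_perm(2)[OF a]]] f_sym(2)[OF a] by simp_all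
    then have "distinct [p, q, f p q s]" "distinct [p, s, f p q s]" unfolding A_def by simp_all
    moreover have "distinct [p, q, s]" using a unfolding A_def by simp
    ultimately show "distinct [p, q, s, f p q s]" by simp
  qed
  then have "exact ((`) enc ` {{p, q, s} | p q s. A p q s}) ((`) enc ` {{p, q, s, f p q s} | p q s. A p q s})"
    by (rule exact_image) (rule inj_on_subset[OF inj_enc subset_UNIV])
  moreover have "(`) enc ` {{p, q, s} | p q s. A p q s} = cross {1..4} g 2"
  proof (intro set_eqI iffI)
    fix T assume "T \<in> (`) enc ` {{p, q, s} | p q s. A p q s}"
    then obtain p q s where T: "T = {enc p, enc q, enc s}" and a: "A p q s" by auto
    have "enc p \<noteq> enc q" "enc p \<noteq> enc s" "enc q \<noteq> enc s"
      using a inj_eq[OF inj_enc] by (simp_all add: A_def)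
    then have "T \<in> triples (gpts {1..4} g 2)" using a T enc_gpts by (simp add: A_def)
    moreover have "\<not> (\<exists>i\<in>{1..4}. T \<subseteq> gpts {i} g 2)"
      unfolding holes T using a hole3[of p q s] by (simp only: A_def simp_thms not_False_eq_True)
    ultimately show "T \<in> cross {1..4} g 2" by (simp add: cross_def)
  next
    fix T assume "T \<in> cross {1..4} g 2"
    then have T: "T \<subseteq> gpts {1..4} g 2" "card T = 3" "\<not> (\<exists>i\<in>{1..4}. T \<subseteq> gpts {i} g 2)"
      by (auto simp: cross_def triples_def)
    obtain a b c where abc: "T = {a, b, c}" "a \<noteq> b" "a \<noteq> c" "b \<noteq> c" using card3_obtain[OF T(2)] by metis
    obtain p where p: "ok p" "a = enc p" using enc_surj[of a] T(1) abc(1) by auto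
    obtain q where q: "ok q" "b = enc q" using enc_surj[of b] T(1) abc(1) by auto
    obtain s where s: "ok s" "c = enc s" using enc_surj[of c] T(1) abc(1) by auto
    have "\<not> (\<exists>h e. grp h e p \<and> grp h e q \<and> grp h e s)"
      using T(3) hole3[of p q s] p q s unfolding holes abc(1) by (simp only: simp_thms not_False_eq_True)
    then have "A p q s" using p q s abc by (auto simp: A_def)
    moreover have "T = enc ` {p, q, s}" using abc p q s by simp
    ultimately show "T \<in> (`) enc ` {{p, q, s} | p q s. A p q s}" by blast
  qed
  ultimately show ?thesis unfolding has_CQS_def by auto
qed

end

theorem has_CQS_quadruple:
  assumes "even g" "g \<ge> 2"
  shows "has_CQS g 4 2"
proof -
  obtain \<kappa> :: "int \<Rightarrow> int \<Rightarrow> int" where k: "factorizes {0..<int g} (\<noteq>) \<kappa>" "\<forall>x y. \<kappa> x y = \<kappa> y x"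
    using factorizes_complete[OF assms] by blast
  obtain \<mu> where mu: "\<And>x z z'. x \<in> {0..<int g} \<Longrightarrow> z \<in> {0..<int g} \<Longrightarrow> z' \<in> {0..<int g} \<Longrightarrow> z \<noteq> z' \<Longrightarrow>
      \<mu> x (\<kappa> z z') \<in> {0..<int g} \<and> x \<noteq> \<mu> x (\<kappa> z z') \<and> \<kappa> x (\<mu> x (\<kappa> z z')) = \<kappa> z z' \<and>
      \<mu> (\<mu> x (\<kappa> z z')) (\<kappa> z z') = x"
    "\<And>x y. x \<in> {0..<int g} \<Longrightarrow> y \<in> {0..<int g} \<Longrightarrow> x \<noteq> y \<Longrightarrow> \<mu> x (\<kappa> x y) = y"
    using factorizes_mate[OF k(1)] by blast
  interpret quadrupling g \<kappa> \<mu> "int g div 2"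
  proof
    show "int g = 2 * (int g div 2)" "0 < int g div 2" using assms by auto
    show "\<kappa> x y = \<kappa> y x" for x y using k(2) by simp
  qed (rule mu; assumption)+
  show ?thesis by (rule has_CQS_quad)
qed

section \<open>Candelabra systems with three groups from a rule on coordinate sums\<close>

section \<open>Tripling\<close>

section \<open>Tripling\<close>

text \<open>A transversal triple \<open>(c\<^sub>1, c\<^sub>2, c\<^sub>3)\<close> is completed according to its sum \<open>\<sigma>\<close> modulo \<open>g\<close> and the residue
  \<open>t\<close> of \<open>c\<^sub>2 - c\<^sub>1\<close> modulo \<open>q\<close>: either by the stem point \<open>\<iota> \<sigma>\<close>, or by moving one coordinate \<open>i\<close> by \<open>\<delta>\<close>, where
  \<open>step \<sigma> t = Some (i, \<delta>)\<close>. The function \<open>sg\<close> recovers \<open>\<sigma>\<close> from two points \<open>x\<close>, \<open>x + \<delta>\<close> of group \<open>i\<close> and a point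
  of group \<open>j\<close>; pairs on which it fails are completed inside group \<open>j\<close> by \<open>\<nu>\<close>.\<close>

definition resid :: "nat \<Rightarrow> nat \<Rightarrow> int \<Rightarrow> int \<Rightarrow> int" where
  "resid i j \<tau> \<sigma> = (if i = 1 \<and> j = 2 then \<tau> else if i = 2 \<and> j = 1 then - \<tau> else if i = 1 \<and> j = 3 then \<sigma> - \<tau>
     else if i = 3 \<and> j = 1 then \<sigma> + \<tau> else if i = 2 \<and> j = 3 then \<tau> - \<sigma> else - \<tau> - \<sigma>)"

definition coord :: "nat \<Rightarrow> int \<Rightarrow> nat \<Rightarrow> int \<Rightarrow> int \<Rightarrow> nat \<Rightarrow> int" where
  "coord i x j y z n = (if n = i then x else if n = j then y else z)"

abbreviation grp3 :: "nat \<Rightarrow> bool" where "grp3 i \<equiv> i = 1 \<or> i = 2 \<or> i = 3"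

text \<open>The condition on \<open>step\<close> makes the move an involution: after coordinate
  \<open>i\<close> has moved by \<open>\<delta>\<close>, the rule sends it back. The function
  \<open>\<nu>\<close> matches the pairs of group \<open>i\<close> that no move uses with such pairs
  of group \<open>j\<close>, symmetrically in both groups. \<open>\<iota>\<close> and
  \<open>vl\<close> translate between stem points and the sums that admit no move. The infinite
  families have \<open>q = 1\<close>; groups of size 12 have \<open>q = 3\<close>.\<close>

locale tripling =
  fixes g s :: nat and q :: int
    and step :: "int \<Rightarrow> int \<Rightarrow> (nat \<times> int) option" and sg :: "nat \<Rightarrow> nat \<Rightarrow> int \<Rightarrow> int \<Rightarrow> int option"
    and \<nu> :: "nat \<Rightarrow> nat \<Rightarrow> int \<Rightarrow> int \<Rightarrow> int \<Rightarrow> int" and \<iota> vl :: "int \<Rightarrow> int"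
  assumes g: "g > 0" and q: "q > 0" "q dvd int g" "q dvd 3"
    and step: "\<And>\<sigma> t i \<delta>. \<sigma> \<in> {0..<int g} \<Longrightarrow> t \<in> {0..<q} \<Longrightarrow> step \<sigma> t = Some (i, \<delta>) \<Longrightarrow>
      grp3 i \<and> \<delta> \<in> {0<..<int g} \<and>
      step ((\<sigma> + \<delta>) mod int g) ((t + (if i = 1 then - \<delta> else if i = 2 then \<delta> else 0)) mod q) = Some (i, int g - \<delta>)"
    and sg: "\<And>i j \<delta> \<tau> \<sigma>. grp3 i \<Longrightarrow> grp3 j \<Longrightarrow> i \<noteq> j \<Longrightarrow> \<delta> \<in> {0<..<int g} \<Longrightarrow> \<tau> \<in> {0..<q} \<Longrightarrow>
      sg i j \<delta> \<tau> = Some \<sigma> \<longleftrightarrow> \<sigma> \<in> {0..<int g} \<and> step \<sigma> (resid i j \<tau> \<sigma> mod q) = Some (i, \<delta>)"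
    and \<nu>: "\<And>i j x x' y. grp3 i \<Longrightarrow> grp3 j \<Longrightarrow> i \<noteq> j \<Longrightarrow> x \<in> {0..<int g} \<Longrightarrow> x' \<in> {0..<int g} \<Longrightarrow> x \<noteq> x' \<Longrightarrow>
      y \<in> {0..<int g} \<Longrightarrow> sg i j ((x' - x) mod int g) ((y - x) mod q) = None \<Longrightarrow>
      (let y' = \<nu> i j x x' y in y' \<in> {0..<int g} \<and> y' \<noteq> y \<and> \<nu> i j x' x y = y' \<and>
        sg i j ((x' - x) mod int g) ((y' - x) mod q) = None \<and> \<nu> i j x x' y' = y \<and>
        sg j i ((y' - y) mod int g) ((x - y) mod q) = None \<and> \<nu> j i y y' x = x')"
    and step_None: "\<And>\<sigma> t. \<sigma> \<in> {0..<int g} \<Longrightarrow> t \<in> {0..<q} \<Longrightarrow> step \<sigma> t = None \<Longrightarrow> \<iota> \<sigma> \<in> {0..<int s} \<and> vl (\<iota> \<sigma>) = \<sigma>"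
    and vl: "\<And>a t. a \<in> {0..<int s} \<Longrightarrow> t \<in> {0..<q} \<Longrightarrow> vl a \<in> {0..<int g} \<and> step (vl a) t = None \<and> \<iota> (vl a) = a"
begin

definition tr :: "(nat \<Rightarrow> int) \<Rightarrow> nat \<times> int" where
  "tr c = (case step ((c 1 + c 2 + c 3) mod int g) ((c 2 - c 1) mod q) of
      None \<Rightarrow> (0, \<iota> ((c 1 + c 2 + c 3) mod int g)) | Some (i, \<delta>) \<Rightarrow> (i, (c i + \<delta>) mod int g))"

text \<open>The group indices 1, 2, 3 add up to 6, so \<open>6 - i - j\<close> is the third
  group.\<close>

definition pr :: "nat \<Rightarrow> int \<Rightarrow> int \<Rightarrow> nat \<Rightarrow> int \<Rightarrow> nat \<times> int" where
  "pr i x x' j y = (case sg i j ((x' - x) mod int g) ((y - x) mod q) of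
      None \<Rightarrow> (j, \<nu> i j x x' y) | Some \<sigma> \<Rightarrow> (6 - i - j, (\<sigma> - x - y) mod int g))"

definition st :: "int \<Rightarrow> nat \<Rightarrow> int \<Rightarrow> nat \<Rightarrow> int \<Rightarrow> nat \<times> int" where
  "st a i x j y = (6 - i - j, (vl a - x - y) mod int g)"

abbreviation Z where "Z \<equiv> {0..<int g}"

lemma tr_eq:
  "(c 1 + c 2 + c 3) mod int g = \<sigma> \<Longrightarrow> (c 2 - c 1) mod q = t \<Longrightarrow>
    tr c = (case step \<sigma> t of None \<Rightarrow> (0, \<iota> \<sigma>) | Some (i, \<delta>) \<Rightarrow> (i, (c i + \<delta>) mod int g))"
  by (simp only: tr_def)

lemma diff_range: "x \<in> Z \<Longrightarrow> x' \<in> Z \<Longrightarrow> x \<noteq> x' \<Longrightarrow> (x' - x) mod int g \<in> {0<..<int g}"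
proof -
  assume a: "x \<in> Z" "x' \<in> Z" "x \<noteq> x'"
  have "(x' - x) mod int g \<noteq> 0"
  proof
    assume "(x' - x) mod int g = 0"
    then have "x' mod int g = x mod int g" by (simp add: mod_eq_dvd_iff mod_0_imp_dvd)
    then show False using a by simp
  qed
  moreover have "0 \<le> (x' - x) mod int g" "(x' - x) mod int g < int g" using g by simp_all
  ultimately show ?thesis by simp
qed

text \<open>Because \<open>q\<close> divides 3, the residue of \<open>c 2 - c 1\<close> can be
  computed from the sum and any one difference. For example, with \<open>i = 1\<close> and
  \<open>j = 3\<close> one has
  \<open>\<sigma> - \<tau> = 2 c 1 + c 2 = (c 2 - c 1) + 3 c 1\<close>.\<close>

lemma resid_coord:
  assumes "grp3 i" "grp3 j" "i \<noteq> j" and c: "c = coord i x j y z"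
  defines "\<sigma> \<equiv> (c 1 + c 2 + c 3) mod int g"
  shows "resid i j ((y - x) mod q) \<sigma> mod q = (c 2 - c 1) mod q" "\<sigma> = (x + y + z) mod int g"
proof -
  show sig: "\<sigma> = (x + y + z) mod int g"
    using assms(1-3) unfolding \<sigma>_def c by (auto simp: coord_def algebra_simps)
  obtain k where k: "\<sigma> = x + y + z + int g * k" unfolding sig by (rule mod_obtain)
  obtain l where l: "(y - x) mod q = y - x + q * l" by (rule mod_obtain)
  obtain G where G: "int g = q * G" using q(2) by (rule dvdE)
  obtain T where T: "3 = q * T" using q(3) by (rule dvdE)
  have "q dvd resid i j ((y - x) mod q) \<sigma> - (c 2 - c 1)"
  proof -
    have 3: "q dvd 3 * u" for u using q(3) by (rule dvd_mult2)
    have e: "\<sigma> - ((y - x) mod q) - (y' - x) = 3 * x + (q * G * k - q * l) + (z - y') " if "y' = z" for y'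
      unfolding k l G using that by simp
    consider "i = 1" "j = 2" | "i = 2" "j = 1" | "i = 1" "j = 3" | "i = 3" "j = 1" | "i = 2" "j = 3" | "i = 3" "j = 2"
      using assms(1-3) by auto
    then show ?thesis
    proof cases
      case 1
      then have "resid i j ((y - x) mod q) \<sigma> - (c 2 - c 1) = q * l" by (simp add: resid_def c coord_def l)
      then show ?thesis by simp
    next
      case 2
      then have "resid i j ((y - x) mod q) \<sigma> - (c 2 - c 1) = q * (- l)" by (simp add: resid_def c coord_def l)
      then show ?thesis by simp
    next
      case 3
      then have "resid i j ((y - x) mod q) \<sigma> - (c 2 - c 1) = 3 * x + q * (G * k - l)"
        by (simp add: resid_def c coord_def k l G algebra_simps)
      then show ?thesis using \<open>\<And>u. q dvd 3 * u\<close> by (metis dvd_add dvd_triv_left)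
    next
      case 4
      then have "resid i j ((y - x) mod q) \<sigma> - (c 2 - c 1) = 3 * y + q * (G * k + l)"
        by (simp add: resid_def c coord_def k l G algebra_simps)
      then show ?thesis using \<open>\<And>u. q dvd 3 * u\<close> by (metis dvd_add dvd_triv_left)
    next
      case 5
      then have "resid i j ((y - x) mod q) \<sigma> - (c 2 - c 1) = 3 * (- x) + q * (l - G * k)"
        by (simp add: resid_def c coord_def k l G algebra_simps)
      then show ?thesis using \<open>\<And>u. q dvd 3 * u\<close> by (metis dvd_add dvd_triv_left)
    next
      case 6
      then have "resid i j ((y - x) mod q) \<sigma> - (c 2 - c 1) = 3 * (- y) + q * (- l - G * k)"
        by (simp add: resid_def c coord_def k l G algebra_simps)
      then show ?thesis using \<open>\<And>u. q dvd 3 * u\<close> by (metis dvd_add dvd_triv_left)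
    qed
  qed
  then show "resid i j ((y - x) mod q) \<sigma> mod q = (c 2 - c 1) mod q" by (simp add: mod_eq_dvd_iff)
qed

text \<open>The bridge between the two views of a moved transversal: \<open>sg\<close> inverts
  \<open>step\<close> once the group and the difference are known, and the recovered sum is the sum
  of the triple.\<close>

lemma tr_pr:
  assumes ij: "grp3 i" "grp3 j" "i \<noteq> j" and r: "x \<in> Z" "x' \<in> Z" "x \<noteq> x'" "y \<in> Z" "z \<in> Z"
  shows "tr (coord i x j y z) = (i, x') \<longleftrightarrow>
    sg i j ((x' - x) mod int g) ((y - x) mod q) = Some ((x + y + z) mod int g)"
proof -
  define c where "c = coord i x j y z"
  define \<sigma> where "\<sigma> = (x + y + z) mod int g"
  define t where "t = (c 2 - c 1) mod q"
  define \<delta> where "\<delta> = (x' - x) mod int g"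
  have \<sigma>: "\<sigma> \<in> Z" "(c 1 + c 2 + c 3) mod int g = \<sigma>"
    using g resid_coord(2)[OF ij c_def] by (simp_all add: \<sigma>_def)
  have t: "t \<in> {0..<q}" "resid i j ((y - x) mod q) \<sigma> mod q = t"
    using q(1) resid_coord(1)[OF ij c_def] \<sigma>(2) by (simp_all add: t_def)
  have ci: "c i = x" by (simp add: c_def coord_def)
  have d: "\<delta> \<in> {0<..<int g}" unfolding \<delta>_def by (rule diff_range[OF r(1-3)])
  have "tr c = (i, x') \<longleftrightarrow> step \<sigma> t = Some (i, \<delta>)"
  proof
    assume a: "step \<sigma> t = Some (i, \<delta>)"
    have "(x + \<delta>) mod int g = x'" using r(2) by (simp add: \<delta>_def mod_add_right_eq)
    then show "tr c = (i, x')" using a ci tr_eq[OF \<sigma>(2) t_def[symmetric]] by simp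
  next
    assume a: "tr c = (i, x')"
    then obtain \<delta>' where s: "step \<sigma> t = Some (i, \<delta>')" and x': "(x + \<delta>') mod int g = x'"
      using ij(1) ci unfolding tr_eq[OF \<sigma>(2) t_def[symmetric]] by (cases "step \<sigma> t") auto
    have "\<delta>' \<in> {0<..<int g}" using step[OF \<sigma>(1) t(1) s] by simp
    moreover have "\<delta> = \<delta>' mod int g" unfolding \<delta>_def x'[symmetric] by (simp add: mod_diff_left_eq)
    ultimately show "step \<sigma> t = Some (i, \<delta>)" using s by simp
  qed
  also have "\<dots> \<longleftrightarrow> sg i j \<delta> ((y - x) mod q) = Some \<sigma>"
    using sg[OF ij d, of "(y - x) mod q" \<sigma>] q(1) t(2) \<sigma>(1) by simp
  finally show ?thesis unfolding c_def \<sigma>_def \<delta>_def .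
qed

lemma coord_other:
  assumes "grp3 i" "grp3 j" "i \<noteq> j"
  shows "coord i x j y z n = (if n = i then x else if n = j then y else z)" "grp3 (6 - i - j)" "6 - i - j \<noteq> i" "6 - i - j \<noteq> j"
  using assms by (auto simp: coord_def)

lemma tr_cong: "c 1 = d 1 \<Longrightarrow> c 2 = d 2 \<Longrightarrow> c 3 = d 3 \<Longrightarrow> tr c = tr d"
proof -
  assume "c 1 = d 1" "c 2 = d 2" "c 3 = d 3"
  moreover have "c i = d i" if "step \<sigma> t = Some (i, \<delta>)" "\<sigma> \<in> Z" "t \<in> {0..<q}" for i \<sigma> t \<delta>
    using step[OF that(2,3,1)] calculation by auto
  ultimately show ?thesis unfolding tr_def using g q(1)
    by (auto split: option.splits)
qed

lemma coord_perm:
  assumes "grp3 i" "grp3 j" "i \<noteq> j" "k = 6 - i - j"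
  shows "tr (coord i x j y z) = tr (coord j y i x z)" "tr (coord i x j y z) = tr (coord i x k z y)"
  by (rule tr_cong; use assms in \<open>auto simp: coord_def\<close>)+

text \<open>Moving coordinate \<open>i\<close> by \<open>\<delta>\<close> changes the sum and the
  residue precisely as in the assumption on \<open>step\<close>, which therefore moves the point
  back.\<close>

lemma sg_flip:
  assumes ij: "grp3 i" "grp3 j" "i \<noteq> j" and r: "x \<in> Z" "x' \<in> Z" "x \<noteq> x'" "y \<in> Z" "z \<in> Z"
    and a: "tr (coord i x j y z) = (i, x')"
  shows "tr (coord i x' j y z) = (i, x)"
proof -
  define c where "c = coord i x j y z"
  define c' where "c' = coord i x' j y z"
  define \<sigma> where "\<sigma> = (c 1 + c 2 + c 3) mod int g"
  define t where "t = (c 2 - c 1) mod q"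
  have \<sigma>: "\<sigma> \<in> Z" using g by (simp add: \<sigma>_def)
  have t: "t \<in> {0..<q}" using q(1) by (simp add: t_def)
  have ci: "c i = x" "c' i = x'" by (simp_all add: c_def c'_def coord_def)
  obtain \<delta> where s: "step \<sigma> t = Some (i, \<delta>)" and x': "(x + \<delta>) mod int g = x'"
    using a ij(1) ci unfolding c_def[symmetric] tr_eq[OF \<sigma>_def[symmetric] t_def[symmetric]]
    by (cases "step \<sigma> t") auto
  note st = step[OF \<sigma> t s]
  obtain k where k: "x' = x + \<delta> + int g * k" unfolding x'[symmetric] by (rule mod_obtain)
  obtain G where G: "int g = q * G" using q(2) by (rule dvdE)
  have "c' 1 + c' 2 + c' 3 = c 1 + c 2 + c 3 + \<delta> + int g * k"
    using ij unfolding c_def c'_def coord_def k by auto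
  then have 1: "(c' 1 + c' 2 + c' 3) mod int g = (\<sigma> + \<delta>) mod int g"
    unfolding \<sigma>_def by (simp add: mod_add_left_eq)
  have "c' 2 - c' 1 = c 2 - c 1 + (if i = 1 then - \<delta> else if i = 2 then \<delta> else 0) +
      q * (if i = 1 then - (G * k) else if i = 2 then G * k else 0)"
    using ij unfolding c_def c'_def coord_def k G by auto
  then have 2: "(c' 2 - c' 1) mod q = (t + (if i = 1 then - \<delta> else if i = 2 then \<delta> else 0)) mod q"
    unfolding t_def by (simp add: mod_add_left_eq)
  have "tr c' = (i, (x' + (int g - \<delta>)) mod int g)" unfolding tr_def 1 2 using st ci by simp
  moreover have "x' + (int g - \<delta>) = x + int g * (k + 1)" unfolding k by (simp add: algebra_simps)
  then have "(x' + (int g - \<delta>)) mod int g = x" using r(1) by (metis atLeastLessThan_iff mod_mult_self2 mod_pos_pos_trivial)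
  ultimately show ?thesis by (simp add: c'_def)
qed

lemma tr_cases:
  assumes ij: "grp3 i" "grp3 j" "i \<noteq> j" and r: "x \<in> Z" "y \<in> Z" "z \<in> Z"
  obtains (st) a where "tr (coord i x j y z) = (0, a)" "a \<in> {0..<int s}" "vl a = (x + y + z) mod int g"
  | (move) n w where "tr (coord i x j y z) = (n, w)" "grp3 n" "w \<in> Z" "w \<noteq> coord i x j y z n"
proof -
  define c where "c = coord i x j y z"
  define \<sigma> where "\<sigma> = (c 1 + c 2 + c 3) mod int g"
  define t where "t = (c 2 - c 1) mod q"
  have \<sigma>: "\<sigma> \<in> Z" "\<sigma> = (x + y + z) mod int g" using g resid_coord(2)[OF ij c_def] by (simp_all add: \<sigma>_def)
  have t: "t \<in> {0..<q}" using q(1) by (simp add: t_def)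
  show thesis
  proof (cases "step \<sigma> t")
    case None
    then show ?thesis using that(1)[of "\<iota> \<sigma>"] step_None[OF \<sigma>(1) t None] \<sigma>(2)
      unfolding c_def[symmetric] tr_eq[OF \<sigma>_def[symmetric] t_def[symmetric]] by simp
  next
    case (Some p)
    obtain n \<delta> where p: "p = (n, \<delta>)" by fastforce
    have st: "grp3 n" "\<delta> \<in> {0<..<int g}" using step[OF \<sigma>(1) t] Some p by auto
    have cn: "c n \<in> Z" using r by (simp add: c_def coord_def)
    have "(c n + \<delta>) mod int g \<noteq> c n"
    proof
      assume "(c n + \<delta>) mod int g = c n"
      then have "(c n + \<delta>) mod int g = c n mod int g" using cn by simp
      then have "int g dvd \<delta>" by (simp add: mod_eq_dvd_iff)
      then show False using st(2) zdvd_imp_le by fastforce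
    qed
    then show ?thesis using that(2)[of n "(c n + \<delta>) mod int g"] Some p st g
      unfolding c_def[symmetric] tr_eq[OF \<sigma>_def[symmetric] t_def[symmetric]] by simp
  qed
qed

lemma sum_back:
  assumes "\<sigma> = (u + v + w) mod int g" "w \<in> Z"
  shows "(\<sigma> - u - v) mod int g = w"
proof -
  obtain k where k: "\<sigma> = u + v + w + int g * k" unfolding assms(1) by (rule mod_obtain)
  have "\<sigma> - u - v = w + int g * k" unfolding k by simp
  then show ?thesis using assms(2) by (metis atLeastLessThan_iff mod_mult_self2 mod_pos_pos_trivial)
qed

text \<open>Two kinds of blocks contain a pair of group \<open>i\<close> and a point of group
  \<open>j\<close>: moved transversals, whose fourth point lies in the third group, and blocks with
  two points in each of the groups \<open>i\<close> and \<open>j\<close>.\<close>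

lemma pr_cases:
  assumes ij: "grp3 i" "grp3 j" "i \<noteq> j" and r: "x \<in> Z" "x' \<in> Z" "x \<noteq> x'" "y \<in> Z"
  obtains (third) z where "pr i x x' j y = (6 - i - j, z)" "pr i x' x j y = (6 - i - j, z)" "z \<in> Z"
      "tr (coord i x j y z) = (i, x')" "pr i x x' (6 - i - j) z = (j, y)"
  | (mate) y' where "pr i x x' j y = (j, y')" "pr i x' x j y = (j, y')" "y' \<in> Z" "y' \<noteq> y"
      "pr i x x' j y' = (j, y)" "pr j y y' i x = (i, x')"
proof (cases "sg i j ((x' - x) mod int g) ((y - x) mod q)")
  case (Some \<sigma>)
  have d: "(x' - x) mod int g \<in> {0<..<int g}" by (rule diff_range[OF r(1-3)])
  have \<sigma>: "\<sigma> \<in> Z" using sg[OF ij d, of "(y - x) mod q" \<sigma>] Some q(1) by simp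
  define z where "z = (\<sigma> - x - y) mod int g"
  have z: "z \<in> Z" using g by (simp add: z_def)
  have sz: "(x + y + z) mod int g = \<sigma>" using \<sigma> unfolding z_def by (simp add: mod_add_right_eq)
  have t: "tr (coord i x j y z) = (i, x')" using tr_pr[OF ij r z] Some sz by simp
  have "tr (coord i x' j y z) = (i, x)" by (rule sg_flip[OF ij r z t])
  then have "sg i j ((x - x') mod int g) ((y - x') mod q) = Some ((x' + y + z) mod int g)"
    using tr_pr[OF ij r(2,1) r(3)[symmetric] r(4) z] by simp
  then have 2: "pr i x' x j y = (6 - i - j, z)" using sum_back[OF refl z, of x' y] by (simp add: pr_def)
  define k where "k = 6 - i - j"
  have k: "grp3 k" "k \<noteq> i" "k \<noteq> j" "6 - i - k = j" using ij by (auto simp: k_def)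
  have "tr (coord i x k z y) = (i, x')" using coord_perm(2)[OF ij k_def, of x y z] t by simp
  then have "sg i k ((x' - x) mod int g) ((z - x) mod q) = Some ((x + z + y) mod int g)"
    using tr_pr[OF ij(1) k(1) k(2)[symmetric] r(1-3) z r(4)] by simp
  then have 3: "pr i x x' k z = (j, y)" using sum_back[OF refl r(4), of x z] k(4) by (simp add: pr_def)
  show thesis
    by (rule third[OF _ 2 z t]) (use 3 in \<open>simp_all add: pr_def Some z_def k_def\<close>)
next
  case None
  from \<nu>[OF ij r None] obtain y' where y': "y' = \<nu> i j x x' y" "y' \<in> Z" "y' \<noteq> y" "\<nu> i j x' x y = y'"
      "sg i j ((x' - x) mod int g) ((y' - x) mod q) = None" "\<nu> i j x x' y' = y"
      "sg j i ((y' - y) mod int g) ((x - y) mod q) = None" "\<nu> j i y y' x = x'"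
    by (auto simp: Let_def)
  have "sg i j ((x - x') mod int g) ((y - x') mod q) = None"
  proof (rule ccontr)
    assume "sg i j ((x - x') mod int g) ((y - x') mod q) \<noteq> None"
    then obtain \<sigma> where S: "sg i j ((x - x') mod int g) ((y - x') mod q) = Some \<sigma>" by blast
    have d: "(x - x') mod int g \<in> {0<..<int g}" by (rule diff_range[OF r(2,1) r(3)[symmetric]])
    have \<sigma>: "\<sigma> \<in> Z" using sg[OF ij d, of "(y - x') mod q" \<sigma>] S q(1) by simp
    define z where "z = (\<sigma> - x' - y) mod int g"
    have z: "z \<in> Z" using g by (simp add: z_def)
    have sz: "(x' + y + z) mod int g = \<sigma>" using \<sigma> unfolding z_def by (simp add: mod_add_right_eq)
    have "tr (coord i x' j y z) = (i, x)" using tr_pr[OF ij r(2,1) r(3)[symmetric] r(4) z] S sz by simp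
    then have "tr (coord i x j y z) = (i, x')" by (rule sg_flip[OF ij r(2,1) r(3)[symmetric] r(4) z])
    then show False using tr_pr[OF ij r z] None by simp
  qed
  then show thesis using mate[of y'] y' None by (simp add: pr_def)
qed

text \<open>The sum \<open>vl a\<close> admits no move for any residue, so the sum alone decides
  whether the triple belongs to stem point \<open>a\<close>.\<close>

lemma tr_stem: 
  assumes ij: "grp3 i" "grp3 j" "i \<noteq> j" and r: "x \<in> Z" "y \<in> Z" "z \<in> Z" and a: "a \<in> {0..<int s}"
  shows "tr (coord i x j y z) = (0, a) \<longleftrightarrow> z = (vl a - x - y) mod int g"
proof -
  have *: "z = (vl a - x - y) mod int g \<longleftrightarrow> vl a = (x + y + z) mod int g"
  proof
    assume z: "z = (vl a - x - y) mod int g"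
    have "(x + y + z) mod int g = vl a mod int g" unfolding z by (simp add: mod_add_right_eq)
    moreover have "vl a \<in> Z" using vl[OF a, of 0] q(1) by simp
    ultimately show "vl a = (x + y + z) mod int g" by simp
  next
    assume "vl a = (x + y + z) mod int g"
    from sum_back[OF this r(3)] show "z = (vl a - x - y) mod int g" by (rule sym)
  qed
  define c where "c = coord i x j y z"
  have \<sigma>: "(c 1 + c 2 + c 3) mod int g = (x + y + z) mod int g" using resid_coord(2)[OF ij c_def] .
  show ?thesis
  proof (rule tr_cases[OF ij r])
    fix b assume b: "tr (coord i x j y z) = (0, b)" "b \<in> {0..<int s}" "vl b = (x + y + z) mod int g"
    have "a = b" if "vl a = vl b" using vl[OF a, of 0] vl[OF b(2), of 0] that q(1) by (metis atLeastLessThan_iff order_refl)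
    then show ?thesis using b * by auto
  next
    fix n w assume n: "tr (coord i x j y z) = (n, w)" "grp3 n"
    have "step ((x + y + z) mod int g) ((c 2 - c 1) mod q) \<noteq> None"
      using n unfolding c_def[symmetric] tr_eq[OF \<sigma> refl] by (auto split: option.splits)
    moreover have "step (vl a) ((c 2 - c 1) mod q) = None" using vl[OF a, of "(c 2 - c 1) mod q"] q(1) by simp
    ultimately show ?thesis using n * by auto
  qed
qed

end

context tripling
begin

definition f :: "nat \<times> int \<Rightarrow> nat \<times> int \<Rightarrow> nat \<times> int \<Rightarrow> nat \<times> int" where
  "f = (\<lambda>(i, x) (j, y) (k, z).
     if i = j then pr i x y k z else if i = k then pr i x z j y else if j = k then pr j y z i x
     else if i = 0 then st x j y k z else if j = 0 then st y i x k z else if k = 0 then st z i x j y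
     else tr (coord i x j y z))"

definition A :: "nat \<times> int \<Rightarrow> nat \<times> int \<Rightarrow> nat \<times> int \<Rightarrow> bool" where
  "A p u r \<longleftrightarrow> distinct [p, u, r] \<and> {p, u, r} \<subseteq> gpts {1, 2, 3} g s \<and>
     \<not> (\<exists>n\<in>{1, 2, 3}. {fst p, fst u, fst r} \<subseteq> {0, n})"

lemma A_cases:
  assumes "A p u r"
  obtains (pair12) i x x' j y where "p = (i, x)" "u = (i, x')" "r = (j, y)" "grp3 i" "grp3 j" "i \<noteq> j" "x \<in> Z" "x' \<in> Z" "x \<noteq> x'" "y \<in> Z"
  | (pair13) i x x' j y where "p = (i, x)" "r = (i, x')" "u = (j, y)" "grp3 i" "grp3 j" "i \<noteq> j" "x \<in> Z" "x' \<in> Z" "x \<noteq> x'" "y \<in> Z"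
  | (pair23) i x x' j y where "u = (i, x)" "r = (i, x')" "p = (j, y)" "grp3 i" "grp3 j" "i \<noteq> j" "x \<in> Z" "x' \<in> Z" "x \<noteq> x'" "y \<in> Z"
  | (stem1) a i x j y where "p = (0, a)" "u = (i, x)" "r = (j, y)" "grp3 i" "grp3 j" "i \<noteq> j" "x \<in> Z" "y \<in> Z" "a \<in> {0..<int s}"
  | (stem2) a i x j y where "u = (0, a)" "p = (i, x)" "r = (j, y)" "grp3 i" "grp3 j" "i \<noteq> j" "x \<in> Z" "y \<in> Z" "a \<in> {0..<int s}"
  | (stem3) a i x j y where "r = (0, a)" "p = (i, x)" "u = (j, y)" "grp3 i" "grp3 j" "i \<noteq> j" "x \<in> Z" "y \<in> Z" "a \<in> {0..<int s}"
  | (transv) i x j y z where "p = (i, x)" "u = (j, y)" "r = (6 - i - j, z)" "grp3 i" "grp3 j" "i \<noteq> j" "x \<in> Z" "y \<in> Z" "z \<in> Z"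
proof -
  obtain i x j y k z where pqr: "p = (i, x)" "u = (j, y)" "r = (k, z)" by (metis surj_pair)
  have G: "(grp3 i \<and> x \<in> Z) \<or> (i = 0 \<and> x \<in> {0..<int s})" "(grp3 j \<and> y \<in> Z) \<or> (j = 0 \<and> y \<in> {0..<int s})"
      "(grp3 k \<and> z \<in> Z) \<or> (k = 0 \<and> z \<in> {0..<int s})" "distinct [(i, x), (j, y), (k, z)]"
    using assms unfolding pqr A_def gpts_def by auto
  have H: "\<not> {i, j, k} \<subseteq> {0, 1}" "\<not> {i, j, k} \<subseteq> {0, 2}" "\<not> {i, j, k} \<subseteq> {0, 3}"
    using assms unfolding pqr A_def by auto
  have n: "i = 0 \<or> i = 1 \<or> i = 2 \<or> i = 3" "j = 0 \<or> j = 1 \<or> j = 2 \<or> j = 3" "k = 0 \<or> k = 1 \<or> k = 2 \<or> k = 3"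
    using G(1-3) by blast+
  have x: "i \<noteq> 0 \<Longrightarrow> grp3 i \<and> x \<in> Z" "j \<noteq> 0 \<Longrightarrow> grp3 j \<and> y \<in> Z" "k \<noteq> 0 \<Longrightarrow> grp3 k \<and> z \<in> Z"
      "i = 0 \<Longrightarrow> x \<in> {0..<int s}" "j = 0 \<Longrightarrow> y \<in> {0..<int s}" "k = 0 \<Longrightarrow> z \<in> {0..<int s}"
    using G(1-3) by auto
  have "(i = j \<and> i \<noteq> 0 \<and> k \<noteq> 0 \<and> k \<noteq> i) \<or> (i = k \<and> i \<noteq> j \<and> i \<noteq> 0 \<and> j \<noteq> 0) \<or> (j = k \<and> i \<noteq> j \<and> i \<noteq> 0 \<and> j \<noteq> 0)
    \<or> (i = 0 \<and> j \<noteq> k \<and> j \<noteq> 0 \<and> k \<noteq> 0) \<or> (j = 0 \<and> i \<noteq> k \<and> i \<noteq> 0 \<and> k \<noteq> 0) \<or> (k = 0 \<and> i \<noteq> j \<and> i \<noteq> 0 \<and> j \<noteq> 0)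
    \<or> (i \<noteq> 0 \<and> j \<noteq> 0 \<and> k = 6 - i - j \<and> i \<noteq> j \<and> k \<noteq> 0)"
    using n H by (elim disjE) simp_all
  then show thesis
  proof (elim disjE conjE)
    assume *: "i = j" "i \<noteq> 0" "k \<noteq> 0" "k \<noteq> i"
    show ?thesis by (rule pair12[of i x y k z]) (use * x pqr G(4) in simp_all)
  next
    assume *: "i = k" "i \<noteq> j" "i \<noteq> 0" "j \<noteq> 0"
    show ?thesis by (rule pair13[of i x z j y]) (use * x pqr G(4) in simp_all)
  next
    assume *: "j = k" "i \<noteq> j" "i \<noteq> 0" "j \<noteq> 0"
    show ?thesis by (rule pair23[of j y z i x]) (use * x pqr G(4) in simp_all)
  next
    assume *: "i = 0" "j \<noteq> k" "j \<noteq> 0" "k \<noteq> 0"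
    show ?thesis by (rule stem1[of x j y k z]) (use * x pqr in simp_all)
  next
    assume *: "j = 0" "i \<noteq> k" "i \<noteq> 0" "k \<noteq> 0"
    show ?thesis by (rule stem2[of y i x k z]) (use * x pqr in simp_all)
  next
    assume *: "k = 0" "i \<noteq> j" "i \<noteq> 0" "j \<noteq> 0"
    show ?thesis by (rule stem3[of z i x j y]) (use * x pqr in simp_all)
  next
    assume *: "i \<noteq> 0" "j \<noteq> 0" "k = 6 - i - j" "i \<noteq> j" "k \<noteq> 0"
    show ?thesis by (rule transv[of i x j y z]) (use * x pqr in simp_all)
  qed
qed

lemma A_intros:
  assumes "grp3 i" "grp3 j" "i \<noteq> j" "x \<in> Z" "y \<in> Z"
  shows "x' \<in> Z \<Longrightarrow> x \<noteq> x' \<Longrightarrow> A (i, x) (i, x') (j, y) \<and> A (i, x) (j, y) (i, x') \<and> A (j, y) (i, x) (i, x')"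
    "a \<in> {0..<int s} \<Longrightarrow> A (0, a) (i, x) (j, y) \<and> A (i, x) (0, a) (j, y) \<and> A (i, x) (j, y) (0, a)"
    "z \<in> Z \<Longrightarrow> A (i, x) (j, y) (6 - i - j, z)"
  using assms unfolding A_def gpts_def by auto

lemma A_perm: "A p u r \<Longrightarrow> A u p r" "A p u r \<Longrightarrow> A p r u"
  unfolding A_def insert_subset by auto

lemma pr_sym:
  assumes "grp3 i" "grp3 j" "i \<noteq> j" "x \<in> Z" "x' \<in> Z" "x \<noteq> x'" "y \<in> Z"
  shows "pr i x x' j y = pr i x' x j y"
  by (rule pr_cases[OF assms]) simp_all

lemma st_sym: "st a i x j y = st a j y i x" unfolding st_def by (simp add: algebra_simps diff_diff_left add.commute)

lemma f_sym:
  assumes "A p u r"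
  shows "f u p r = f p u r \<and> f p r u = f p u r"
  using assms
proof (cases rule: A_cases)
  case (pair12 i x x' j y) then show ?thesis using pr_sym[of i j x x' y] by (auto simp: f_def)
next
  case (pair13 i x x' j y) then show ?thesis using pr_sym[of i j x x' y] by (auto simp: f_def)
next
  case (pair23 i x x' j y) then show ?thesis using pr_sym[of i j x x' y] by (auto simp: f_def)
next
  case (stem1 a i x j y) then show ?thesis using st_sym by (auto simp: f_def)
next
  case (stem2 a i x j y) then show ?thesis using st_sym by (auto simp: f_def)
next
  case (stem3 a i x j y) then show ?thesis using st_sym by (auto simp: f_def)
next
  case (transv i x j y z)
  define k where "k = 6 - i - j"
  have k: "k \<noteq> 0" "k \<noteq> i" "k \<noteq> j" using transv by (auto simp: k_def)
  have "tr (coord j y i x z) = tr (coord i x j y z)" "tr (coord i x k z y) = tr (coord i x j y z)"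
    using coord_perm[OF transv(4-6) k_def, of x y z] by simp_all
  then show ?thesis using transv k unfolding transv(1-3) k_def[symmetric] by (auto simp: f_def)
qed

lemma inv_swap:
  assumes "A p u r" "A u p (f u p r) \<and> f u p (f u p r) = r"
  shows "A p u (f p u r) \<and> f p u (f p u r) = r"
  using assms f_sym[OF assms(1)] f_sym[of u p "f p u r"] A_perm(1)[of u p "f p u r"] by simp

lemma inv_pair13:
  assumes ij: "grp3 i" "grp3 j" "i \<noteq> j" and r: "x \<in> Z" "x' \<in> Z" "x \<noteq> x'" "y \<in> Z"
  shows "A (i, x) (j, y) (f (i, x) (j, y) (i, x')) \<and> f (i, x) (j, y) (f (i, x) (j, y) (i, x')) = (i, x')"
proof -
  have e: "f (i, x) (j, y) (i, x') = pr i x x' j y" using ij by (simp add: f_def)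
  show ?thesis
  proof (rule pr_cases[OF ij r])
    fix z assume z: "pr i x x' j y = (6 - i - j, z)" "z \<in> Z" "tr (coord i x j y z) = (i, x')"
    have "f (i, x) (j, y) (6 - i - j, z) = tr (coord i x j y z)" using ij by (auto simp: f_def)
    then show ?thesis unfolding e z(1) using z A_intros(3)[OF ij r(1,4) z(2)] by simp
  next
    fix y' assume y': "pr i x x' j y = (j, y')" "y' \<in> Z" "y' \<noteq> y" "pr j y y' i x = (i, x')"
    have "f (i, x) (j, y) (j, y') = pr j y y' i x" using ij by (auto simp: f_def)
    then show ?thesis unfolding e y'(1)
      using y' A_intros(1)[OF ij(2,1) ij(3)[symmetric] r(4,1) y'(2)] by auto
  qed
qed

lemma inv_pair12:
  assumes ij: "grp3 i" "grp3 j" "i \<noteq> j" and r: "x \<in> Z" "x' \<in> Z" "x \<noteq> x'" "y \<in> Z"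
  shows "A (i, x) (i, x') (f (i, x) (i, x') (j, y)) \<and> f (i, x) (i, x') (f (i, x) (i, x') (j, y)) = (j, y)"
proof -
  have e: "f (i, x) (i, x') u = pr i x x' (fst u) (snd u)" for u by (cases u) (simp add: f_def)
  show ?thesis
  proof (rule pr_cases[OF ij r])
    fix z assume z: "pr i x x' j y = (6 - i - j, z)" "z \<in> Z" "pr i x x' (6 - i - j) z = (j, y)"
    have "A (i, x) (i, x') (6 - i - j, z)"
      using A_intros(1)[of i "6 - i - j" x z x'] coord_other(2-4)[OF ij] ij r z(2) by auto
    then show ?thesis using z by (simp add: e)
  next
    fix y' assume y': "pr i x x' j y = (j, y')" "y' \<in> Z" "y' \<noteq> y" "pr i x x' j y' = (j, y)"
    then show ?thesis using A_intros(1)[OF ij r(1) y'(2) r(2,3)] by (simp add: e)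
  qed
qed

lemma inv_transv:
  assumes ij: "grp3 i" "grp3 j" "i \<noteq> j" and r: "x \<in> Z" "y \<in> Z" "z \<in> Z"
  shows "A (i, x) (j, y) (tr (coord i x j y z)) \<and> f (i, x) (j, y) (tr (coord i x j y z)) = (6 - i - j, z)"
proof (rule tr_cases[OF ij r])
  fix a assume a: "tr (coord i x j y z) = (0, a)" "a \<in> {0..<int s}"
  have "z = (vl a - x - y) mod int g" using tr_stem[OF ij r a(2)] a(1) by simp
  moreover have "f (i, x) (j, y) (0, a) = st a i x j y" using ij by (auto simp: f_def)
  ultimately show ?thesis using a A_intros(2)[OF ij r(1,2) a(2)] by (simp add: st_def)
next
  define k where "k = 6 - i - j"
  have k: "grp3 k" "k \<noteq> i" "k \<noteq> j" using coord_other(2-4)[OF ij] by (simp_all add: k_def)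
  fix n w assume n: "tr (coord i x j y z) = (n, w)" "grp3 n" "w \<in> Z" "w \<noteq> coord i x j y z n"
  then consider "n = i" | "n = j" | "n = k" using ij k(1-3) by auto
  then show ?thesis
  proof cases
    case 1
    then have w: "w \<noteq> x" "tr (coord i x j y z) = (i, w)" using n by (simp_all add: coord_def)
    have "sg i j ((w - x) mod int g) ((y - x) mod q) = Some ((x + y + z) mod int g)"
      using tr_pr[OF ij r(1) n(3) w(1)[symmetric] r(2,3)] w(2) by simp
    then have "pr i x w j y = (k, z)" using sum_back[OF refl r(3), of x y] by (simp add: pr_def k_def)
    moreover have "f (i, x) (j, y) (i, w) = pr i x w j y" using ij by (auto simp: f_def)
    ultimately show ?thesis using w A_intros(1)[OF ij r(1,2) n(3)] by (simp add: k_def)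
  next
    case 2
    then have w: "w \<noteq> y" "tr (coord j y i x z) = (j, w)"
      using n ij coord_perm(1)[OF ij k_def, of x y z] by (simp_all add: coord_def)
    have "sg j i ((w - y) mod int g) ((x - y) mod q) = Some ((y + x + z) mod int g)"
      using tr_pr[OF ij(2,1) ij(3)[symmetric] r(2) n(3) w(1)[symmetric] r(1,3)] w(2) by simp
    then have "pr j y w i x = (k, z)" using sum_back[OF refl r(3), of y x] by (simp add: pr_def k_def)
    moreover have "f (i, x) (j, y) (j, w) = pr j y w i x" using ij by (auto simp: f_def)
    ultimately show ?thesis using 2 n(1) w A_intros(1)[OF ij(2,1) ij(3)[symmetric] r(2,1) n(3)] by (simp add: k_def)
  next
    case 3
    then have w: "w \<noteq> z" using n k by (simp add: coord_def)
    \<comment> \<open>The moved coordinate is brought to the front, flipped there, and put back into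
      third place.\<close>
    have "tr (coord k z i x y) = (k, w)"
      using n(1) 3 coord_perm(2)[OF ij k_def, of x y z] coord_perm(1)[of i k "6 - i - k" x z y] ij k by simp
    then have "tr (coord k w i x y) = (k, z)"
      by (rule sg_flip[OF k(1) ij(1) k(2) r(3) n(3) w[symmetric] r(1,2)])
    then have "tr (coord i x j y w) = (k, z)"
      using coord_perm(2)[OF ij k_def, of x y w] coord_perm(1)[of i k "6 - i - k" x w y] ij k by simp
    moreover have "f (i, x) (j, y) (k, w) = tr (coord i x j y w)" using ij k by (auto simp: f_def)
    ultimately show ?thesis using 3 n(1) A_intros(3)[OF ij r(1,2) n(3)] by (simp add: k_def)
  qed
qed

lemma inv_stem3:
  assumes ij: "grp3 i" "grp3 j" "i \<noteq> j" and r: "x \<in> Z" "y \<in> Z" and a: "a \<in> {0..<int s}"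
  shows "A (i, x) (j, y) (st a i x j y) \<and> f (i, x) (j, y) (st a i x j y) = (0, a)"
    and "A (0, a) (i, x) (st a i x j y) \<and> f (0, a) (i, x) (st a i x j y) = (j, y)"
proof -
  define k where "k = 6 - i - j"
  define z where "z = (vl a - x - y) mod int g"
  have k: "grp3 k" "k \<noteq> i" "k \<noteq> j" "6 - i - k = j" using ij by (auto simp: k_def)
  have z: "z \<in> Z" using g by (simp add: z_def)
  have s: "st a i x j y = (k, z)" by (simp add: st_def k_def z_def)
  have t: "tr (coord i x j y z) = (0, a)" using tr_stem[OF ij r z a] z_def by simp
  have "f (i, x) (j, y) (k, z) = tr (coord i x j y z)" using ij k by (auto simp: f_def)
  then show "A (i, x) (j, y) (st a i x j y) \<and> f (i, x) (j, y) (st a i x j y) = (0, a)"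
    using t s A_intros(3)[OF ij r z] by (simp add: k_def)
  have "tr (coord i x k z y) = (0, a)" using t coord_perm(2)[OF ij k_def, of x y z] by simp
  then have "y = (vl a - x - z) mod int g" using tr_stem[OF ij(1) k(1) k(2)[symmetric] r(1) z r(2) a] by simp
  then have "st a i x k z = (j, y)" using k(4) by (simp add: st_def)
  moreover have "f (0, a) (i, x) (k, z) = st a i x k z" using ij k by (auto simp: f_def)
  ultimately show "A (0, a) (i, x) (st a i x j y) \<and> f (0, a) (i, x) (st a i x j y) = (j, y)"
    using s A_intros(2)[OF ij(1) k(1) k(2)[symmetric] r(1) z a] by simp
qed

lemma inv_f:
  assumes a: "A p u r"
  shows "A p u (f p u r) \<and> f p u (f p u r) = r"
  using a
proof (cases rule: A_cases)
  case (pair12 i x x' j y) then show ?thesis using inv_pair12[of i j x x' y] by simp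
next
  case (pair13 i x x' j y) then show ?thesis using inv_pair13[of i j x x' y] by simp
next
  case (pair23 i x x' j y) show ?thesis by (rule inv_swap[OF a]) (use pair23 inv_pair13[of i j x x' y] in simp)
next
  case (stem1 b i x j y)
  then have "f p u r = st b i x j y" by (auto simp: f_def)
  then show ?thesis using stem1 inv_stem3(2)[OF stem1(4-9)] by simp
next
  case (stem2 b i x j y)
  then have "f u p r = st b i x j y" by (auto simp: f_def)
  then show ?thesis using stem2 inv_stem3(2)[OF stem2(4-9)] inv_swap[OF a] by simp
next
  case (stem3 b i x j y)
  then have "f p u r = st b i x j y" by (auto simp: f_def)
  then show ?thesis using stem3 inv_stem3(1)[OF stem3(4-9)] by simp
next
  case (transv i x j y z)
  have "f p u r = tr (coord i x j y z)" using transv by (auto simp: f_def)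
  then show ?thesis using transv(1-3) inv_transv[OF transv(4-9)] by simp
qed

theorem has_CQS_triple: "has_CQS g 3 s"
proof -
  have "exact {{p, u, r} | p u r. A p u r} {{p, u, r, f p u r} | p u r. A p u r}"
  proof (rule exact_skein)
    fix p u r assume a: "A p u r"
    show "A u p r \<and> f u p r = f p u r" by (rule conjI[OF A_perm(1)[OF a] conjunct1[OF f_sym[OF a]]])
    show "A p r u \<and> f p r u = f p u r" by (rule conjI[OF A_perm(2)[OF a] conjunct2[OF f_sym[OF a]]])
    show "A p u (f p u r) \<and> f p u (f p u r) = r" by (rule inv_f[OF a])
    have "A p u (f p u r)" "A p r (f p u r)"
      using conjunct1[OF inv_f[OF a]] conjunct1[OF inv_f[OF A_perm(2)[OF a]]] f_sym[OF a] by simp_all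
    then have "distinct [p, u, f p u r]" "distinct [p, r, f p u r]" unfolding A_def by auto
    moreover have "distinct [p, u, r]" using a unfolding A_def by auto
    ultimately show "distinct [p, u, r, f p u r]" by simp
  qed
  moreover have "{{p, u, r} | p u r. A p u r} = cross {1..3} g s"
  proof -
    have e: "{1..3} = {1, 2, 3 :: nat}" by auto
    have hole: "{(i, x), (j, y), (k, z)} \<subseteq> gpts {n} g s \<longleftrightarrow> {i, j, k} \<subseteq> {0, n}"
      if "{(i, x), (j, y), (k, z)} \<subseteq> gpts {1, 2, 3} g s" "n \<in> {1, 2, 3}" for i x j y k z n
      using that unfolding gpts_def by auto
    have A: "A p u r \<longleftrightarrow> distinct [p, u, r] \<and> {p, u, r} \<in> cross {1..3} g s" for p u r
    proof -
      obtain i x j y k z where pqr: "p = (i, x)" "u = (j, y)" "r = (k, z)" by (metis surj_pair)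
      show ?thesis
      proof (cases "distinct [p, u, r] \<and> {p, u, r} \<subseteq> gpts {1, 2, 3} g s")
        case True
        then have "{p, u, r} \<in> triples (gpts {1, 2, 3} g s)" by simp
        then show ?thesis using True hole[of i x j y k z] unfolding e cross_def A_def pqr by simp
      next
        case False
        then show ?thesis unfolding e cross_def triples_def A_def pqr by auto
      qed
    qed
    show ?thesis
    proof (intro set_eqI iffI)
      fix T assume T: "T \<in> cross {1..3} g s"
      then have "card T = 3" by (simp add: cross_def triples_def)
      then obtain p u r where T': "T = {p, u, r}" "p \<noteq> u" "p \<noteq> r" "u \<noteq> r" by (rule card3_obtain)
      then have "A p u r" using A[of p u r] T by simp
      then show "T \<in> {{p, u, r} | p u r. A p u r}" using T'(1) by blast
    next
      fix T assume "T \<in> {{p, u, r} | p u r. A p u r}"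
      then obtain p u r where "T = {p, u, r}" "A p u r" by blast
      then show "T \<in> cross {1..3} g s" using A[of p u r] by simp
    qed
  qed
  ultimately show ?thesis unfolding has_CQS_def by auto
qed

end

section \<open>One-factorizations of circulant graphs, and two infinite families with three
  groups\<close>

section \<open>One-factorizations of circulant graphs\<close>

text \<open>Each label class is factorized on its own; recording the label in the colour keeps the
  classes apart.\<close>

lemma factorizes_label:
  assumes "\<And>a. factorizes V (\<lambda>x y. E x y \<and> lab x y = a) (K a)"
  shows "factorizes V E (\<lambda>x y. (lab x y, K (lab x y) x y))"
  unfolding factorizes_def
proof (intro conjI ballI impI)
  fix x y assume xy: "x \<in> V" "y \<in> V" "E x y"
  have "x \<noteq> y \<and> (E y x \<and> lab y x = lab x y) \<and> K (lab x y) y x = K (lab x y) x y"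
    using assms[of "lab x y"] xy unfolding factorizes_def by blast
  then show "x \<noteq> y" "E y x" "(lab y x, K (lab y x) y x) = (lab x y, K (lab x y) x y)" by auto
next
  fix x z z' assume "x \<in> V" "z \<in> V" "z' \<in> V" "E z z'"
  then have "\<exists>!w. w \<in> V \<and> (E x w \<and> lab x w = lab z z') \<and> K (lab z z') x w = K (lab z z') z z'"
    using assms[of "lab z z'"] unfolding factorizes_def by blast
  moreover have "(E x w \<and> lab x w = lab z z') \<and> K (lab z z') x w = K (lab z z') z z' \<longleftrightarrow>
      E x w \<and> (lab x w, K (lab x w) x w) = (lab z z', K (lab z z') z z')" for w by auto
  ultimately show "\<exists>!w. w \<in> V \<and> E x w \<and> (lab x w, K (lab x w) x w) = (lab z z', K (lab z z') z z')"
    by (simp only:)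
qed

lemma factorizes_cong:
  assumes "factorizes V E \<kappa>" "\<And>x y. x \<in> V \<Longrightarrow> y \<in> V \<Longrightarrow> E x y = E' x y"
  shows "factorizes V E' \<kappa>"
  unfolding factorizes_def
proof (intro conjI ballI impI)
  fix x y assume "x \<in> V" "y \<in> V" "E' x y"
  then show "x \<noteq> y" "E' y x" "\<kappa> y x = \<kappa> x y" using assms unfolding factorizes_def by blast+
next
  fix x z z' assume a: "x \<in> V" "z \<in> V" "z' \<in> V" "E' z z'"
  have eq: "w \<in> V \<and> E' x w \<and> k \<longleftrightarrow> w \<in> V \<and> E x w \<and> k" for w k using assms(2)[OF a(1), of w] by blast
  have "E z z'" using assms(2)[OF a(2,3)] a(4) by simp
  then show "\<exists>!w. w \<in> V \<and> E' x w \<and> \<kappa> x w = \<kappa> z z'"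
    unfolding eq using assms(1) a(1-3) unfolding factorizes_def by blast
qed

lemma factorizes_single:
  assumes "\<And>x. x \<in> V \<Longrightarrow> \<pi> x \<in> V \<and> \<pi> (\<pi> x) = x \<and> \<pi> x \<noteq> x"
  shows "factorizes V (\<lambda>x y. y = \<pi> x) (\<lambda>x y. 0 :: int)"
  unfolding factorizes_def
proof (intro conjI ballI impI)
  fix x y assume "x \<in> V" "y \<in> V" "y = \<pi> x"
  then show "x \<noteq> y" "x = \<pi> y" using assms[of x] by simp_all metis
next
  fix x z z' assume "x \<in> V"
  then show "\<exists>!w. w \<in> V \<and> w = \<pi> x \<and> (0 :: int) = 0"
    using assms[of x] by (intro ex1I[of _ "\<pi> x"]) auto
qed simp

text \<open>Here \<open>c x\<close> is the colour of the edge from \<open>x\<close> to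
  \<open>\<sigma> x\<close>; along each cycle of \<open>\<sigma>\<close> it alternates between two
  values.\<close>

lemma factorizes_cycle:
  fixes c :: "'a \<Rightarrow> int"
  assumes "\<And>x. x \<in> V \<Longrightarrow> \<sigma> x \<in> V \<and> \<sigma>' x \<in> V \<and> \<sigma>' (\<sigma> x) = x \<and> \<sigma> (\<sigma>' x) = x \<and> \<sigma> (\<sigma> x) \<noteq> x"
    and "\<And>x. x \<in> V \<Longrightarrow> c (\<sigma> x) \<noteq> c x \<and> c x \<in> {0, 1}"
  shows "factorizes V (\<lambda>x y. y = \<sigma> x \<or> y = \<sigma>' x) (\<lambda>x y. if y = \<sigma> x then c x else c y)"
  unfolding factorizes_def
proof (intro conjI ballI impI)
  fix x y assume xy: "x \<in> V" "y \<in> V" "y = \<sigma> x \<or> y = \<sigma>' x"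
  have n: "\<sigma> x \<noteq> x" using assms(2)[OF xy(1)] by auto
  have n': "\<sigma>' x \<noteq> x" using n assms(1)[OF xy(1)] by metis
  have d: "\<sigma>' x \<noteq> \<sigma> x" using assms(1)[OF xy(1)] by metis
  show "x \<noteq> y" using xy n n' by auto
  show "x = \<sigma> y \<or> x = \<sigma>' y" using xy assms(1)[OF xy(1)] by auto
  show "(if x = \<sigma> y then c y else c x) = (if y = \<sigma> x then c x else c y)"
    using xy(3) assms(1)[OF xy(1)] d by auto
next
  fix x z z' assume xz: "x \<in> V" "z \<in> V" "z' \<in> V" "z' = \<sigma> z \<or> z' = \<sigma>' z"
  define k where "k = (if z' = \<sigma> z then c z else c z')"
  have k: "k \<in> {0, 1}" using assms(2) xz by (auto simp: k_def)
  have d: "\<sigma>' x \<noteq> \<sigma> x" using assms(1)[OF xz(1)] by metis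
  have V: "\<sigma> x \<in> V" "\<sigma>' x \<in> V" using assms(1)[OF xz(1)] by auto
  have c: "c x \<noteq> c (\<sigma>' x)" "c x \<in> {0, 1}" "c (\<sigma>' x) \<in> {0, 1}"
    using assms(2)[OF V(2)] assms(2)[OF xz(1)] assms(1)[OF xz(1)] by auto
  have "\<exists>!w. w \<in> V \<and> (w = \<sigma> x \<or> w = \<sigma>' x) \<and> (if w = \<sigma> x then c x else c w) = k"
  proof (cases "c x = k")
    case True
    show ?thesis by (rule ex1I[of _ "\<sigma> x"]) (use True V d c in auto)
  next
    case False
    then have "c (\<sigma>' x) = k" using c k by auto
    then show ?thesis by (intro ex1I[of _ "\<sigma>' x"]) (use False V d in auto)
  qed
  then show "\<exists>!w. w \<in> V \<and> (w = \<sigma> x \<or> w = \<sigma>' x) \<and>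
      (if w = \<sigma> x then c x else c w) = (if z' = \<sigma> z then c z else c z')" by (simp only: k_def)
qed

text \<open>A three-edge-colouring of a prism: both copies of the cycles are coloured alike, and the rung at a vertex
  takes the colour missing there.\<close>

lemma factorizes_prism:
  fixes c :: "'a \<Rightarrow> int"
  assumes \<sigma>: "\<And>x. x \<in> V \<Longrightarrow> \<sigma> x \<in> V \<and> \<sigma>' x \<in> V \<and> \<sigma>' (\<sigma> x) = x \<and> \<sigma> (\<sigma>' x) = x \<and> \<sigma> (\<sigma> x) \<noteq> x"
    and c: "\<And>x. x \<in> V \<Longrightarrow> c (\<sigma> x) \<noteq> c x \<and> c x \<in> {0, 1, 2}"
    and \<pi>: "\<And>x. x \<in> V \<Longrightarrow> \<pi> x \<in> V \<and> \<pi> (\<pi> x) = x \<and> \<pi> x \<noteq> x \<and> \<pi> x \<noteq> \<sigma> x \<and> \<pi> x \<noteq> \<sigma>' x"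
    and third: "\<And>x. x \<in> V \<Longrightarrow> c (\<pi> x) + c (\<sigma>' (\<pi> x)) = c x + c (\<sigma>' x)"
  shows "factorizes V (\<lambda>x y. y = \<sigma> x \<or> y = \<sigma>' x \<or> y = \<pi> x)
    (\<lambda>x y. if y = \<sigma> x then c x else if y = \<sigma>' x then c y else 3 - c x - c (\<sigma>' x))"
  unfolding factorizes_def
proof (intro conjI ballI impI)
  fix x y assume xy: "x \<in> V" "y \<in> V" "y = \<sigma> x \<or> y = \<sigma>' x \<or> y = \<pi> x"
  note S = \<sigma>[OF xy(1)] and P = \<pi>[OF xy(1)]
  have n: "\<sigma> x \<noteq> x" using c[OF xy(1)] by auto
  have n': "\<sigma>' x \<noteq> x" using n S by metis
  have d: "\<sigma>' x \<noteq> \<sigma> x" using S by metis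
  show "x \<noteq> y" using xy(3) n n' P by auto
  show "x = \<sigma> y \<or> x = \<sigma>' y \<or> x = \<pi> y" using xy(3) S P by auto
  have p: "x \<noteq> \<sigma> (\<pi> x)" "x \<noteq> \<sigma>' (\<pi> x)" using \<pi>[of "\<pi> x"] P by auto
  from xy(3) show "(if x = \<sigma> y then c y else if x = \<sigma>' y then c x else 3 - c y - c (\<sigma>' y)) =
      (if y = \<sigma> x then c x else if y = \<sigma>' x then c y else 3 - c x - c (\<sigma>' x))"
  proof (elim disjE)
    assume y: "y = \<sigma> x"
    have "x \<noteq> \<sigma> y" using S y by metis
    then show ?thesis using S y by simp
  next
    assume y: "y = \<sigma>' x"
    then show ?thesis using S d by simp
  next
    assume y: "y = \<pi> x"
    then show ?thesis using P p third[OF xy(1)] by simp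
  qed
next
  fix x z z' assume xz: "x \<in> V" "z \<in> V" "z' \<in> V" "z' = \<sigma> z \<or> z' = \<sigma>' z \<or> z' = \<pi> z"
  define \<kappa> where "\<kappa> = (\<lambda>x y. if y = \<sigma> x then c x else if y = \<sigma>' x then c y else 3 - c x - c (\<sigma>' x))"
  have tri: "c u \<noteq> c (\<sigma>' u) \<and> c u \<in> {0, 1, 2} \<and> c (\<sigma>' u) \<in> {0, 1, 2}" if "u \<in> V" for u
    using c[of u] c[of "\<sigma>' u"] \<sigma>[OF that] that by auto
  have k: "\<kappa> z z' \<in> {0, 1, 2}" using tri[OF xz(2)] xz(4) by (auto simp: \<kappa>_def)
  note S = \<sigma>[OF xz(1)] and P = \<pi>[OF xz(1)] and T = tri[OF xz(1)]
  have d: "\<sigma>' x \<noteq> \<sigma> x" using S by metis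
  have \<kappa>x: "\<kappa> x (\<sigma> x) = c x" "\<kappa> x (\<sigma>' x) = c (\<sigma>' x)" "\<kappa> x (\<pi> x) = 3 - c x - c (\<sigma>' x)"
    using d P by (auto simp: \<kappa>_def)
  consider "\<kappa> z z' = c x" | "\<kappa> z z' = c (\<sigma>' x)" | "\<kappa> z z' = 3 - c x - c (\<sigma>' x)" using T k by auto
  then have "\<exists>!w. w \<in> V \<and> (w = \<sigma> x \<or> w = \<sigma>' x \<or> w = \<pi> x) \<and> \<kappa> x w = \<kappa> z z'"
  proof cases
    case 1 show ?thesis by (rule ex1I[of _ "\<sigma> x"]) (use 1 S T \<kappa>x in auto)
  next
    case 2 show ?thesis by (rule ex1I[of _ "\<sigma>' x"]) (use 2 S T \<kappa>x in auto)
  next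
    case 3 show ?thesis by (rule ex1I[of _ "\<pi> x"]) (use 3 P T \<kappa>x in auto)
  qed
  then show "\<exists>!w. w \<in> V \<and> (w = \<sigma> x \<or> w = \<sigma>' x \<or> w = \<pi> x) \<and>
      (if w = \<sigma> x then c x else if w = \<sigma>' x then c w else 3 - c x - c (\<sigma>' x)) =
      (if z' = \<sigma> z then c z else if z' = \<sigma>' z then c z' else 3 - c z - c (\<sigma>' z))"
    unfolding \<kappa>_def .
qed

text \<open>The colour of the edge from \<open>x\<close> to \<open>x + e\<close> modulo
  \<open>g\<close>. Runs of \<open>e\<close> consecutive points alternate between 0 and 1, and the
  edges that wrap around take a third colour, which settles cycles of odd length.\<close>

definition cyc :: "int \<Rightarrow> int \<Rightarrow> int \<Rightarrow> int" where
  "cyc g e x = (if x \<ge> g - e then 2 else (x div e) mod 2)"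

lemma cyc_proper:
  assumes "0 < e" "2 * e \<le> g" "0 \<le> x" "x < g"
  shows "cyc g e ((x + e) mod g) \<noteq> cyc g e x" "cyc g e x \<in> {0, 1, 2}"
proof -
  show "cyc g e x \<in> {0, 1, 2}" by (auto simp: cyc_def)
  show "cyc g e ((x + e) mod g) \<noteq> cyc g e x"
  proof (cases "x \<ge> g - e")
    case True
    have "(x + e) mod g = (x + e - g) mod g" by simp
    also have "\<dots> = x + e - g" using True assms by (intro mod_pos_pos_trivial) auto
    finally have m: "(x + e) mod g = x + e - g" .
    have "(x + e - g) div e = 0" using True assms by (intro div_pos_pos_trivial) auto
    then show ?thesis using True assms unfolding m by (simp add: cyc_def)
  next
    case False
    then have m: "(x + e) mod g = x + e" using assms by simp
    have "(x + e) div e = x div e + 1" using div_add_self2[of e x] assms by simp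
    moreover have "(k + 1) mod 2 \<noteq> k mod 2" for k :: int by presburger
    ultimately have "((x + e) div e) mod 2 \<noteq> (x div e) mod 2" by metis
    moreover have "(x div e) mod 2 \<noteq> 2" using pos_mod_bound[of 2 "x div e"] by linarith
    ultimately show ?thesis using False unfolding m by (simp add: cyc_def)
  qed
qed

lemma diff_mod_iff:
  fixes g x y k :: int
  assumes "x \<in> {0..<g}" "y \<in> {0..<g}" "0 < k" "k < g"
  shows "(y - x) mod g = k \<longleftrightarrow> y = (x + k) mod g" "(y - x) mod g = g - k \<longleftrightarrow> y = (x - k) mod g"
    "(x - y) mod g = k \<longleftrightarrow> y = (x - k) mod g"
proof -
  have *: "(y - x) mod g = k \<longleftrightarrow> y = (x + k) mod g" if "x \<in> {0..<g}" "y \<in> {0..<g}" "0 < k" "k < g" for x y k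
  proof
    assume "(y - x) mod g = k"
    then have "(x + k) mod g = (x + (y - x)) mod g" by (metis mod_add_right_eq)
    then show "y = (x + k) mod g" using that by simp
  next
    assume "y = (x + k) mod g"
    then have "(y - x) mod g = (x + k - x) mod g" by (metis mod_diff_left_eq)
    then show "(y - x) mod g = k" using that by simp
  qed
  show "(y - x) mod g = k \<longleftrightarrow> y = (x + k) mod g" by (rule *[OF assms])
  have "(x + (g - k)) mod g = (x - k) mod g" by (metis add_diff_eq diff_add_eq mod_add_self2)
  then show "(y - x) mod g = g - k \<longleftrightarrow> y = (x - k) mod g" using *[OF assms(1,2), of "g - k"] assms(3,4) by simp
  have "y = (x - k) mod g \<longleftrightarrow> x = (y + k) mod g"
  proof
    assume "y = (x - k) mod g"
    then have "(y + k) mod g = (x - k + k) mod g" by (metis mod_add_left_eq)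
    then show "x = (y + k) mod g" using assms by simp
  next
    assume "x = (y + k) mod g"
    then have "(x - k) mod g = (y + k - k) mod g" by (metis mod_diff_left_eq)
    then show "y = (x - k) mod g" using assms by simp
  qed
  then show "(x - y) mod g = k \<longleftrightarrow> y = (x - k) mod g" using *[OF assms(2,1,3,4)] by simp
qed

lemma even_mod_even: "even g \<Longrightarrow> even ((a :: int) mod g) = even a"
  by (metis dvd_mod_iff)

lemma shift_facts:
  fixes g x e :: int
  assumes "x \<in> {0..<g}" "0 < e" "2 * e < g"
  shows "(x + e) mod g \<in> {0..<g}" "(x - e) mod g \<in> {0..<g}" "((x + e) mod g - e) mod g = x"
    "((x - e) mod g + e) mod g = x" "((x + e) mod g + e) mod g \<noteq> x"
proof -
  show "(x + e) mod g \<in> {0..<g}" "(x - e) mod g \<in> {0..<g}" using assms by auto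
  show "((x + e) mod g - e) mod g = x" "((x - e) mod g + e) mod g = x"
    using assms(1) by (simp_all add: mod_diff_left_eq mod_add_left_eq)
  have "x + e + e = x + 2 * e" by simp
  then have "((x + e) mod g + e) mod g = (x + 2 * e) mod g" using mod_add_left_eq[of "x + e" g e] by (simp only:)
  moreover have "(x + 2 * e) mod g \<noteq> x"
  proof
    assume "(x + 2 * e) mod g = x"
    then have "(x + 2 * e) mod g = x mod g" using assms(1) by simp
    then have "g dvd 2 * e" by (simp add: mod_eq_dvd_iff)
    then show False using assms(2,3) zdvd_imp_le by fastforce
  qed
  ultimately show "((x + e) mod g + e) mod g \<noteq> x" by simp
qed

lemma factorizes_empty: "(\<And>x y. x \<in> V \<Longrightarrow> y \<in> V \<Longrightarrow> \<not> E x y) \<Longrightarrow> factorizes V E \<kappa>"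
  unfolding factorizes_def by blast

text \<open>An even difference splits the points into cycles, possibly odd ones, which have no
  one-factorization. Lending it a private odd difference \<open>\<phi> e\<close> as rungs creates
  prisms, and these are three-edge-colourable. An even difference without rungs must be 2 modulo 4
  with 4 dividing \<open>g\<close>, so that its cycles are even. Half of \<open>g\<close> and the
  spare odd differences are matchings.\<close>

lemma cayley_factorizes:
  fixes g :: int and \<phi> :: "int \<Rightarrow> int"
  assumes g: "even g" "g > 0"
    and W: "\<And>d. d \<in> W \<Longrightarrow> 0 < d \<and> d < g \<and> g - d \<in> W"
    and P: "\<And>e. P e \<Longrightarrow> even e \<and> 0 < e \<and> 2 * e < g \<and> e \<in> W \<and> odd (\<phi> e) \<and> \<phi> e \<in> W"
    and inj: "\<And>e e'. P e \<Longrightarrow> P e' \<Longrightarrow> \<phi> e = \<phi> e' \<Longrightarrow> e = e'"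
    and rest: "\<And>e. e \<in> W \<Longrightarrow> even e \<Longrightarrow> 2 * e < g \<Longrightarrow> \<not> P e \<Longrightarrow> e mod 4 = 2 \<and> 4 dvd g"
  shows "\<exists>\<kappa> :: int \<Rightarrow> int \<Rightarrow> int \<times> int. factorizes {0..<g} (\<lambda>x y. (y - x) mod g \<in> W) \<kappa>"
proof -
  let ?Z = "{0..<g}"
  define d where "d x y = (y - x) mod g" for x y
  \<comment> \<open>An odd difference is measured from its even end, so that \<open>f\<close> and
    \<open>g - f\<close> name two different perfect matchings.\<close>
  define fd where "fd x y = (if even x then d x y else d y x)" for x y
  \<comment> \<open>On edges of the graph, positive labels stand for even differences with their
    rungs and negative labels for the odd differences left over, so the two kinds cannot
    collide.\<close>
  define lab where "lab x y = (if even (d x y) then min (d x y) (g - d x y)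
    else if \<exists>e. P e \<and> \<phi> e = fd x y then THE e. P e \<and> \<phi> e = fd x y else - fd x y)" for x y
  have dpar: "even (d x y) \<longleftrightarrow> even (x - y)" for x y using even_mod_even[OF g(1)] by (auto simp: d_def)
  have drng: "0 \<le> d x y" "d x y < g" for x y using g by (simp_all add: d_def)
  have dsym: "d y x = g - d x y" if "d x y \<in> W" for x y
  proof -
    have "d y x = (- (y - x)) mod g" by (simp add: d_def)
    also have "\<dots> = (- d x y) mod g" by (simp add: d_def mod_minus_eq)
    also have "\<dots> = (g - d x y) mod g" by simp
    also have "\<dots> = g - d x y" using W[OF that] by (intro mod_pos_pos_trivial) auto
    finally show ?thesis .
  qed
  have the: "(THE e'. P e' \<and> \<phi> e' = \<phi> e) = e" if "P e" for e using that inj by (intro the_equality) auto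
  have labO: "(\<exists>e. P e \<and> fd x y = \<phi> e \<and> lab x y = e) \<or> (\<not> (\<exists>e. P e \<and> \<phi> e = fd x y) \<and> lab x y = - fd x y)"
    if "odd (d x y)" for x y
  proof (cases "\<exists>e'. P e' \<and> \<phi> e' = fd x y")
    case True
    then obtain e' where e': "P e'" "fd x y = \<phi> e'" by metis
    have "lab x y = e'" using that True the[OF e'(1)] unfolding lab_def e'(2) by simp
    then show ?thesis using e' by blast
  next
    case False then show ?thesis using that by (auto simp: lab_def)
  qed
  have labP: "lab x y = e \<longleftrightarrow> (even (d x y) \<and> (d x y = e \<or> d x y = g - e)) \<or> (odd (d x y) \<and> fd x y = \<phi> e)"
    if "P e" "d x y \<in> W" for x y e
  proof (cases "even (d x y)")
    case True then show ?thesis using P[OF that(1)] by (auto simp: lab_def min_def)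
  next
    case False
    show ?thesis
    proof (cases "\<exists>e'. P e' \<and> \<phi> e' = fd x y")
      case True
      then obtain e' where e': "P e'" "fd x y = \<phi> e'" by metis
      have "lab x y = e'" using False True the[OF e'(1)] unfolding lab_def e'(2) by simp
      then show ?thesis using False e' inj[OF e'(1) that(1)] by auto
    next
      case F: False
      have "fd x y > 0" using W[OF that(2)] dsym[OF that(2)] by (auto simp: fd_def)
      then have "lab x y \<noteq> e" using False F P[OF that(1)] by (auto simp: lab_def)
      then show ?thesis using False F that(1) by auto
    qed
  qed
  have labN: "lab x y = e \<longleftrightarrow> even (d x y) \<and> (d x y = e \<or> d x y = g - e)"
    if "\<not> P e" "0 < e" "2 * e \<le> g" "d x y \<in> W" for x y e
  proof (cases "even (d x y)")
    case True then show ?thesis using that by (auto simp: lab_def min_def)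
  next
    case False
    have "fd x y > 0" using W[OF that(4)] dsym[OF that(4)] by (auto simp: fd_def)
    then show ?thesis using False labO[OF False] that(1,2) by auto
  qed
  have labF: "lab x y = - f \<longleftrightarrow> odd (d x y) \<and> fd x y = f"
    if "\<not> (\<exists>e. P e \<and> \<phi> e = f)" "0 < f" "d x y \<in> W" for x y f
  proof (cases "even (d x y)")
    case True then show ?thesis using that W[OF that(3)] by (auto simp: lab_def min_def)
  next
    case False then show ?thesis using labO[OF False] that P by fastforce
  qed
  define \<sigma> where "\<sigma> e x = (x + e) mod g" for e x
  define \<sigma>' where "\<sigma>' e x = (x - e) mod g" for e x
  define \<pi> where "\<pi> f x = (if even x then (x + f) mod g else (x - f) mod g)" for f x
  have fdE: "fd x y = f \<longleftrightarrow> y = \<pi> f x" if "x \<in> ?Z" "y \<in> ?Z" "f \<in> W" for x y f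
    using diff_mod_iff(1,3)[OF that(1,2), of f] W[OF that(3)] by (simp add: fd_def \<pi>_def d_def)
  have \<pi>Z: "\<pi> f x \<in> ?Z" for f x using g by (simp add: \<pi>_def)
  have \<pi>par: "even (\<pi> f x) \<longleftrightarrow> odd x" if "odd f" for f x
    using that even_mod_even[OF g(1)] by (auto simp: \<pi>_def)
  have \<pi>\<pi>: "\<pi> f (\<pi> f x) = x" if "odd f" "x \<in> ?Z" for f x
    using \<pi>par[OF that(1), of x] that(2) by (auto simp: \<pi>_def mod_diff_left_eq mod_add_left_eq)
  have \<pi>f: "\<pi> f x \<in> ?Z \<and> \<pi> f (\<pi> f x) = x \<and> \<pi> f x \<noteq> x" if "odd f" "x \<in> ?Z" for f x
    using \<pi>Z \<pi>\<pi>[OF that] \<pi>par[OF that(1), of x] by metis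
  have dE: "d x y = e \<longleftrightarrow> y = \<sigma> e x" "d x y = g - e \<longleftrightarrow> y = \<sigma>' e x"
    if "x \<in> ?Z" "y \<in> ?Z" "0 < e" "e < g" for x y e
    using diff_mod_iff(1,2)[OF that] by (simp_all add: d_def \<sigma>_def \<sigma>'_def)
  have exK: "\<exists>K. factorizes ?Z (\<lambda>x y. d x y \<in> W \<and> lab x y = a) (K :: int \<Rightarrow> int \<Rightarrow> int)" for a
  proof -
    consider (prism) "P a" | (cycle) "\<not> P a" "a \<in> W" "even a" "2 * a < g" | (half) "2 * a = g" "a \<in> W" "even a"
      | (match) "- a \<in> W" "odd a" "\<not> (\<exists>e. P e \<and> \<phi> e = - a)"
      | (none) "\<not> P a" "\<not> (a \<in> W \<and> even a \<and> 2 * a \<le> g)" "\<not> (- a \<in> W \<and> odd a \<and> \<not> (\<exists>e. P e \<and> \<phi> e = - a))"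
      by force
    then show ?thesis
    proof cases
      case prism
      note Pa = P[OF prism]
      \<comment> \<open>The odd points copy the colouring of the even ones, translated by
        \<open>\<phi> a\<close>; hence both ends of a rung miss the same colour.\<close>
      define c where "c x = (if even x then cyc g a x else cyc g a ((x - \<phi> a) mod g))" for x
      have \<sigma>par: "even (\<sigma> a x) \<longleftrightarrow> even x" "even (\<sigma>' a x) \<longleftrightarrow> even x" for x
        using Pa even_mod_even[OF g(1)] by (auto simp: \<sigma>_def \<sigma>'_def)
      have "factorizes ?Z (\<lambda>x y. y = \<sigma> a x \<or> y = \<sigma>' a x \<or> y = \<pi> (\<phi> a) x)
        (\<lambda>x y. if y = \<sigma> a x then c x else if y = \<sigma>' a x then c y else 3 - c x - c (\<sigma>' a x))"
      proof (rule factorizes_prism)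
        fix x assume x: "x \<in> ?Z"
        show "\<sigma> a x \<in> ?Z \<and> \<sigma>' a x \<in> ?Z \<and> \<sigma>' a (\<sigma> a x) = x \<and> \<sigma> a (\<sigma>' a x) = x \<and> \<sigma> a (\<sigma> a x) \<noteq> x"
          using shift_facts[OF x, of a] Pa by (simp add: \<sigma>_def \<sigma>'_def)
        have y: "(x - \<phi> a) mod g \<in> ?Z" using g by simp
        have e: "(\<sigma> a x - \<phi> a) mod g = ((x - \<phi> a) mod g + a) mod g"
        proof -
          have "x + a - \<phi> a = x - \<phi> a + a" by simp
          then show ?thesis unfolding \<sigma>_def mod_diff_left_eq mod_add_left_eq by (simp only:)
        qed
        show "c (\<sigma> a x) \<noteq> c x \<and> c x \<in> {0, 1, 2}"
          using cyc_proper[of a g x] cyc_proper[of a g "(x - \<phi> a) mod g"] Pa x y \<sigma>par[of x] e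
          by (auto simp: c_def \<sigma>_def)
        have par: "even (\<pi> (\<phi> a) x) \<longleftrightarrow> odd x" using \<pi>par Pa by blast
        show "\<pi> (\<phi> a) x \<in> ?Z \<and> \<pi> (\<phi> a) (\<pi> (\<phi> a) x) = x \<and> \<pi> (\<phi> a) x \<noteq> x \<and> \<pi> (\<phi> a) x \<noteq> \<sigma> a x \<and> \<pi> (\<phi> a) x \<noteq> \<sigma>' a x"
          using \<pi>f[of "\<phi> a" x] Pa x par \<sigma>par[of x] by metis
        have e1: "((x + \<phi> a) mod g - \<phi> a) mod g = x" using x by (simp add: mod_diff_left_eq)
        have e2: "(\<sigma>' a ((x + \<phi> a) mod g) - \<phi> a) mod g = \<sigma>' a x"
        proof -
          have "x + \<phi> a - a - \<phi> a = x - a" by simp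
          then show ?thesis unfolding \<sigma>'_def mod_diff_left_eq by (simp only:)
        qed
        have e3: "\<sigma>' a ((x - \<phi> a) mod g) = (\<sigma>' a x - \<phi> a) mod g"
        proof -
          have "x - \<phi> a - a = x - a - \<phi> a" by simp
          then show ?thesis unfolding \<sigma>'_def mod_diff_left_eq by (simp only:)
        qed
        show "c (\<pi> (\<phi> a) x) + c (\<sigma>' a (\<pi> (\<phi> a) x)) = c x + c (\<sigma>' a x)"
        proof (cases "even x")
          case True
          then have "\<pi> (\<phi> a) x = (x + \<phi> a) mod g" by (simp add: \<pi>_def)
          then show ?thesis using True par \<sigma>par e1 e2 by (simp add: c_def)
        next
          case False
          then have p: "\<pi> (\<phi> a) x = (x - \<phi> a) mod g" by (simp add: \<pi>_def)
          have "even ((\<sigma>' a x - \<phi> a) mod g)" using \<sigma>par(2)[of "(x - \<phi> a) mod g"] e3 p par False by simp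
          then show ?thesis using p False par \<sigma>par e3 by (simp add: c_def)
        qed
      qed
      then have "factorizes ?Z (\<lambda>x y. d x y \<in> W \<and> lab x y = a)
        (\<lambda>x y. if y = \<sigma> a x then c x else if y = \<sigma>' a x then c y else 3 - c x - c (\<sigma>' a x))"
      proof (rule factorizes_cong)
        fix x y assume xy: "x \<in> ?Z" "y \<in> ?Z"
        note D = dE[OF xy, of a] fdE[OF xy, of "\<phi> a"]
        show "(y = \<sigma> a x \<or> y = \<sigma>' a x \<or> y = \<pi> (\<phi> a) x) = (d x y \<in> W \<and> lab x y = a)"
        proof (cases "d x y \<in> W")
          case True
          have "odd (d x y)" if "fd x y = \<phi> a"
            using that Pa dsym[OF True] g(1) by (auto simp: fd_def split: if_splits)
          moreover have "even (d x y)" if "d x y = a \<or> d x y = g - a" using that Pa g by auto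
          ultimately show ?thesis using True labP[OF prism True] D Pa by auto
        next
          case False
          have "d x y \<noteq> a" "d x y \<noteq> g - a" using False Pa W[of a] by auto
          moreover have "fd x y \<noteq> \<phi> a"
          proof
            assume f: "fd x y = \<phi> a"
            then have "d x y = \<phi> a \<or> d y x = \<phi> a" by (auto simp: fd_def split: if_splits)
            then show False
            proof
              assume "d y x = \<phi> a"
              then have "d x y \<in> W" using dsym[of y x] W[of "\<phi> a"] Pa by auto
              then show False using False by simp
            qed (use False Pa in simp)
          qed
          ultimately show ?thesis using False D Pa by auto
        qed
      qed
      then show ?thesis by (intro exI)
    next
      case cycle
      have a: "0 < a" "a mod 4 = 2" "4 dvd g" using W[OF cycle(2)] rest cycle by auto
      \<comment> \<open>A step of 2 modulo 4 flips \<open>x div 2\<close> modulo 2, and wrapping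
        around changes the point by a multiple of 4 only.\<close>
      define c where "c x = (x div 2) mod 2" for x :: int
      have "factorizes ?Z (\<lambda>x y. y = \<sigma> a x \<or> y = \<sigma>' a x) (\<lambda>x y. if y = \<sigma> a x then c x else c y)"
      proof (rule factorizes_cycle)
        fix x assume x: "x \<in> ?Z"
        show "\<sigma> a x \<in> ?Z \<and> \<sigma>' a x \<in> ?Z \<and> \<sigma>' a (\<sigma> a x) = x \<and> \<sigma> a (\<sigma>' a x) = x \<and> \<sigma> a (\<sigma> a x) \<noteq> x"
          using shift_facts[OF x a(1) cycle(4)] by (simp add: \<sigma>_def \<sigma>'_def)
        obtain k where k: "\<sigma> a x = x + a + g * k" unfolding \<sigma>_def by (rule mod_obtain)
        obtain G where G: "g = 4 * G" using a(3) by (rule dvdE)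
        have "\<sigma> a x = x + a + 4 * (G * k)" using k G by simp
        moreover have "(w div 2) mod 2 \<noteq> (x div 2) mod 2 \<and> ((x div 2) mod 2 = 0 \<or> (x div 2) mod 2 = 1)"
          if "w = x + b + 4 * l" "b mod 4 = 2" for w x b l :: int using that by presburger
        ultimately show "c (\<sigma> a x) \<noteq> c x \<and> c x \<in> {0, 1}" using a(2) unfolding c_def by blast
      qed
      then have "factorizes ?Z (\<lambda>x y. d x y \<in> W \<and> lab x y = a) (\<lambda>x y. if y = \<sigma> a x then c x else c y)"
      proof (rule factorizes_cong)
        fix x y assume xy: "x \<in> ?Z" "y \<in> ?Z"
        show "(y = \<sigma> a x \<or> y = \<sigma>' a x) = (d x y \<in> W \<and> lab x y = a)"
          using dE[OF xy, of a] labN[OF cycle(1) a(1), of x y] cycle W[OF cycle(2)] g by auto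
      qed
      then show ?thesis by (intro exI)
    next
      case half
      then have a: "0 < a" "\<not> P a" using W P by auto
      have "factorizes ?Z (\<lambda>x y. y = \<sigma> a x) (\<lambda>x y. 0 :: int)"
      proof (rule factorizes_single)
        fix x assume x: "x \<in> ?Z"
        have "x + a + a = x + 2 * a" by simp
        then have "\<sigma> a (\<sigma> a x) = (x + 2 * a) mod g" unfolding \<sigma>_def mod_add_left_eq by (simp only:)
        then have "\<sigma> a (\<sigma> a x) = x" using half(1) x by simp
        moreover have "\<sigma> a x \<noteq> x" using dE(1)[OF x x a(1)] half(1) a g by (auto simp: d_def)
        ultimately show "\<sigma> a x \<in> ?Z \<and> \<sigma> a (\<sigma> a x) = x \<and> \<sigma> a x \<noteq> x" using g by (simp add: \<sigma>_def)
      qed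
      then have "factorizes ?Z (\<lambda>x y. d x y \<in> W \<and> lab x y = a) (\<lambda>x y. 0 :: int)"
      proof (rule factorizes_cong)
        fix x y assume xy: "x \<in> ?Z" "y \<in> ?Z"
        have "g - a = a" using half(1) by simp
        then show "(y = \<sigma> a x) = (d x y \<in> W \<and> lab x y = a)"
          using dE(1)[OF xy a(1)] labN[OF a(2,1), of x y] half g by auto
      qed
      then show ?thesis by (intro exI)
    next
      case match
      define f where "f = - a"
      have f: "f \<in> W" "odd f" "0 < f" "\<not> (\<exists>e. P e \<and> \<phi> e = f)" using match W[OF match(1)] by (auto simp: f_def)
      have "factorizes ?Z (\<lambda>x y. y = \<pi> f x) (\<lambda>x y. 0 :: int)"
        by (rule factorizes_single) (use \<pi>f f in blast)
      then have "factorizes ?Z (\<lambda>x y. d x y \<in> W \<and> lab x y = - f) (\<lambda>x y. 0 :: int)"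
      proof (rule factorizes_cong)
        fix x y assume xy: "x \<in> ?Z" "y \<in> ?Z"
        have "d x y \<in> W \<and> odd (d x y)" if "fd x y = f"
        proof (cases "even x")
          case True then show ?thesis using that f by (simp add: fd_def)
        next
          case False
          then have "d y x = f" using that by (simp add: fd_def)
          then show ?thesis using dsym[of y x] W[OF f(1)] f g(1) by auto
        qed
        then show "(y = \<pi> f x) = (d x y \<in> W \<and> lab x y = - f)"
          using fdE[OF xy f(1)] labF[OF f(4,3), of x y] by auto
      qed
      then have "factorizes ?Z (\<lambda>x y. d x y \<in> W \<and> lab x y = a) (\<lambda>x y. 0 :: int)" by (simp only: f_def minus_minus)
      then show ?thesis by (intro exI)
    next
      case none
      have nE: "\<not> (d x y \<in> W \<and> lab x y = a)" for x y
      proof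
        assume *: "d x y \<in> W \<and> lab x y = a"
        note Wd = W[OF conjunct1[OF *]]
        show False
        proof (cases "even (d x y)")
          case True
          then have "a = min (d x y) (g - d x y)" using * by (simp add: lab_def)
          then show False using none(2) Wd True * g(1) by (auto simp: min_def split: if_splits)
        next
          case False
          then have "a = - fd x y \<and> \<not> (\<exists>e. P e \<and> \<phi> e = fd x y)" using * none(1) labO[OF False] by auto
          moreover have "fd x y \<in> W" "odd (fd x y)" using Wd * dsym[of x y] False g(1) by (auto simp: fd_def)
          ultimately show False using none(3) by auto
        qed
      qed
      show ?thesis by (rule exI[of _ "\<lambda>_ _. 0"], rule factorizes_empty, rule nE)
    qed
  qed
  define K where "K a = (SOME K. factorizes ?Z (\<lambda>x y. d x y \<in> W \<and> lab x y = a) (K :: int \<Rightarrow> int \<Rightarrow> int))" for a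
  have "factorizes ?Z (\<lambda>x y. d x y \<in> W \<and> lab x y = a) (K a)" for a
    unfolding K_def by (rule someI_ex[OF exK])
  from factorizes_label[OF this] show ?thesis unfolding d_def by (intro exI)
qed

text \<open>The sums below \<open>3 * L\<close> form three intervals of length \<open>L\<close>, one
  per group, and \<open>step\<close> reflects a sum within its interval. The stem consists of the
  sums from \<open>3 * L\<close> on and of the midpoints, which exist for odd \<open>L\<close>: this
  gives 2 or 1 + 3 points. A reflection moves by less than \<open>L\<close>, with the parity of
  \<open>L - 1\<close>; \<open>W\<close> holds the differences that never occur.\<close>

lemma has_CQS_standard:
  fixes L :: int and g s :: nat and \<kappa> :: "int \<Rightarrow> int \<Rightarrow> int \<times> int"
  assumes L: "L > 0" and par: "(even L \<and> int g = 3 * L + 2 \<and> s = 2) \<or> (odd L \<and> int g = 3 * L + 1 \<and> s = 4)"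
    and fac: "factorizes {0..<int g} (\<lambda>x y. (y - x) mod int g \<in> W) \<kappa>"
    and W: "W = {d. 0 < d \<and> d < int g \<and> \<not> ((d < L \<or> d > int g - L) \<and> even (d - (L - 1)))}"
  shows "has_CQS g 3 s"
proof -
  let ?g = "int g" and ?Z = "{0..<int g}"
  have "even ?g" using par by (elim disjE conjE) presburger+
  then have g: "2 * L < ?g" "0 < ?g" "even ?g" "3 * L < ?g" using L par by auto
  \<comment> \<open>The signed representative of a difference; the moves are exactly its non-zero
    values of size below \<open>L\<close> with the parity of \<open>L - 1\<close>.\<close>
  define cd where "cd \<delta> = (if 2 * \<delta> < ?g then \<delta> else \<delta> - ?g)" for \<delta>
  define step :: "int \<Rightarrow> int \<Rightarrow> (nat \<times> int) option" where
    "step \<sigma> t = (if \<sigma> \<ge> 3 * L \<or> 2 * (\<sigma> div L) * L + L - 1 - 2 * \<sigma> = 0 then None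
      else Some (nat (\<sigma> div L) + 1, (2 * (\<sigma> div L) * L + L - 1 - 2 * \<sigma>) mod ?g))" for \<sigma> t
  define sg :: "nat \<Rightarrow> nat \<Rightarrow> int \<Rightarrow> int \<Rightarrow> int option" where
    "sg i j \<delta> \<tau> = (if \<bar>cd \<delta>\<bar> < L \<and> even (cd \<delta> - (L - 1)) then Some ((2 * (int i - 1) * L + L - 1 - cd \<delta>) div 2) else None)"
    for i j \<delta> \<tau>
  obtain \<mu> where \<mu>1: "\<And>x z z'. x \<in> ?Z \<Longrightarrow> z \<in> ?Z \<Longrightarrow> z' \<in> ?Z \<Longrightarrow> (z' - z) mod ?g \<in> W \<Longrightarrow>
      \<mu> x (\<kappa> z z') \<in> ?Z \<and> (\<mu> x (\<kappa> z z') - x) mod ?g \<in> W \<and> \<kappa> x (\<mu> x (\<kappa> z z')) = \<kappa> z z' \<and> \<mu> (\<mu> x (\<kappa> z z')) (\<kappa> z z') = x"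
    and \<mu>2: "\<And>x y. x \<in> ?Z \<Longrightarrow> y \<in> ?Z \<Longrightarrow> (y - x) mod ?g \<in> W \<Longrightarrow> \<mu> x (\<kappa> x y) = y"
    using factorizes_mate[OF fac] by metis
  \<comment> \<open>For \<open>s = 4\<close> the stem points 0, 1, 2 are the three midpoints and 3
    is the sum \<open>3 * L\<close>.\<close>
  define \<iota> where "\<iota> \<sigma> = (if s = 2 then \<sigma> - 3 * L else if \<sigma> \<ge> 3 * L then 3 else \<sigma> div L)" for \<sigma>
  define vl where "vl a = (if s = 2 then 3 * L + a else if a = 3 then 3 * L else a * L + (L - 1) div 2)" for a
  have dv: "\<sigma> div L = i" if "i * L \<le> \<sigma>" "\<sigma> < i * L + L" for \<sigma> i
    using that L by (intro int_div_pos_eq[of _ _ _ "\<sigma> - i * L"]) (auto simp: algebra_simps)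
  have blk: "\<exists>i. (i = 0 \<or> i = 1 \<or> i = 2) \<and> i * L \<le> \<sigma> \<and> \<sigma> < i * L + L" if "0 \<le> \<sigma>" "\<sigma> < 3 * L" for \<sigma>
  proof -
    consider "\<sigma> < L" | "L \<le> \<sigma>" "\<sigma> < 2 * L" | "2 * L \<le> \<sigma>" using L by linarith
    then show ?thesis
    proof cases
      case 1 then show ?thesis using that by (intro exI[of _ 0]) simp
    next
      case 2 then show ?thesis using that by (intro exI[of _ 1]) simp
    next
      case 3 then show ?thesis using that by (intro exI[of _ 2]) simp
    qed
  qed
  have stepI: "step \<sigma> t = (if 2 * i * L + L - 1 - 2 * \<sigma> = 0 then None else Some (nat i + 1, (2 * i * L + L - 1 - 2 * \<sigma>) mod ?g))"
    if "i = 0 \<or> i = 1 \<or> i = 2" "i * L \<le> \<sigma>" "\<sigma> < i * L + L" for \<sigma> i t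
  proof -
    have "\<not> \<sigma> \<ge> 3 * L" using that L by auto
    then show ?thesis using dv[OF that(2,3)] by (simp add: step_def)
  qed
  have cdd: "cd (d mod ?g) = d" if "\<bar>d\<bar> < L" for d
  proof (cases "d \<ge> 0")
    case True
    then have "d mod ?g = d" using that g by (intro mod_pos_pos_trivial) auto
    then show ?thesis using that g by (simp add: cd_def)
  next
    case False
    have "d mod ?g = (d + ?g) mod ?g" by simp
    also have "\<dots> = d + ?g" using False that g by (intro mod_pos_pos_trivial) auto
    finally show ?thesis using that g False by (simp add: cd_def)
  qed
  have cdm: "cd \<delta> mod ?g = \<delta>" if "0 < \<delta>" "\<delta> < ?g" for \<delta>
    using that by (simp add: cd_def)
  have stepE: "\<exists>i. (i = 0 \<or> i = 1 \<or> i = 2) \<and> i * L \<le> \<sigma> \<and> \<sigma> < i * L + L \<and> n = nat i + 1 \<and>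
      2 * i * L + L - 1 - 2 * \<sigma> \<noteq> 0 \<and> \<delta> = (2 * i * L + L - 1 - 2 * \<sigma>) mod ?g"
    if "\<sigma> \<in> ?Z" "step \<sigma> t = Some (n, \<delta>)" for \<sigma> t n \<delta>
  proof -
    have lt: "\<sigma> < 3 * L" using that(2) by (auto simp: step_def split: if_splits)
    have ge: "0 \<le> \<sigma>" using that(1) by simp
    obtain i where i: "i = 0 \<or> i = 1 \<or> i = 2" "i * L \<le> \<sigma>" "\<sigma> < i * L + L" using blk[OF ge lt] by blast
    then show ?thesis using that(2) stepI[OF i, of t] by (intro exI[of _ i]) (auto split: if_splits)
  qed
  have sgW: "sg i j \<delta> \<tau> = None \<longleftrightarrow> \<delta> \<in> W" if "0 < \<delta>" "\<delta> < ?g" for i j \<delta> \<tau>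
  proof -
    have "even (cd \<delta> - (L - 1)) = even (\<delta> - (L - 1))" using g(3) by (simp add: cd_def)
    moreover have "\<bar>cd \<delta>\<bar> < L \<longleftrightarrow> \<delta> < L \<or> \<delta> > ?g - L" using that g by (auto simp: cd_def)
    ultimately show ?thesis using that by (simp add: sg_def W)
  qed
  interpret tripling g s 1 step sg "\<lambda>i j x x' y. \<mu> y (\<kappa> x x')" \<iota> vl
  proof
    show "0 < g" "(0 :: int) < 1" "(1 :: int) dvd int g" "(1 :: int) dvd 3" using g by simp_all
  next
    fix \<sigma> t n \<delta> assume a: "\<sigma> \<in> ?Z" "t \<in> {0..<1 :: int}" "step \<sigma> t = Some (n, \<delta>)"
    from stepE[OF a(1,3)] obtain i where i0: "(i = 0 \<or> i = 1 \<or> i = 2) \<and> i * L \<le> \<sigma> \<and> \<sigma> < i * L + L \<and> n = nat i + 1 \<and>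
      2 * i * L + L - 1 - 2 * \<sigma> \<noteq> 0 \<and> \<delta> = (2 * i * L + L - 1 - 2 * \<sigma>) mod ?g" by (elim exE)
    have i: "i = 0 \<or> i = 1 \<or> i = 2" "i * L \<le> \<sigma>" "\<sigma> < i * L + L" and n: "n = nat i + 1"
      and d0: "2 * i * L + L - 1 - 2 * \<sigma> \<noteq> 0" and \<delta>: "\<delta> = (2 * i * L + L - 1 - 2 * \<sigma>) mod ?g"
      using i0 by - (elim conjE, assumption)+
    define iL where "iL = i * L"
    define d where "d = 2 * iL + L - 1 - 2 * \<sigma>"
    have de: "2 * i * L + L - 1 - 2 * \<sigma> = d" by (simp add: d_def iL_def)
    have dL: "\<bar>d\<bar> < L" using i(2,3) unfolding d_def iL_def[symmetric] by linarith
    note dL = dL d0[unfolded de] \<delta>[unfolded de]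
    have ndvd: "\<not> ?g dvd d" using dL g zdvd_imp_le[of ?g "\<bar>d\<bar>"] by auto
    then have "\<delta> \<noteq> 0" using dL(3) by (auto simp: dvd_eq_mod_eq_0)
    moreover have "0 \<le> \<delta>" "\<delta> < ?g" using dL(3) g(2) by simp_all
    ultimately have r: "\<delta> \<in> {0<..<?g}" by simp
    have "(\<sigma> + \<delta>) mod ?g = (\<sigma> + d) mod ?g" unfolding dL(3) by (simp add: mod_add_right_eq)
    also have "\<dots> = \<sigma> + d" using i L g unfolding d_def iL_def by (intro mod_pos_pos_trivial) auto
    finally have e: "(\<sigma> + \<delta>) mod ?g = \<sigma> + d" .
    have "step (\<sigma> + d) t' = Some (n, (- d) mod ?g)" for t'
    proof -
      have b: "i * L \<le> \<sigma> + d" "\<sigma> + d < i * L + L" using i unfolding d_def iL_def by auto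
      have ed: "2 * i * L + L - 1 - 2 * (\<sigma> + d) = - d" by (simp add: d_def iL_def)
      show ?thesis using stepI[OF i(1) b, of t', unfolded ed] dL(2) n by simp
    qed
    moreover have "(- d) mod ?g = ?g - \<delta>" using ndvd dL(3) by (simp add: zmod_zminus1_eq_if dvd_eq_mod_eq_0)
    moreover have "grp3 n" using n i(1) by auto
    ultimately show "grp3 n \<and> \<delta> \<in> {0<..<?g} \<and>
      step ((\<sigma> + \<delta>) mod ?g) ((t + (if n = 1 then - \<delta> else if n = 2 then \<delta> else 0)) mod 1) = Some (n, ?g - \<delta>)"
      using r e by simp
  next
    fix i j :: nat and \<delta> \<tau> \<sigma> assume a: "grp3 i" "grp3 j" "i \<noteq> j" "\<delta> \<in> {0<..<?g}" "\<tau> \<in> {0..<1 :: int}"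
    define i' where "i' = int i - 1"
    have i': "i' = 0 \<or> i' = 1 \<or> i' = 2" "i = nat i' + 1" using a(1) by (auto simp: i'_def)
    define d where "d = cd \<delta>"
    have dm: "d mod ?g = \<delta>" using cdm a(4) by (simp add: d_def)
    show "sg i j \<delta> \<tau> = Some \<sigma> \<longleftrightarrow> \<sigma> \<in> ?Z \<and> step \<sigma> (resid i j \<tau> \<sigma> mod 1) = Some (i, \<delta>)"
    proof
      assume s: "sg i j \<delta> \<tau> = Some \<sigma>"
      then have c: "\<bar>d\<bar> < L" "even (d - (L - 1))" "\<sigma> = (2 * i' * L + L - 1 - d) div 2"
        by (auto simp: sg_def d_def i'_def split: if_splits)
      define iL where "iL = i' * L"
      have "even (2 * i' * L + L - 1 - d)" using c(2) by auto
      then have s2: "2 * \<sigma> = 2 * iL + L - 1 - d" using c(3) by (simp add: iL_def)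
      then have b: "i' * L \<le> \<sigma>" "\<sigma> < i' * L + L" using c(1) unfolding iL_def by linarith+
      have ed: "2 * i' * L + L - 1 - 2 * \<sigma> = d" using s2 by (simp add: iL_def)
      have "d \<noteq> 0" using dm a(4) by auto
      moreover have "\<sigma> \<in> ?Z" using b i' L g by auto
      ultimately show "\<sigma> \<in> ?Z \<and> step \<sigma> (resid i j \<tau> \<sigma> mod 1) = Some (i, \<delta>)"
        using stepI[OF i'(1) b, unfolded ed] i'(2) dm by simp
    next
      assume s: "\<sigma> \<in> ?Z \<and> step \<sigma> (resid i j \<tau> \<sigma> mod 1) = Some (i, \<delta>)"
      then obtain k where k: "k = 0 \<or> k = 1 \<or> k = 2" "k * L \<le> \<sigma>" "\<sigma> < k * L + L" "i = nat k + 1"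
        "\<delta> = (2 * k * L + L - 1 - 2 * \<sigma>) mod ?g"
        using stepE[OF conjunct1[OF s] conjunct2[OF s]] by (elim exE conjE) (rule that)
      have ki: "k = i'" using k(1,4) by (auto simp: i'_def)
      define iL where "iL = i' * L"
      define d' where "d' = 2 * iL + L - 1 - 2 * \<sigma>"
      have "\<bar>d'\<bar> < L" using k(2,3) unfolding ki d'_def iL_def by linarith
      moreover have "\<delta> = d' mod ?g" using k(5) unfolding ki d'_def iL_def by (simp add: mult.assoc)
      ultimately have dd: "d = d'" "\<bar>d\<bar> < L" using cdd unfolding d_def by auto
      have "even (d - (L - 1))" unfolding dd d'_def by simp
      moreover have "2 * i' * L + L - 1 - d = 2 * \<sigma>" unfolding dd d'_def iL_def by simp
      ultimately show "sg i j \<delta> \<tau> = Some \<sigma>" using dd(2) by (simp add: sg_def d_def[symmetric] i'_def[symmetric])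
    qed
  next
    fix i j :: nat and x x' y assume a: "x \<in> ?Z" "x' \<in> ?Z" "x \<noteq> x'" "y \<in> ?Z"
      "sg i j ((x' - x) mod ?g) ((y - x) mod 1) = None"
    have rng: "0 < (u - v) mod ?g" "(u - v) mod ?g < ?g" if "u \<in> ?Z" "v \<in> ?Z" "u \<noteq> v" for u v
    proof -
      have "u mod ?g \<noteq> v mod ?g" using that by simp
      then have "(u - v) mod ?g \<noteq> 0" by (metis mod_eq_dvd_iff mod_0_imp_dvd)
      moreover have "0 \<le> (u - v) mod ?g" "(u - v) mod ?g < ?g" using g(2) by simp_all
      ultimately show "0 < (u - v) mod ?g" "(u - v) mod ?g < ?g" by linarith+
    qed
    have E: "(x' - x) mod ?g \<in> W" using a sgW rng[OF a(2,1)] by auto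
    define y' where "y' = \<mu> y (\<kappa> x x')"
    note m = \<mu>1[OF a(4,1,2) E, folded y'_def]
    have sym: "\<kappa> x' x = \<kappa> x x'" using fac a E unfolding factorizes_def by blast
    have "y' \<noteq> y" using m W by auto
    moreover have "sg i j ((x' - x) mod ?g) ((y' - x) mod 1) = None" using a(5) by simp
    moreover have "sg j i ((y' - y) mod ?g) ((x - y) mod 1) = None"
      using m sgW rng[of y' y] a(4) \<open>y' \<noteq> y\<close> by auto
    moreover have "\<mu> x (\<kappa> y y') = x'" using m \<mu>2[OF a(1,2) E] by simp
    ultimately show "let y' = \<mu> y (\<kappa> x x') in y' \<in> ?Z \<and> y' \<noteq> y \<and> \<mu> y (\<kappa> x' x) = y' \<and>
        sg i j ((x' - x) mod ?g) ((y' - x) mod 1) = None \<and> \<mu> y' (\<kappa> x x') = y \<and>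
        sg j i ((y' - y) mod ?g) ((x - y) mod 1) = None \<and> \<mu> x (\<kappa> y y') = x'"
      using m sym unfolding y'_def[symmetric] by (simp add: y'_def[symmetric])
  next
    fix \<sigma> t assume a: "\<sigma> \<in> ?Z" "t \<in> {0..<1 :: int}" "step \<sigma> t = None"
    show "\<iota> \<sigma> \<in> {0..<int s} \<and> vl (\<iota> \<sigma>) = \<sigma>"
    proof (cases "\<sigma> \<ge> 3 * L")
      case True then show ?thesis using par a(1) by (auto simp: \<iota>_def vl_def)
    next
      case False
      then obtain i where i: "i = 0 \<or> i = 1 \<or> i = 2" "i * L \<le> \<sigma>" "\<sigma> < i * L + L" using blk[of \<sigma>] a(1) by auto
      have d0: "2 * i * L + L - 1 - 2 * \<sigma> = 0" using stepI[OF i, of t] a(3) by (auto split: if_splits)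
      define iL where "iL = i * L"
      have e: "L = 2 * (\<sigma> - iL) + 1" using d0 by (simp add: iL_def)
      then have "odd L" by simp
      then have "s = 4" using par by auto
      moreover have "(L - 1) div 2 = \<sigma> - iL" using e by simp
      ultimately show ?thesis using dv[OF i(2,3)] i(1) False by (auto simp: \<iota>_def vl_def iL_def)
    qed
  next
    fix a t assume a: "a \<in> {0..<int s}" "t \<in> {0..<1 :: int}"
    show "vl a \<in> ?Z \<and> step (vl a) t = None \<and> \<iota> (vl a) = a"
    proof (cases "s = 2 \<or> a = 3")
      case True then show ?thesis using par a L by (auto simp: vl_def step_def \<iota>_def)
    next
      case False
      then have s4: "s = 4" "odd L" "a = 0 \<or> a = 1 \<or> a = 2" using par a by auto
      define h where "h = (L - 1) div 2"
      have h: "L = 2 * h + 1" "0 \<le> h" using s4(2) L by (auto simp: h_def elim!: oddE)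
      have v: "vl a = a * L + h" using False s4 by (auto simp: vl_def h_def)
      have b: "a * L \<le> vl a" "vl a < a * L + L" using v h by auto
      have "step (vl a) t = None" using stepI[OF s4(3) b, of t] v h by (simp add: algebra_simps)
      moreover have "\<iota> (vl a) = a" using dv[OF b] s4 b L by (auto simp: \<iota>_def)
      moreover have "vl a \<in> ?Z" using b s4(3) L g by auto
      ultimately show ?thesis by simp
    qed
  qed
  show ?thesis by (rule has_CQS_triple)
qed

theorem has_CQS_triple_2: "has_CQS (12 * k + 8) 3 2"
proof -
  define L where "L = 4 * int k + 2"
  define g where "g = 12 * k + 8"
  have g: "int g = 3 * L + 2" by (simp add: g_def L_def)
  define W where "W = {d. 0 < d \<and> d < int g \<and> \<not> ((d < L \<or> d > int g - L) \<and> even (d - (L - 1)))}"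
  have L: "even L" "L > 0" by (simp_all add: L_def)
  have "\<exists>\<kappa> :: int \<Rightarrow> int \<Rightarrow> int \<times> int. factorizes {0..<int g} (\<lambda>x y. (y - x) mod int g \<in> W) \<kappa>"
  proof (rule cayley_factorizes[where P = "\<lambda>e. 4 dvd e \<and> 0 < e \<and> 2 * e < int g" and \<phi> = "\<lambda>e. L + 1 + e div 2"])
    show "even (int g)" "int g > 0" using g L by simp_all
  next
    fix d assume "d \<in> W"
    then show "0 < d \<and> d < int g \<and> int g - d \<in> W" using g L by (auto simp: W_def)
  next
    fix e assume e: "4 dvd e \<and> 0 < e \<and> 2 * e < int g"
    then obtain m where m: "e = 4 * m" by (auto elim: dvdE)
    show "even e \<and> 0 < e \<and> 2 * e < int g \<and> e \<in> W \<and> odd (L + 1 + e div 2) \<and> L + 1 + e div 2 \<in> W"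
      using e m L g unfolding W_def by (auto simp: L_def)
  next
    fix e e' :: int assume "4 dvd e \<and> 0 < e \<and> 2 * e < int g" "4 dvd e' \<and> 0 < e' \<and> 2 * e' < int g" "L + 1 + e div 2 = L + 1 + e' div 2"
    then show "e = e'" by (auto elim!: dvdE)
  next
    fix e assume "e \<in> W" "even e" "2 * e < int g" "\<not> (4 dvd e \<and> 0 < e \<and> 2 * e < int g)"
    then have "\<not> 4 dvd e" by (simp add: W_def)
    then have "e mod 4 = 2" using \<open>even e\<close> by presburger
    moreover have "4 dvd int g" by (simp add: g_def)
    ultimately show "e mod 4 = 2 \<and> 4 dvd int g" by simp
  qed
  then obtain \<kappa> :: "int \<Rightarrow> int \<Rightarrow> int \<times> int" where "factorizes {0..<int g} (\<lambda>x y. (y - x) mod int g \<in> W) \<kappa>" by blast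
  from has_CQS_standard[OF L(2) _ this W_def, of 2] show ?thesis using L g by (simp add: g_def)
qed

text \<open>\<open>L\<close> is odd, so the moves use even differences and every odd one is
  available; \<open>e + 1\<close> provides the rungs for \<open>e\<close>. Here \<open>g\<close> is
  2 modulo 4, so each remaining even difference below \<open>g / 2\<close> must get rungs.\<close>

theorem has_CQS_triple_4: "has_CQS (12 * k + 10) 3 4"
proof -
  define L where "L = 4 * int k + 3"
  define g where "g = 12 * k + 10"
  have g: "int g = 3 * L + 1" by (simp add: g_def L_def)
  define W where "W = {d. 0 < d \<and> d < int g \<and> \<not> ((d < L \<or> d > int g - L) \<and> even (d - (L - 1)))}"
  have L: "odd L" "L > 0" by (simp_all add: L_def)
  have "\<exists>\<kappa> :: int \<Rightarrow> int \<Rightarrow> int \<times> int. factorizes {0..<int g} (\<lambda>x y. (y - x) mod int g \<in> W) \<kappa>"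
  proof (rule cayley_factorizes[where P = "\<lambda>e. even e \<and> L < e \<and> 2 * e < int g" and \<phi> = "\<lambda>e. e + 1"])
    show "even (int g)" "int g > 0" using g L by simp_all
  next
    fix d assume "d \<in> W"
    then show "0 < d \<and> d < int g \<and> int g - d \<in> W" using g L by (auto simp: W_def)
  next
    fix e assume e: "even e \<and> L < e \<and> 2 * e < int g"
    show "even e \<and> 0 < e \<and> 2 * e < int g \<and> e \<in> W \<and> odd (e + 1) \<and> e + 1 \<in> W"
      using e L g unfolding W_def by auto
  next
    fix e assume "e \<in> W" "even e" "2 * e < int g" "\<not> (even e \<and> L < e \<and> 2 * e < int g)"
    then have "e \<le> L" "e \<noteq> L" "even e" "e \<in> W" using L by auto
    then show "e mod 4 = 2 \<and> 4 dvd int g" using L by (auto simp: W_def)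
  qed simp
  then obtain \<kappa> :: "int \<Rightarrow> int \<Rightarrow> int \<times> int" where "factorizes {0..<int g} (\<lambda>x y. (y - x) mod int g \<in> W) \<kappa>" by blast
  from has_CQS_standard[OF L(2) _ this W_def, of 4] show ?thesis using L g by (simp add: g_def)
qed

section \<open>Explicit designs: an SQS(14) and candelabra systems of types (6^3 : 4) and (12^3 :
  2)\<close>

section \<open>Small designs\<close>

fun occurs :: "int \<Rightarrow> int list \<Rightarrow> bool" where
  "occurs a [] \<longleftrightarrow> False"
| "occurs a (x # xs) \<longleftrightarrow> a = x \<or> occurs a xs"

lemma occurs_iff: "occurs a xs \<longleftrightarrow> a \<in> set xs"
  by (induction xs) auto

fun increasing4 :: "int \<Rightarrow> int list \<Rightarrow> bool" where
  "increasing4 n [a, b, c, d] \<longleftrightarrow> 0 \<le> a \<and> a < b \<and> b < c \<and> c < d \<and> d < n"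
| "increasing4 n _ \<longleftrightarrow> False"

fun singleton :: "'b list \<Rightarrow> bool" where
  "singleton [_] \<longleftrightarrow> True"
| "singleton _ \<longleftrightarrow> False"

text \<open>Blocks are filtered one point at a time, so the list of blocks through \<open>a\<close>,
  and then through \<open>a\<close> and \<open>b\<close>, is computed once and shared by all further
  points.\<close>

fun select :: "int \<Rightarrow> int list list \<Rightarrow> int list list" where
  "select a [] = []"
| "select a (b # bs) = (if occurs a b then b # select a bs else select a bs)"

lemma set_select: "set (select a bs) = {b \<in> set bs. a \<in> set b}"
  by (induction bs) (auto simp: occurs_iff)

definition covers :: "bool \<Rightarrow> int list list \<Rightarrow> bool" where
  "covers hole bs = (if hole then bs = [] else singleton bs)"

text \<open>The triples \<open>a < b < c\<close> are enumerated by three nested recursions over an increasing list of points, so that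
  evaluation never proceeds under a binder.\<close>

fun check3 :: "(int \<Rightarrow> int \<Rightarrow> int \<Rightarrow> bool) \<Rightarrow> int \<Rightarrow> int \<Rightarrow> int list list \<Rightarrow> int list \<Rightarrow> bool" where
  "check3 H a b bs [] \<longleftrightarrow> True"
| "check3 H a b bs (c # cs) \<longleftrightarrow> covers (H a b c) (select c bs) \<and> check3 H a b bs cs"

fun check2 :: "(int \<Rightarrow> int \<Rightarrow> int \<Rightarrow> bool) \<Rightarrow> int \<Rightarrow> int list list \<Rightarrow> int list \<Rightarrow> bool" where
  "check2 H a bs [] \<longleftrightarrow> True"
| "check2 H a bs (b # cs) \<longleftrightarrow> check3 H a b (select b bs) cs \<and> check2 H a bs cs"

fun check1 :: "(int \<Rightarrow> int \<Rightarrow> int \<Rightarrow> bool) \<Rightarrow> int list list \<Rightarrow> int list \<Rightarrow> bool" where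
  "check1 H bs [] \<longleftrightarrow> True"
| "check1 H bs (a # cs) \<longleftrightarrow> check2 H a (select a bs) cs \<and> check1 H bs cs"

lemma check3_covers: "check3 H a b bs cs \<Longrightarrow> c \<in> set cs \<Longrightarrow> covers (H a b c) (select c bs)"
  by (induction cs) auto

lemma check2_covers:
  "sorted_wrt (<) cs \<Longrightarrow> check2 H a bs cs \<Longrightarrow> b \<in> set cs \<Longrightarrow> c \<in> set cs \<Longrightarrow> b < c \<Longrightarrow>
    covers (H a b c) (select c (select b bs))"
proof (induction cs)
  case (Cons x cs)
  show ?case
  proof (cases "b = x")
    case True
    then have "c \<in> set cs" using Cons.prems by auto
    then show ?thesis using check3_covers[of H a x "select x bs" cs c] Cons.prems(2) True by simp
  next
    case False
    then have b: "b \<in> set cs" using Cons.prems(3) by simp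
    then have "x < b" using Cons.prems(1) by simp
    then have "c \<in> set cs" using Cons.prems(4,5) by auto
    then show ?thesis using Cons.IH Cons.prems(1,2,5) b by simp
  qed
qed simp

lemma check1_covers:
  "sorted_wrt (<) cs \<Longrightarrow> check1 H bs cs \<Longrightarrow> a \<in> set cs \<Longrightarrow> b \<in> set cs \<Longrightarrow> c \<in> set cs \<Longrightarrow> a < b \<Longrightarrow> b < c \<Longrightarrow>
    covers (H a b c) (select c (select b (select a bs)))"
proof (induction cs)
  case (Cons x cs)
  show ?case
  proof (cases "a = x")
    case True
    then have "b \<in> set cs" "c \<in> set cs" using Cons.prems by auto
    then show ?thesis using check2_covers[of cs H a "select a bs" b c] Cons.prems(1,2,7) True by simp
  next
    case False
    then have a: "a \<in> set cs" using Cons.prems(3) by simp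
    then have "x < a" using Cons.prems(1) by simp
    then have "b \<in> set cs" "c \<in> set cs" using Cons.prems(4-7) by auto
    then show ?thesis using Cons.IH Cons.prems(1,2,6,7) a by simp
  qed
qed simp

definition covered_once :: "int \<Rightarrow> (int \<Rightarrow> int \<Rightarrow> int \<Rightarrow> bool) \<Rightarrow> int list list \<Rightarrow> bool" where
  "covered_once n H bs \<longleftrightarrow> check1 H bs [0..n - 1]"

lemma increasing4_obtain:
  assumes "increasing4 n b"
  obtains p q r s where "b = [p, q, r, s]" "0 \<le> p" "p < q" "q < r" "r < s" "s < n"
  using assms by (cases "(n, b)" rule: increasing4.cases) auto

lemma increasing3_obtain:
  fixes T :: "int set"
  assumes "card T = 3"
  obtains a b c where "T = {a, b, c}" "a < b" "b < c"
proof -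
  obtain p q r where T: "T = {p, q, r}" "p \<noteq> q" "p \<noteq> r" "q \<noteq> r" using assms by (rule card3_obtain)
  consider "p < q \<and> q < r" | "p < r \<and> r < q" | "q < p \<and> p < r" | "q < r \<and> r < p" | "r < p \<and> p < q" | "r < q \<and> q < p"
    using T(2-4) by linarith
  then show ?thesis using T(1) that by cases (auto simp: insert_commute)
qed

lemma exact_covered_once:
  assumes inc: "list_all (increasing4 n) bs" and cov: "covered_once n H bs"
  shows "exact {T. \<exists>a b c. T = {a, b, c} \<and> 0 \<le> a \<and> a < b \<and> b < c \<and> c < n \<and> \<not> H a b c} (set ` set bs)"
    (is "exact ?T _")
proof -
  define fl where "fl a b c = select c (select b (select a bs))" for a b c
  have fl: "if H a b c then fl a b c = [] else singleton (fl a b c)" if "0 \<le> a" "a < b" "b < c" "c < n" for a b c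
  proof -
    have "a \<in> set [0..n - 1]" "b \<in> set [0..n - 1]" "c \<in> set [0..n - 1]" using that by auto
    from check1_covers[OF sorted_wrt_upto cov[unfolded covered_once_def] this that(2,3)] show ?thesis
      unfolding covers_def fl_def .
  qed
  have mem: "b' \<in> set (fl a b c) \<longleftrightarrow> b' \<in> set bs \<and> {a, b, c} \<subseteq> set b'" for a b c b'
    by (auto simp: fl_def set_select)
  show ?thesis unfolding exact_def
  proof (intro conjI ballI)
    fix B assume "B \<in> set ` set bs"
    then obtain b where b: "b \<in> set bs" "B = set b" by blast
    have "increasing4 n b" using inc b(1) by (simp add: list_all_iff)
    then obtain p q r s where q: "b = [p, q, r, s]" "0 \<le> p" "p < q" "q < r" "r < s" "s < n"
      by (rule increasing4_obtain)
    then show "card B = 4" using b(2) by simp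
    show "triples B \<subseteq> ?T"
    proof
      fix T assume T: "T \<in> triples B"
      then have "card T = 3" "T \<subseteq> B" by (auto simp: triples_def)
      then obtain x y z where xyz: "T = {x, y, z}" "x < y" "y < z" by (metis increasing3_obtain)
      have r: "0 \<le> x" "z < n" using \<open>T \<subseteq> B\<close> xyz(1) b(2) q by auto
      have "b \<in> set (fl x y z)" using mem b \<open>T \<subseteq> B\<close> xyz(1) by blast
      then have "\<not> H x y z" using fl[OF r(1) xyz(2,3) r(2)] by (auto split: if_splits)
      then show "T \<in> ?T" using xyz r by blast
    qed
  next
    fix T assume "T \<in> ?T"
    then obtain x y z where xyz: "T = {x, y, z}" "0 \<le> x" "x < y" "y < z" "z < n" "\<not> H x y z" by blast
    show "card T = 3" using xyz by simp
    have "singleton (fl x y z)" using fl[OF xyz(2-5)] xyz(6) by simp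
    then obtain b where b: "fl x y z = [b]" by (cases "fl x y z" rule: singleton.cases) auto
    have iff: "b' \<in> set bs \<and> T \<subseteq> set b' \<longleftrightarrow> b' = b" for b'
      using mem[of b' x y z, symmetric] unfolding xyz(1) b by simp
    show "\<exists>!B. B \<in> set ` set bs \<and> T \<subseteq> B"
    proof (rule ex1I[of _ "set b"])
      show "set b \<in> set ` set bs \<and> T \<subseteq> set b" using iff[of b] by blast
    next
      fix B assume B: "B \<in> set ` set bs \<and> T \<subseteq> B"
      from conjunct1[OF B] obtain b' where b': "B = set b'" "b' \<in> set bs" by (rule imageE)
      have "b' \<in> set bs \<and> T \<subseteq> set b'" using b' B by simp
      then have "b' = b" unfolding iff .
      then show "B = set b" using b'(1) by simp
    qed
  qed
qed

lemma int_div_less_iff: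
  fixes a g k :: int
  assumes "0 < g"
  shows "a div g < k \<longleftrightarrow> a < k * g"
proof -
  have a: "a = g * (a div g) + a mod g" "0 \<le> a mod g" "a mod g < g" using assms by simp_all
  show ?thesis
  proof (cases "a div g < k")
    case True
    then have "g * (a div g + 1) \<le> g * k" using assms by (intro mult_left_mono) auto
    moreover have "g * (a div g + 1) = g * (a div g) + g" by (rule distrib_left[of g "a div g" 1, simplified])
    ultimately have "a < k * g" using a mult.commute[of g k] by linarith
    then show ?thesis using True by simp
  next
    case False
    then have "g * k \<le> g * (a div g)" using assms by (intro mult_left_mono) auto
    then have "\<not> a < k * g" using a mult.commute[of g k] by linarith
    then show ?thesis using False by simp
  qed
qed

text \<open>Points are numbered group by group with the stem last: \<open>a div g\<close> is the
  group, and a value of at least 3 means the stem. For \<open>a < b < c\<close>, once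
  \<open>b\<close> is in the stem so is \<open>c\<close>, and the triple lies in a group with the
  stem whatever \<open>a\<close> is.\<close>

definition in_hole :: "int \<Rightarrow> int \<Rightarrow> int \<Rightarrow> int \<Rightarrow> bool" where
  "in_hole g a b c \<longleftrightarrow> 3 \<le> b div g \<or> b div g = a div g \<and> (3 \<le> c div g \<or> c div g = a div g)"

lemma has_CQS_covered_once:
  fixes g s :: nat
  assumes inc: "list_all (increasing4 (3 * int g + int s)) bs"
    and cov: "covered_once (3 * int g + int s) (in_hole (int g)) bs" and gs: "0 < g"
  shows "has_CQS g 3 s"
proof -
  let ?g = "int g" and ?s = "int s"
  let ?T = "{T. \<exists>a b c. T = {a, b, c} \<and> 0 \<le> a \<and> a < b \<and> b < c \<and> c < 3 * ?g + ?s \<and> \<not> in_hole ?g a b c}"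
  let ?P = "{0..<3 * ?g + ?s}"
  define h where "h p = (if p < 3 * ?g then (nat (p div ?g) + 1, p mod ?g) else (0, p - 3 * ?g))" for p
  define h' where "h' z = (if fst z = 0 then 3 * ?g + snd z else (int (fst z) - 1) * ?g + snd z)" for z :: "nat \<times> int"
  have gp: "?g > 0" using gs by simp
  have hh: "h' (h p) = p" if "p \<in> ?P" for p
    using that gp by (auto simp: h_def h'_def pos_imp_zdiv_nonneg_iff mult.commute)
  have d3: "p div ?g < 3 \<longleftrightarrow> p < 3 * ?g" for p using int_div_less_iff[OF gp] by blast
  have hP: "h p \<in> gpts {1..3} g s" if "p \<in> ?P" for p
    using that gp d3[of p] by (auto simp: h_def gpts_def pos_imp_zdiv_nonneg_iff)
  have h'P: "h' z \<in> ?P \<and> h (h' z) = z" if "z \<in> gpts {1..3} g s" for z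
  proof -
    obtain i x where z: "z = (i, x)" by (cases z)
    show ?thesis
    proof (cases "i = 0")
      case True then show ?thesis using that z gp by (auto simp: gpts_def h_def h'_def)
    next
      case False
      then have i: "i \<in> {1..3}" "0 \<le> x" "x < ?g" using that z by (auto simp: gpts_def)
      have v: "h' z = (int i - 1) * ?g + x" using False z by (simp add: h'_def)
      have dm: "h' z div ?g = int i - 1" "h' z mod ?g = x" using v i gp by simp_all
      have "h' z < 3 * ?g" using d3[of "h' z"] dm(1) i(1) by simp
      moreover have "0 \<le> h' z" using v i gp by simp
      moreover have "Suc (nat (int i - 1)) = i" using False by (cases i) simp_all
      ultimately show ?thesis using dm i z by (simp add: h_def)
    qed
  qed
  have inj: "inj_on h ?P" using hh by (rule inj_on_inverseI)
  have him: "h ` ?P = gpts {1..3} g s"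
  proof
    show "h ` ?P \<subseteq> gpts {1..3} g s" using hP by blast
    show "gpts {1..3} g s \<subseteq> h ` ?P"
    proof
      fix z assume "z \<in> gpts {1..3} g s"
      then show "z \<in> h ` ?P" using h'P[of z] by (metis imageI)
    qed
  qed
  have hI: "h p \<in> gpts {i} g s \<longleftrightarrow> p div ?g + 1 = int i \<or> p div ?g \<ge> 3" if "p \<in> ?P" "i \<in> {1..3}" for p i
  proof -
    have "0 \<le> p div ?g" using that gp by (simp add: pos_imp_zdiv_nonneg_iff)
    then show ?thesis using that gp d3[of p] by (auto simp: h_def gpts_def)
  qed
  have hole: "in_hole ?g a b c \<longleftrightarrow> (\<exists>i\<in>{1..3}. h ` {a, b, c} \<subseteq> gpts {i} g s)"
    if abc: "0 \<le> a" "a < b" "b < c" "c < 3 * ?g + ?s" for a b c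
  proof -
    define A B C where "A = a div ?g" and "B = b div ?g" and "C = c div ?g"
    have le: "0 \<le> A" "A \<le> B" "B \<le> C" using abc gp by (auto simp: A_def B_def C_def pos_imp_zdiv_nonneg_iff zdiv_mono1)
    have "(\<exists>i\<in>{1..3}. h ` {a, b, c} \<subseteq> gpts {i} g s) \<longleftrightarrow>
      (\<exists>i\<in>{1..3::nat}. (A + 1 = int i \<or> A \<ge> 3) \<and> (B + 1 = int i \<or> B \<ge> 3) \<and> (C + 1 = int i \<or> C \<ge> 3))"
      using hI[of a] hI[of b] hI[of c] abc by (intro bex_cong) (auto simp: A_def B_def C_def)
    also have "\<dots> \<longleftrightarrow> B \<ge> 3 \<or> B = A \<and> (C \<ge> 3 \<or> C = A)"
    proof
      assume "B \<ge> 3 \<or> B = A \<and> (C \<ge> 3 \<or> C = A)"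
      then show "\<exists>i\<in>{1..3::nat}. (A + 1 = int i \<or> A \<ge> 3) \<and> (B + 1 = int i \<or> B \<ge> 3) \<and> (C + 1 = int i \<or> C \<ge> 3)"
        using le by (intro bexI[of _ "if A \<ge> 3 then 1 else nat (A + 1)"]) auto
    qed (use le in auto)
    finally show ?thesis by (simp add: in_hole_def A_def B_def C_def)
  qed
  have sub: "\<Union>?T \<subseteq> ?P"
  proof
    fix p assume "p \<in> \<Union>?T"
    then obtain a b c where "p \<in> {a, b, c}" "0 \<le> a" "a < b" "b < c" "c < 3 * ?g + ?s" by blast
    then show "p \<in> ?P" by auto
  qed
  have ex: "exact ((`) h ` ?T) ((`) h ` (set ` set bs))"
    by (rule exact_image[OF exact_covered_once[OF inc cov]]) (rule inj_on_subset[OF inj sub])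
  have "(`) h ` ?T = cross {1..3} g s"
  proof (intro equalityI subsetI)
    fix U assume "U \<in> (`) h ` ?T"
    then obtain T where T: "T \<in> ?T" "U = h ` T" by blast
    then obtain a b c where abc: "T = {a, b, c}" "0 \<le> a" "a < b" "b < c" "c < 3 * ?g + ?s" "\<not> in_hole ?g a b c" by blast
    have P: "T \<subseteq> ?P" using T(1) sub by blast
    have "card U = card T" unfolding T(2) using inj_on_subset[OF inj P] by (rule card_image)
    then have "card U = 3" using abc by simp
    moreover have "U \<subseteq> gpts {1..3} g s" using P him T(2) by blast
    ultimately show "U \<in> cross {1..3} g s" using hole[OF abc(2-5)] abc(1,6) T(2) by (simp add: cross_def triples_def)
  next
    fix U assume U: "U \<in> cross {1..3} g s"
    then have U3: "card U = 3" "U \<subseteq> h ` ?P" "\<not> (\<exists>i\<in>{1..3}. U \<subseteq> gpts {i} g s)" unfolding him by (auto simp: cross_def triples_def)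
    obtain T where T: "T \<subseteq> ?P" "U = h ` T" using U3(2) by (meson subset_imageE)
    have "card T = 3" using card_image[OF inj_on_subset[OF inj T(1)]] U3(1) T(2) by simp
    then obtain a b c where abc: "T = {a, b, c}" "a < b" "b < c" by (rule increasing3_obtain)
    have r: "0 \<le> a" "c < 3 * ?g + ?s" using T(1) abc(1) by auto
    then have "\<not> in_hole ?g a b c" using hole[OF r(1) abc(2,3) r(2)] U3(3) T(2) abc(1) by simp
    then have "T \<in> ?T" using abc r by blast
    then show "U \<in> (`) h ` ?T" using T(2) by blast
  qed
  then show ?thesis using ex unfolding has_CQS_def by metis
qed

text \<open>The recursion with groups of size 12 fills them with a system of order 14, so this order
  has to be supplied from outside.\<close>

definition blocks14 :: "int list list" where
  "blocks14 =
    [[0, 1, 2, 5], [0, 1, 3, 13], [0, 1, 4, 6], [0, 1, 7, 8], [0, 1, 9, 10], [0, 1, 11, 12], [0, 2, 3, 4], [0, 2, 6, 12],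
     [0, 2, 7, 9], [0, 2, 8, 10], [0, 2, 11, 13], [0, 3, 5, 6], [0, 3, 7, 10], [0, 3, 8, 11], [0, 3, 9, 12], [0, 4, 5, 10],
     [0, 4, 7, 11], [0, 4, 8, 12], [0, 4, 9, 13], [0, 5, 7, 12], [0, 5, 8, 13], [0, 5, 9, 11], [0, 6, 7, 13], [0, 6, 8, 9],
     [0, 6, 10, 11], [0, 10, 12, 13], [1, 2, 3, 6], [1, 2, 4, 7], [1, 2, 8, 9], [1, 2, 10, 11], [1, 2, 12, 13], [1, 3, 4, 5],
     [1, 3, 7, 12], [1, 3, 8, 10], [1, 3, 9, 11], [1, 4, 8, 11], [1, 4, 9, 12], [1, 4, 10, 13], [1, 5, 6, 11], [1, 5, 7, 10],
     [1, 5, 8, 12], [1, 5, 9, 13], [1, 6, 7, 9], [1, 6, 8, 13], [1, 6, 10, 12], [1, 7, 11, 13], [2, 3, 5, 8], [2, 3, 7, 13],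
     [2, 3, 9, 10], [2, 3, 11, 12], [2, 4, 5, 6], [2, 4, 8, 13], [2, 4, 9, 11], [2, 4, 10, 12], [2, 5, 7, 11], [2, 5, 9, 12],
     [2, 5, 10, 13], [2, 6, 7, 10], [2, 6, 8, 11], [2, 6, 9, 13], [2, 7, 8, 12], [3, 4, 6, 9], [3, 4, 7, 8], [3, 4, 10, 11],
     [3, 4, 12, 13], [3, 5, 7, 9], [3, 5, 10, 12], [3, 5, 11, 13], [3, 6, 7, 11], [3, 6, 8, 12], [3, 6, 10, 13], [3, 8, 9, 13],
     [4, 5, 7, 13], [4, 5, 8, 9], [4, 5, 11, 12], [4, 6, 7, 12], [4, 6, 8, 10], [4, 6, 11, 13], [4, 7, 9, 10], [5, 6, 7, 8],
     [5, 6, 9, 10], [5, 6, 12, 13], [5, 8, 10, 11], [6, 9, 11, 12], [7, 8, 9, 11], [7, 8, 10, 13], [7, 9, 12, 13], [7, 10, 11, 12],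
     [8, 9, 10, 12], [8, 11, 12, 13], [9, 10, 11, 13]]"

definition no_hole :: "int \<Rightarrow> int \<Rightarrow> int \<Rightarrow> bool" where
  "no_hole a b c = False"

lemma has_SQS_14: "has_SQS 14"
proof -
  have 1: "list_all (increasing4 14) blocks14" by code_simp
  have 2: "covered_once 14 no_hole blocks14" by code_simp
  have "{T. \<exists>a b c. T = {a, b, c} \<and> 0 \<le> a \<and> a < b \<and> b < c \<and> c < 14 \<and> \<not> False} = triples {0..<14 :: int}"
  proof (intro equalityI subsetI)
    fix T :: "int set" assume "T \<in> {T. \<exists>a b c. T = {a, b, c} \<and> 0 \<le> a \<and> a < b \<and> b < c \<and> c < 14 \<and> \<not> False}"
    then obtain a b c where "T = {a, b, c}" "0 \<le> a" "a < b" "b < c" "c < 14" by blast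
    then show "T \<in> triples {0..<14}" by simp
  next
    fix T :: "int set" assume "T \<in> triples {0..<14}"
    then have T: "card T = 3" "T \<subseteq> {0..<14}" by (auto simp: triples_def)
    obtain a b c where abc: "T = {a, b, c}" "a < b" "b < c" using T(1) by (rule increasing3_obtain)
    then have "0 \<le> a" "c < 14" using T(2) by auto
    then show "T \<in> {T. \<exists>a b c. T = {a, b, c} \<and> 0 \<le> a \<and> a < b \<and> b < c \<and> c < 14 \<and> \<not> False}" using abc by blast
  qed
  then have "exact (triples {0..<14 :: int}) (set ` set blocks14)" using exact_covered_once[OF 1 2] by (simp only: no_hole_def)
  then have "is_SQS {0..<14 :: int} (set ` set blocks14)" by (simp add: is_SQS_iff_exact)
  then show ?thesis using has_SQS_iff[of "{0..<14 :: int}" 14] by auto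
qed

text \<open>The groups are 0 to 5, 6 to 11 and 12 to 17; the stem is 18 to 21.\<close>

definition blocks22 :: "int list list" where
  "blocks22 =
    [[0, 1, 6, 7], [0, 1, 8, 11], [0, 1, 9, 10], [0, 1, 12, 13], [0, 1, 14, 17], [0, 1, 15, 16], [0, 2, 6, 8], [0, 2, 7, 9],
     [0, 2, 10, 16], [0, 2, 11, 15], [0, 2, 12, 14], [0, 2, 13, 17], [0, 3, 6, 9], [0, 3, 7, 8], [0, 3, 10, 11], [0, 3, 12, 15],
     [0, 3, 13, 14], [0, 3, 16, 17], [0, 4, 6, 10], [0, 4, 7, 11], [0, 4, 8, 14], [0, 4, 9, 13], [0, 4, 12, 16], [0, 4, 15, 17],
     [0, 5, 6, 11], [0, 5, 7, 10], [0, 5, 8, 9], [0, 5, 12, 17], [0, 5, 13, 16], [0, 5, 14, 15], [0, 6, 12, 19], [0, 6, 13, 20],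
     [0, 6, 14, 16], [0, 6, 15, 18], [0, 6, 17, 21], [0, 7, 12, 20], [0, 7, 13, 15], [0, 7, 14, 19], [0, 7, 16, 21], [0, 7, 17, 18],
     [0, 8, 10, 12], [0, 8, 13, 19], [0, 8, 15, 21], [0, 8, 16, 18], [0, 8, 17, 20], [0, 9, 11, 17], [0, 9, 12, 18], [0, 9, 14, 21],
     [0, 9, 15, 19], [0, 9, 16, 20], [0, 10, 13, 21], [0, 10, 14, 18], [0, 10, 15, 20], [0, 10, 17, 19], [0, 11, 12, 21], [0, 11, 13, 18],
     [0, 11, 14, 20], [0, 11, 16, 19], [1, 2, 6, 9], [1, 2, 7, 8], [1, 2, 10, 11], [1, 2, 12, 15], [1, 2, 13, 14], [1, 2, 16, 17],
     [1, 3, 6, 13], [1, 3, 7, 11], [1, 3, 8, 10], [1, 3, 9, 16], [1, 3, 12, 14], [1, 3, 15, 17], [1, 4, 6, 11], [1, 4, 7, 10],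
     [1, 4, 8, 9], [1, 4, 12, 17], [1, 4, 13, 16], [1, 4, 14, 15], [1, 5, 6, 8], [1, 5, 7, 14], [1, 5, 9, 11], [1, 5, 10, 17],
     [1, 5, 12, 16], [1, 5, 13, 15], [1, 6, 10, 15], [1, 6, 12, 20], [1, 6, 14, 19], [1, 6, 16, 21], [1, 6, 17, 18], [1, 7, 9, 12],
     [1, 7, 13, 18], [1, 7, 15, 21], [1, 7, 16, 19], [1, 7, 17, 20], [1, 8, 12, 19], [1, 8, 13, 17], [1, 8, 14, 21], [1, 8, 15, 18],
     [1, 8, 16, 20], [1, 9, 13, 21], [1, 9, 14, 18], [1, 9, 15, 20], [1, 9, 17, 19], [1, 10, 12, 21], [1, 10, 13, 19], [1, 10, 14, 20],
     [1, 10, 16, 18], [1, 11, 12, 18], [1, 11, 13, 20], [1, 11, 14, 16], [1, 11, 15, 19], [1, 11, 17, 21], [2, 3, 6, 11], [2, 3, 7, 10],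
     [2, 3, 8, 9], [2, 3, 12, 17], [2, 3, 13, 16], [2, 3, 14, 15], [2, 4, 6, 12], [2, 4, 7, 17], [2, 4, 8, 10], [2, 4, 9, 11],
     [2, 4, 13, 15], [2, 4, 14, 16], [2, 5, 6, 7], [2, 5, 8, 11], [2, 5, 9, 10], [2, 5, 12, 13], [2, 5, 14, 17], [2, 5, 15, 16],
     [2, 6, 10, 14], [2, 6, 13, 19], [2, 6, 15, 21], [2, 6, 16, 18], [2, 6, 17, 20], [2, 7, 11, 13], [2, 7, 12, 19], [2, 7, 14, 21],
     [2, 7, 15, 18], [2, 7, 16, 20], [2, 8, 12, 16], [2, 8, 13, 21], [2, 8, 14, 19], [2, 8, 15, 20], [2, 8, 17, 18], [2, 9, 12, 21],
     [2, 9, 13, 18], [2, 9, 14, 20], [2, 9, 15, 17], [2, 9, 16, 19], [2, 10, 12, 18], [2, 10, 13, 20], [2, 10, 15, 19], [2, 10, 17, 21],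
     [2, 11, 12, 20], [2, 11, 14, 18], [2, 11, 16, 21], [2, 11, 17, 19], [3, 4, 6, 7], [3, 4, 8, 11], [3, 4, 9, 10], [3, 4, 12, 13],
     [3, 4, 14, 17], [3, 4, 15, 16], [3, 5, 6, 10], [3, 5, 7, 9], [3, 5, 8, 15], [3, 5, 11, 12], [3, 5, 13, 17], [3, 5, 14, 16],
     [3, 6, 8, 17], [3, 6, 12, 18], [3, 6, 14, 21], [3, 6, 15, 19], [3, 6, 16, 20], [3, 7, 12, 16], [3, 7, 13, 21], [3, 7, 14, 18],
     [3, 7, 15, 20], [3, 7, 17, 19], [3, 8, 12, 21], [3, 8, 13, 18], [3, 8, 14, 20], [3, 8, 16, 19], [3, 9, 11, 14], [3, 9, 12, 19],
     [3, 9, 13, 20], [3, 9, 15, 18], [3, 9, 17, 21], [3, 10, 12, 20], [3, 10, 13, 15], [3, 10, 14, 19], [3, 10, 16, 21], [3, 10, 17, 18],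
     [3, 11, 13, 19], [3, 11, 15, 21], [3, 11, 16, 18], [3, 11, 17, 20], [4, 5, 6, 9], [4, 5, 7, 8], [4, 5, 10, 11], [4, 5, 12, 15],
     [4, 5, 13, 14], [4, 5, 16, 17], [4, 6, 8, 16], [4, 6, 13, 21], [4, 6, 14, 18], [4, 6, 15, 20], [4, 6, 17, 19], [4, 7, 9, 15],
     [4, 7, 12, 21], [4, 7, 13, 19], [4, 7, 14, 20], [4, 7, 16, 18], [4, 8, 12, 18], [4, 8, 13, 20], [4, 8, 15, 19], [4, 8, 17, 21],
     [4, 9, 12, 20], [4, 9, 14, 19], [4, 9, 16, 21], [4, 9, 17, 18], [4, 10, 12, 14], [4, 10, 13, 18], [4, 10, 15, 21], [4, 10, 16, 19],
     [4, 10, 17, 20], [4, 11, 12, 19], [4, 11, 13, 17], [4, 11, 14, 21], [4, 11, 15, 18], [4, 11, 16, 20], [5, 6, 12, 21], [5, 6, 13, 18],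
     [5, 6, 14, 20], [5, 6, 15, 17], [5, 6, 16, 19], [5, 7, 11, 16], [5, 7, 12, 18], [5, 7, 13, 20], [5, 7, 15, 19], [5, 7, 17, 21],
     [5, 8, 10, 13], [5, 8, 12, 20], [5, 8, 14, 18], [5, 8, 16, 21], [5, 8, 17, 19], [5, 9, 12, 14], [5, 9, 13, 19], [5, 9, 15, 21],
     [5, 9, 16, 18], [5, 9, 17, 20], [5, 10, 12, 19], [5, 10, 14, 21], [5, 10, 15, 18], [5, 10, 16, 20], [5, 11, 13, 21], [5, 11, 14, 19],
     [5, 11, 15, 20], [5, 11, 17, 18], [6, 7, 12, 13], [6, 7, 14, 17], [6, 7, 15, 16], [6, 8, 12, 14], [6, 8, 13, 15], [6, 9, 12, 15],
     [6, 9, 13, 14], [6, 9, 16, 17], [6, 10, 12, 16], [6, 10, 13, 17], [6, 11, 12, 17], [6, 11, 13, 16], [6, 11, 14, 15], [7, 8, 12, 15],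
     [7, 8, 13, 14], [7, 8, 16, 17], [7, 9, 13, 17], [7, 9, 14, 16], [7, 10, 12, 17], [7, 10, 13, 16], [7, 10, 14, 15], [7, 11, 12, 14],
     [7, 11, 15, 17], [8, 9, 12, 17], [8, 9, 13, 16], [8, 9, 14, 15], [8, 10, 14, 16], [8, 10, 15, 17], [8, 11, 12, 13], [8, 11, 14, 17],
     [8, 11, 15, 16], [9, 10, 12, 13], [9, 10, 14, 17], [9, 10, 15, 16], [9, 11, 12, 16], [9, 11, 13, 15], [10, 11, 12, 15], [10, 11, 13, 14],
     [10, 11, 16, 17]]"

lemma has_CQS_6_3_4: "has_CQS 6 3 4"
proof -
  have 1: "list_all (increasing4 22) blocks22" by code_simp
  have 2: "covered_once 22 (in_hole 6) blocks22" by code_simp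
  show ?thesis by (rule has_CQS_covered_once[of 6 4 blocks22]) (use 1 2 in simp_all)
qed

text \<open>Size 12 is outside the two infinite families. The rule exchanges the sums 1 and 2, 5 and
  6, 8 and 10, 0 and 3, 4 and 7, while 9 and 11 go to the stem. Moves by 3 or 9 keep
  \<open>t\<close> modulo 3, so their group, \<open>A\<close> or \<open>B\<close>, may depend on
  \<open>t\<close>.\<close>

definition step12 :: "int \<Rightarrow> int \<Rightarrow> (nat \<times> int) option" where
  "step12 \<sigma> t =
    (let A = (if t = 2 then 1 else if t = 1 then 2 else 3); B = (if t = 1 then 1 else if t = 2 then 2 else 3) in
     if \<sigma> = 1 then Some (1, 1) else if \<sigma> = 2 then Some (1, 11) else if \<sigma> = 5 then Some (2, 1)
     else if \<sigma> = 6 then Some (2, 11) else if \<sigma> = 8 then Some (3, 2) else if \<sigma> = 10 then Some (3, 10)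
     else if \<sigma> = 0 then Some (A, 3) else if \<sigma> = 3 then Some (A, 9) else if \<sigma> = 4 then Some (B, 3)
     else if \<sigma> = 7 then Some (B, 9) else None)"

definition sg12 :: "nat \<Rightarrow> nat \<Rightarrow> int \<Rightarrow> int \<Rightarrow> int option" where
  "sg12 i j \<delta> \<tau> = find (\<lambda>\<sigma>. step12 \<sigma> (resid i j \<tau> \<sigma> mod 3) = Some (i, \<delta>)) [0..11]"

text \<open>The differences that the rule never uses in group \<open>i\<close>. The differences 3
  and 9 are absent, being used for two of the three residues.\<close>

definition W12 :: "nat \<Rightarrow> int \<Rightarrow> bool" where
  "W12 i \<delta> \<longleftrightarrow> 4 \<le> \<delta> \<and> \<delta> \<le> 8 \<or> (if i = 3 then \<delta> = 1 \<or> \<delta> = 11 else \<delta> = 2 \<or> \<delta> = 10)"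

definition shift12 :: "nat \<Rightarrow> nat \<Rightarrow> int" where
  "shift12 i j = (if i + j = 3 then 0 else if i < j then 2 else 1)"

text \<open>Edge colours of the triangles of step 4. The odd triangles copy the even ones,
  translated by 5, which is the difference of the rungs.\<close>

definition prism12 :: "int \<Rightarrow> int" where
  "prism12 x = (if x mod 2 = 0 then x mod 12 div 4 else (x - 5) mod 12 div 4)"

text \<open>Colours 0, 1, 2 belong to the prisms with differences 4 and 5, colour 3 to difference 7
  from an even point, colour 4 to difference 6, and colours 5, 6 to the even cycles of difference 1
  or 2.\<close>

definition colour12 :: "int \<Rightarrow> int \<Rightarrow> int" where
  "colour12 x x' = (let \<delta> = (x' - x) mod 12 in
     if \<delta> = 4 then prism12 x else if \<delta> = 8 then prism12 x' else if \<delta> = 6 then 4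
     else if \<delta> = 2 then 5 + x div 2 mod 2 else if \<delta> = 10 then 5 + x' div 2 mod 2
     else if \<delta> = 1 then 5 + x mod 2 else if \<delta> = 11 then 6 - x mod 2
     else if (\<delta> = 5) = (x mod 2 = 0) then 3 - prism12 x - prism12 (x - 4) else 3)"

definition mate12 :: "nat \<Rightarrow> int \<Rightarrow> int \<Rightarrow> int" where
  "mate12 i x c = (let e = (if x mod 2 = 0 then 1 else - 1) in
     x + (if c = 3 then 7 * e else if c = 4 then 6
       else if c = 5 then (if i = 3 then e else if x div 2 mod 2 = 0 then 2 else - 2)
       else if c = 6 then (if i = 3 then - e else if x div 2 mod 2 = 1 then 2 else - 2)
       else if prism12 x = c then 4 else if prism12 (x - 4) = c then - 4 else 5 * e)) mod 12"

text \<open>On the leftover residue, a pair of difference 3 is joined to the pairs of difference 3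
  whose starting point has the same parity as its own.\<close>

definition nu12 :: "nat \<Rightarrow> nat \<Rightarrow> int \<Rightarrow> int \<Rightarrow> int \<Rightarrow> int" where
  "nu12 i j x x' y =
    (if W12 i ((x' - x) mod 12) then mate12 j y (colour12 x x')
     else (y + (if (y - (if (x' - x) mod 12 = 3 then x else x')) mod 2 = 0 then 3 else - 3)) mod 12)"

lemma step12_inverse:
  "\<forall>\<sigma>\<in>set [0..11]. \<forall>t\<in>set [0..2]. case step12 \<sigma> t of None \<Rightarrow> \<sigma> = 9 \<or> \<sigma> = 11
    | Some (i, \<delta>) \<Rightarrow> grp3 i \<and> 0 < \<delta> \<and> \<delta> < 12 \<and>
        step12 ((\<sigma> + \<delta>) mod 12) ((t + (if i = 1 then - \<delta> else if i = 2 then \<delta> else 0)) mod 3) = Some (i, 12 - \<delta>)"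
  by code_simp

lemma sg12_unique:
  "\<forall>i\<in>set [1, 2, 3]. \<forall>j\<in>set [1, 2, 3]. i \<noteq> j \<longrightarrow> (\<forall>\<tau>\<in>set [0..2]. \<forall>\<sigma>\<in>set [0..11].
     case step12 \<sigma> (resid i j \<tau> \<sigma> mod 3) of None \<Rightarrow> True | Some (i', \<delta>) \<Rightarrow> i' = i \<longrightarrow> sg12 i j \<delta> \<tau> = Some \<sigma>)"
  by code_simp

lemma sg12_None:
  "\<forall>i\<in>set [1, 2, 3]. \<forall>j\<in>set [1, 2, 3]. i \<noteq> j \<longrightarrow> (\<forall>\<tau>\<in>set [0..2]. \<forall>\<delta>\<in>set [1..11].
     (sg12 i j \<delta> \<tau> = None) = (W12 i \<delta> \<or> (\<delta> = 3 \<or> \<delta> = 9) \<and> \<tau> = shift12 i j))"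
  by code_simp

lemma mate12_colour:
  "\<forall>i\<in>set [1, 2, 3]. \<forall>x\<in>set [0..11]. \<forall>c\<in>set [0..6].
     0 \<le> mate12 i x c \<and> mate12 i x c < 12 \<and> W12 i ((mate12 i x c - x) mod 12) \<and>
     colour12 x (mate12 i x c) = c \<and> mate12 i (mate12 i x c) c = x"
  by code_simp

lemma colour12_mate:
  "\<forall>i\<in>set [1, 2, 3]. \<forall>x\<in>set [0..11]. \<forall>x'\<in>set [0..11]. W12 i ((x' - x) mod 12) \<longrightarrow>
     0 \<le> colour12 x x' \<and> colour12 x x' \<le> 6 \<and> colour12 x' x = colour12 x x' \<and> mate12 i x (colour12 x x') = x' \<and> W12 i ((x - x') mod 12)"
  by code_simp

lemma nu12_three:
  "\<forall>i\<in>set [1, 2, 3]. \<forall>j\<in>set [1, 2, 3]. i \<noteq> j \<longrightarrow> (\<forall>x\<in>set [0..11]. \<forall>y\<in>set [0..11].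
     (y - x) mod 3 = shift12 i j \<longrightarrow> (\<forall>\<delta>\<in>set [3, 9]. let x' = (x + \<delta>) mod 12; y' = nu12 i j x x' y in
       0 \<le> y' \<and> y' < 12 \<and> ((y' - y) mod 12 = 3 \<or> (y' - y) mod 12 = 9) \<and> nu12 i j x' x y = y' \<and>
       (y' - x) mod 3 = shift12 i j \<and> nu12 i j x x' y' = y \<and> (x - y) mod 3 = shift12 j i \<and> nu12 j i y y' x = x'))"
  by code_simp

lemma has_CQS_12_3_2: "has_CQS 12 3 2"
proof -
  have Zs: "x \<in> {0..<12 :: int} \<Longrightarrow> x \<in> set [0..11]" for x by simp
  have gs: "grp3 i \<Longrightarrow> i \<in> set [1, 2, 3]" for i by simp
  have W0: "\<not> W12 i 0" "W12 i 3 = False" "W12 i 9 = False" for i by (simp_all add: W12_def)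
  have N: "sg12 i j ((a - b) mod 12) ((c - d) mod 3) = None \<longleftrightarrow>
      W12 i ((a - b) mod 12) \<or> ((a - b) mod 12 = 3 \<or> (a - b) mod 12 = 9) \<and> (c - d) mod 3 = shift12 i j"
    if "grp3 i" "grp3 j" "i \<noteq> j" "(a - b) mod 12 \<noteq> 0" for i j and a b c d :: int
  proof -
    have "0 \<le> (a - b) mod 12" "(a - b) mod 12 < 12" "0 \<le> (c - d) mod 3" "(c - d) mod 3 < 3" by simp_all
    then have "(a - b) mod 12 \<in> set [1..11]" "(c - d) mod 3 \<in> set [0..2]" using that(4) unfolding set_upto by auto
    then show ?thesis using sg12_None gs[OF that(1)] gs[OF that(2)] that(3) by blast
  qed
  interpret tripling 12 2 3 step12 sg12 nu12 "\<lambda>\<sigma>. if \<sigma> = 9 then 0 else 1" "\<lambda>a. if a = 0 then 9 else 11"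
  proof
    show "0 < (12 :: nat)" "(0 :: int) < 3" "(3 :: int) dvd int 12" "(3 :: int) dvd 3" by simp_all
  next
    fix \<sigma> t i \<delta> assume a: "\<sigma> \<in> {0..<int 12}" "t \<in> {0..<3 :: int}" "step12 \<sigma> t = Some (i, \<delta>)"
    have "\<sigma> \<in> set [0..11]" "t \<in> set [0..2]" using a by auto
    from step12_inverse[rule_format, OF this] show "grp3 i \<and> \<delta> \<in> {0<..<int 12} \<and>
      step12 ((\<sigma> + \<delta>) mod int 12) ((t + (if i = 1 then - \<delta> else if i = 2 then \<delta> else 0)) mod 3) = Some (i, int 12 - \<delta>)"
      using a(3) by simp
  next
    fix i j \<delta> \<tau> \<sigma> assume a: "grp3 i" "grp3 j" "i \<noteq> j" "\<delta> \<in> {0<..<int 12}" "\<tau> \<in> {0..<3 :: int}"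
    show "sg12 i j \<delta> \<tau> = Some \<sigma> \<longleftrightarrow> \<sigma> \<in> {0..<int 12} \<and> step12 \<sigma> (resid i j \<tau> \<sigma> mod 3) = Some (i, \<delta>)"
    proof
      assume s: "sg12 i j \<delta> \<tau> = Some \<sigma>"
      have "\<sigma> \<in> set [0..11] \<and> step12 \<sigma> (resid i j \<tau> \<sigma> mod 3) = Some (i, \<delta>)"
        using s unfolding sg12_def find_Some_iff by (metis nth_mem)
      then show "\<sigma> \<in> {0..<int 12} \<and> step12 \<sigma> (resid i j \<tau> \<sigma> mod 3) = Some (i, \<delta>)" by auto
    next
      assume s: "\<sigma> \<in> {0..<int 12} \<and> step12 \<sigma> (resid i j \<tau> \<sigma> mod 3) = Some (i, \<delta>)"
      then have "\<sigma> \<in> set [0..11]" "\<tau> \<in> set [0..2]" using a(5) by auto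
      from sg12_unique[rule_format, OF gs[OF a(1)] gs[OF a(2)] a(3) this(2,1)] show "sg12 i j \<delta> \<tau> = Some \<sigma>"
        using s by simp
    qed
  next
    fix i j x x' y assume a: "grp3 i" "grp3 j" "i \<noteq> j" "x \<in> {0..<int 12}" "x' \<in> {0..<int 12}" "x \<noteq> x'" "y \<in> {0..<int 12}"
      and n: "sg12 i j ((x' - x) mod int 12) ((y - x) mod 3) = None"
    have Z: "x \<in> set [0..11]" "x' \<in> set [0..11]" "y \<in> set [0..11]" using a(4,5,7) by auto
    note G = gs[OF a(1)] gs[OF a(2)]
    have i12: "int 12 = 12" by simp
    have d0: "(x' - x) mod 12 \<noteq> 0"
    proof
      assume "(x' - x) mod 12 = 0"
      then have "x' mod 12 = x mod 12" by (simp add: mod_eq_dvd_iff mod_0_imp_dvd)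
      then show False using a(4,5,6) by simp
    qed
    define y' where "y' = nu12 i j x x' y"
    have "y' \<in> {0..<12} \<and> y' \<noteq> y \<and> nu12 i j x' x y = y' \<and> sg12 i j ((x' - x) mod 12) ((y' - x) mod 3) = None \<and>
      nu12 i j x x' y' = y \<and> sg12 j i ((y' - y) mod 12) ((x - y) mod 3) = None \<and> nu12 j i y y' x = x'"
    proof (cases "W12 i ((x' - x) mod 12)")
      case True
      define c where "c = colour12 x x'"
      note c1 = colour12_mate[rule_format, OF G(1) Z(1,2) True, folded c_def]
      have c: "c \<in> set [0..6]" using c1 by auto
      have y': "y' = mate12 j y c" using True by (simp add: y'_def nu12_def c_def)
      note m = mate12_colour[rule_format, OF G(2) Z(3) c, folded y']
      have e0: "(y' - y) mod 12 \<noteq> 0" using m W0 by auto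
      have "y' \<noteq> y" using e0 by auto
      moreover have "nu12 i j x' x y = y'" using c1 y' by (simp add: nu12_def)
      moreover have "nu12 i j x x' y' = y" using True m by (simp add: nu12_def c_def[symmetric])
      moreover have "nu12 j i y y' x = x'" using m c1 by (simp add: nu12_def)
      ultimately show ?thesis using N[OF a(1-3) d0] N[OF a(2,1) a(3)[symmetric] e0] True m by simp
    next
      case False
      then have d: "(x' - x) mod 12 = 3 \<or> (x' - x) mod 12 = 9" and t: "(y - x) mod 3 = shift12 i j"
        using n N[OF a(1-3) d0] by auto
      define \<delta> where "\<delta> = (x' - x) mod 12"
      have \<delta>: "\<delta> \<in> set [3, 9]" using d by (auto simp: \<delta>_def)
      have x': "x' = (x + \<delta>) mod 12" using a(5) by (simp add: \<delta>_def mod_add_right_eq)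
      note k = nu12_three[rule_format, OF G a(3) Z(1,3) t \<delta>, folded x', unfolded Let_def, folded y'_def]
      have e0: "(y' - y) mod 12 \<noteq> 0" using k by auto
      then have "y' \<noteq> y" by auto
      moreover have "y' \<in> {0..<12}" using k by simp
      moreover have "sg12 i j ((x' - x) mod 12) ((y' - x) mod 3) = None" using N[OF a(1-3) d0, of y' x] d k by blast
      moreover have "sg12 j i ((y' - y) mod 12) ((x - y) mod 3) = None"
        using N[OF a(2,1) a(3)[symmetric] e0, of x y] k by blast
      ultimately show ?thesis using k by blast
    qed
    then show "let y' = nu12 i j x x' y in y' \<in> {0..<int 12} \<and> y' \<noteq> y \<and> nu12 i j x' x y = y' \<and>
        sg12 i j ((x' - x) mod int 12) ((y' - x) mod 3) = None \<and> nu12 i j x x' y' = y \<and>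
        sg12 j i ((y' - y) mod int 12) ((x - y) mod 3) = None \<and> nu12 j i y y' x = x'"
      unfolding Let_def i12 y'_def .
  next
    fix \<sigma> t assume a: "\<sigma> \<in> {0..<int 12}" "t \<in> {0..<3 :: int}" "step12 \<sigma> t = None"
    have "\<sigma> \<in> set [0..11]" "t \<in> set [0..2]" using a by auto
    from step12_inverse[rule_format, OF this] a(3)
    show "(if \<sigma> = 9 then 0 else 1) \<in> {0..<int 2} \<and> (if (if \<sigma> = 9 then 0 else 1) = (0 :: int) then 9 else 11) = \<sigma>" by auto
  next
    fix a t :: int assume "a \<in> {0..<int 2}"
    then have "a = 0 \<or> a = 1" by auto
    then show "(if a = 0 then 9 else 11) \<in> {0..<int 12} \<and> step12 (if a = 0 then 9 else 11) t = None \<and>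
      (if (if a = 0 then 9 else 11) = (9 :: int) then 0 else 1) = a" by (auto simp: step12_def)
  qed
  show ?thesis by (rule has_CQS_triple)
qed

section \<open>Hanani's existence theorem by strong induction\<close>

section \<open>Existence of quadruple systems\<close>

lemma has_SQS_2: "has_SQS 2"
proof -
  have "triples {..<2 :: nat} = {}" by (rule triples_small) simp_all
  then have "is_SQS {..<2 :: nat} {}" by (simp add: is_SQS_iff_exact exact_def)
  then show ?thesis unfolding has_SQS_def by blast
qed

text \<open>Orders 4 and 8 modulo 12 are doubled. The others are \<open>12 * u + 2\<close> and
  \<open>12 * u + 10\<close>. For even \<open>u\<close> four groups with a stem of two points
  suffice. For odd \<open>u\<close> the order is \<open>12 * (v - 1) + 2\<close> with
  \<open>v = u + 1\<close>, or \<open>6 * (v - 1) + 4\<close> with \<open>v = 2 * u + 2\<close>, and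
  a system of order \<open>v\<close> can be inflated. This fails precisely for \<open>u\<close>
  equal to 5 modulo 6, where 6 divides \<open>v\<close>; there the two infinite families with three
  groups step in.\<close>

theorem has_SQS_hanani:
  assumes "w mod 6 = 2 \<or> w mod 6 = 4"
  shows "has_SQS w"
  using assms
proof (induction w rule: less_induct)
  case (less w)
  note IH = less.IH
  have m: "(6 * k + c) mod 6 = c mod 6" for k c :: nat by simp
  have mod6: "(6 * k + c) mod 6 = c mod 6" "(12 * k + c) mod 6 = c mod 6" "(24 * k + c) mod 6 = c mod 6" for k c :: nat
    using m[of k c] m[of "2 * k" c] m[of "4 * k" c] by simp_all
  have h14: "has_SQS (12 + 2)" using has_SQS_14 by simp
  have inflate: "has_SQS (g * (v - 1) + s)" if "has_CQS g 3 s" "g > 0" "has_SQS (g + s)" "s = 2 \<or> s = 4" "v < w" "v mod 6 = 2 \<or> v mod 6 = 4" for g v s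
  proof -
    have v: "v \<ge> 2" using that(6) by presburger
    have c: "has_CQS g (v - 1) s" by (rule has_CQS_inflate[OF IH[OF that(5,6)] that(1,2) v])
    have "has_SQS ((v - 1) * g + s)" by (rule has_CQS_fill[OF c that(3,4)]) (use v in simp)
    then show ?thesis by (simp add: mult.commute)
  qed
  have "(w mod 12 = 4 \<or> w mod 12 = 8) \<or> w mod 12 = 2 \<or> w mod 12 = 10" using less.prems by presburger
  then consider (double) "w mod 12 = 4 \<or> w mod 12 = 8" | (two) "w mod 12 = 2" | (ten) "w mod 12 = 10" by blast
  then show ?case
  proof cases
    case double
    define v where "v = w div 2"
    have "w = 2 * v" "v mod 6 = 2 \<or> v mod 6 = 4" "v < w" using double unfolding v_def by presburger+
    then show ?thesis using has_SQS_double IH by metis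
  next
    case two
    define u where "u = w div 12"
    have u: "w = 12 * u + 2" using two unfolding u_def by presburger
    consider k where "u = 2 * k" | k where "u = 6 * k + 1" | k where "u = 6 * k + 3" | k where "u = 6 * k + 5"
    proof -
      have "u = 2 * (u div 2) \<or> u = 6 * (u div 6) + 1 \<or> u = 6 * (u div 6) + 3 \<or> u = 6 * (u div 6) + 5" by presburger
      then show ?thesis using that by metis
    qed
    then show ?thesis
    proof cases
      case (1 k)
      show ?thesis
      proof (cases "k = 0")
        case True
        then have w: "w = 2" using u 1 by simp
        show ?thesis unfolding w by (rule has_SQS_2)
      next
        case False
        have h: "has_SQS (6 * k + 2)" by (rule IH) (use u 1 False mod6(1)[of k 2] in auto)
        have c: "has_CQS (6 * k) 4 2" by (rule has_CQS_quadruple) (use False in auto)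
        have w: "w = 4 * (6 * k) + 2" using u 1 by simp
        show ?thesis unfolding w by (rule has_CQS_fill[OF c h]) simp_all
      qed
    next
      case (2 k)
      show ?thesis
      proof (cases "k = 0")
        case True then show ?thesis using u 2 has_SQS_14 by simp
      next
        case False
        have lt: "6 * k + 2 < w" using u 2 by simp
        have w: "w = 12 * (6 * k + 2 - 1) + 2" using u 2 by simp
        have "(6 * k + 2) mod 6 = 2" using mod6(1)[of k 2] by simp
        then have m: "(6 * k + 2) mod 6 = 2 \<or> (6 * k + 2) mod 6 = 4" by (rule disjI1)
        show ?thesis by (subst w, rule inflate[OF has_CQS_12_3_2 _ h14 _ lt m]) simp_all
      qed
    next
      case (3 k)
      have lt: "6 * k + 4 < w" using u 3 by simp
      have w: "w = 12 * (6 * k + 4 - 1) + 2" using u 3 by simp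
      have "(6 * k + 4) mod 6 = 4" using mod6(1)[of k 4] by simp
      then have m: "(6 * k + 4) mod 6 = 2 \<or> (6 * k + 4) mod 6 = 4" by (rule disjI2)
      show ?thesis by (subst w, rule inflate[OF has_CQS_12_3_2 _ h14 _ lt m]) simp_all
    next
      case (4 k)
      have "has_SQS (24 * k + 22)" by (rule IH) (use u 4 mod6(3)[of k 22] in auto)
      moreover have "24 * k + 22 = 12 * (2 * k + 1) + 8 + 2" by simp
      ultimately have h: "has_SQS (12 * (2 * k + 1) + 8 + 2)" by (simp only:)
      have w: "w = 3 * (12 * (2 * k + 1) + 8) + 2" using u 4 by simp
      show ?thesis unfolding w by (rule has_CQS_fill[OF has_CQS_triple_2 h]) simp_all
    qed
  next
    case ten
    define u where "u = w div 12"
    have u: "w = 12 * u + 10" using ten unfolding u_def by presburger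
    consider k where "u = 2 * k" | k where "u = 6 * k + 1" | k where "u = 6 * k + 3" | k where "u = 6 * k + 5"
    proof -
      have "u = 2 * (u div 2) \<or> u = 6 * (u div 6) + 1 \<or> u = 6 * (u div 6) + 3 \<or> u = 6 * (u div 6) + 5" by presburger
      then show ?thesis using that by metis
    qed
    then show ?thesis
    proof cases
      case (1 k)
      have "has_SQS (6 * k + 4)" by (rule IH) (use u 1 mod6(1)[of k 4] in auto)
      moreover have "6 * k + 4 = 6 * k + 2 + 2" by simp
      ultimately have h: "has_SQS (6 * k + 2 + 2)" by (simp only:)
      have c: "has_CQS (6 * k + 2) 4 2" by (rule has_CQS_quadruple) simp_all
      have w: "w = 4 * (6 * k + 2) + 2" using u 1 by simp
      show ?thesis unfolding w by (rule has_CQS_fill[OF c h]) simp_all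
    next
      case (2 k)
      have s10: "has_SQS (6 + 4)" by (rule IH) (use u 2 in auto)
      have lt: "12 * k + 4 < w" using u 2 by simp
      have w: "w = 6 * (12 * k + 4 - 1) + 4" using u 2 by simp
      have "(12 * k + 4) mod 6 = 4" using mod6(2)[of k 4] by simp
      then have m: "(12 * k + 4) mod 6 = 2 \<or> (12 * k + 4) mod 6 = 4" by (rule disjI2)
      show ?thesis by (subst w, rule inflate[OF has_CQS_6_3_4 _ s10 _ lt m]) simp_all
    next
      case (3 k)
      have s10: "has_SQS (6 + 4)" by (rule IH) (use u 3 in auto)
      have lt: "12 * k + 8 < w" using u 3 by simp
      have w: "w = 6 * (12 * k + 8 - 1) + 4" using u 3 by simp
      have "(12 * k + 8) mod 6 = 2" using mod6(2)[of k 8] by simp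
      then have m: "(12 * k + 8) mod 6 = 2 \<or> (12 * k + 8) mod 6 = 4" by (rule disjI1)
      show ?thesis by (subst w, rule inflate[OF has_CQS_6_3_4 _ s10 _ lt m]) simp_all
    next
      case (4 k)
      have "has_SQS (24 * k + 26)" by (rule IH) (use u 4 mod6(3)[of k 26] in auto)
      moreover have "24 * k + 26 = 12 * (2 * k + 1) + 10 + 4" by simp
      ultimately have h: "has_SQS (12 * (2 * k + 1) + 10 + 4)" by (simp only:)
      have w: "w = 3 * (12 * (2 * k + 1) + 10) + 4" using u 4 by simp
      show ?thesis unfolding w by (rule has_CQS_fill[OF has_CQS_triple_4 h]) simp_all
    qed
  qed
qed

section \<open>Lindner systems and doubling systems on two copies of a point set\<close>

section \<open>Systems on two copies of a point set\<close>

definition two_sided ::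
  "(bool \<Rightarrow> 'a \<Rightarrow> 'a \<Rightarrow> 'a \<Rightarrow> bool \<times> 'a) \<Rightarrow> (bool \<Rightarrow> 'a \<Rightarrow> 'a \<Rightarrow> 'a \<Rightarrow> bool \<times> 'a) \<Rightarrow>
    bool \<times> 'a \<Rightarrow> bool \<times> 'a \<Rightarrow> bool \<times> 'a \<Rightarrow> bool \<times> 'a" where
  "two_sided g h p q r =
    (if fst p = fst q
     then if fst q = fst r then g (fst p) (snd p) (snd q) (snd r) else h (fst p) (snd p) (snd q) (snd r)
     else if fst p = fst r then h (fst p) (snd p) (snd r) (snd q) else h (fst q) (snd q) (snd r) (snd p))"

text \<open>A quadruple system on two copies of \<open>Q\<close>: \<open>g s x y z\<close> completes three points on side \<open>s\<close>, and
  \<open>h s x y u\<close> completes two points on side \<open>s\<close> and one on the other side.\<close>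

locale two_sided_skein =
  fixes Q :: "'a set" and g h :: "bool \<Rightarrow> 'a \<Rightarrow> 'a \<Rightarrow> 'a \<Rightarrow> bool \<times> 'a"
  assumes fin: "finite Q"
    and g_sym: "\<And>s x y z. x \<in> Q \<Longrightarrow> y \<in> Q \<Longrightarrow> z \<in> Q \<Longrightarrow> distinct [x, y, z] \<Longrightarrow> g s y x z = g s x y z \<and> g s x z y = g s x y z"
    and g_same: "\<And>s x y z w. x \<in> Q \<Longrightarrow> y \<in> Q \<Longrightarrow> z \<in> Q \<Longrightarrow> distinct [x, y, z] \<Longrightarrow> g s x y z = (s, w) \<Longrightarrow>
      w \<in> Q - {x, y, z} \<and> g s x y w = (s, z)"
    and g_other: "\<And>s x y z w. x \<in> Q \<Longrightarrow> y \<in> Q \<Longrightarrow> z \<in> Q \<Longrightarrow> distinct [x, y, z] \<Longrightarrow> g s x y z = (\<not> s, w) \<Longrightarrow>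
      w \<in> Q \<and> h s x y w = (s, z)"
    and h_sym: "\<And>s x y u. x \<in> Q \<Longrightarrow> y \<in> Q \<Longrightarrow> u \<in> Q \<Longrightarrow> x \<noteq> y \<Longrightarrow> h s y x u = h s x y u"
    and h_same: "\<And>s x y u w. x \<in> Q \<Longrightarrow> y \<in> Q \<Longrightarrow> u \<in> Q \<Longrightarrow> x \<noteq> y \<Longrightarrow> h s x y u = (s, w) \<Longrightarrow>
      w \<in> Q - {x, y} \<and> g s x y w = (\<not> s, u) \<and> h s x w u = (s, y)"
    and h_other: "\<And>s x y u w. x \<in> Q \<Longrightarrow> y \<in> Q \<Longrightarrow> u \<in> Q \<Longrightarrow> x \<noteq> y \<Longrightarrow> h s x y u = (\<not> s, w) \<Longrightarrow>
      w \<in> Q - {u} \<and> h s x y w = (\<not> s, u) \<and> h (\<not> s) u w x = (s, y)"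
begin

abbreviation f where "f \<equiv> two_sided g h"

definition blocks :: "(bool \<times> 'a) set set" where
  "blocks = {{p, q, r, f p q r} | p q r. {p, q, r} \<subseteq> UNIV \<times> Q \<and> distinct [p, q, r]}"

lemma skein:
  assumes "p \<in> UNIV \<times> Q" "q \<in> UNIV \<times> Q" "r \<in> UNIV \<times> Q" "distinct [p, q, r]"
  shows "f p q r \<in> UNIV \<times> Q - {p, q, r} \<and> f q p r = f p q r \<and> f p r q = f p q r \<and> f p q (f p q r) = r"
proof -
  obtain s1 x s2 y s3 z where pqr: "p = (s1, x)" "q = (s2, y)" "r = (s3, z)" by (cases p, cases q, cases r)
  have Q: "x \<in> Q" "y \<in> Q" "z \<in> Q" using assms pqr by auto
  consider (all) "s2 = s1" "s3 = s1" | (pq) "s2 = s1" "s3 = (\<not> s1)" | (pr) "s3 = s1" "s2 = (\<not> s1)" | (qr) "s3 = s2" "s1 = (\<not> s2)"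
    by blast
  then show ?thesis
  proof cases
    case all
    have d: "distinct [x, y, z]" using assms(4) pqr all by auto
    obtain t w where v: "g s1 x y z = (t, w)" by (cases "g s1 x y z")
    show ?thesis
    proof (cases "t = s1")
      case True
      then show ?thesis using g_same[OF Q d, of s1 w] g_sym[OF Q d, of s1] v pqr all by (auto simp: two_sided_def)
    next
      case False
      then have "t = (\<not> s1)" by blast
      then show ?thesis using g_other[OF Q d, of s1 w] g_sym[OF Q d, of s1] v pqr all by (auto simp: two_sided_def)
    qed
  next
    case pq
    have d: "x \<noteq> y" using assms(4) pqr pq by auto
    obtain t w where v: "h s1 x y z = (t, w)" by (cases "h s1 x y z")
    show ?thesis
    proof (cases "t = s1")
      case True
      then show ?thesis using h_same[OF Q d, of s1 w] h_sym[OF Q d, of s1] v pqr pq by (auto simp: two_sided_def)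
    next
      case False
      then have "t = (\<not> s1)" by blast
      then show ?thesis using h_other[OF Q d, of s1 w] h_sym[OF Q d, of s1] v pqr pq by (auto simp: two_sided_def)
    qed
  next
    case pr
    have d: "x \<noteq> z" using assms(4) pqr pr by auto
    obtain t w where v: "h s1 x z y = (t, w)" by (cases "h s1 x z y")
    show ?thesis
    proof (cases "t = s1")
      case True
      then show ?thesis using h_same[OF Q(1,3,2) d, of s1 w] h_sym[OF Q(1,3,2) d, of s1] v pqr pr by (auto simp: two_sided_def)
    next
      case False
      then have "t = (\<not> s1)" by blast
      then show ?thesis using h_other[OF Q(1,3,2) d, of s1 w] h_sym[OF Q(1,3,2) d, of s1] v pqr pr by (auto simp: two_sided_def)
    qed
  next
    case qr
    have d: "y \<noteq> z" using assms(4) pqr qr by auto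
    obtain t w where v: "h s2 y z x = (t, w)" by (cases "h s2 y z x")
    show ?thesis
    proof (cases "t = s2")
      case True
      then show ?thesis using h_same[OF Q(2,3,1) d, of s2 w] h_sym[OF Q(2,3,1) d, of s2] v pqr qr by (auto simp: two_sided_def)
    next
      case False
      then have "t = (\<not> s2)" by blast
      then show ?thesis using h_other[OF Q(2,3,1) d, of s2 w] h_sym[OF Q(2,3,1) d, of s2] v pqr qr by (auto simp: two_sided_def)
    qed
  qed
qed

lemma is_SQS_blocks: "is_SQS (UNIV \<times> Q) blocks"
  unfolding blocks_def by (rule is_SQS_skein) (use fin skein in auto)

lemma block_eq:
  assumes "b \<in> blocks" "p \<in> b" "q \<in> b" "r \<in> b" "distinct [p, q, r]"
  shows "b = {p, q, r, f p q r}" "f p q r \<notin> {p, q, r}"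
proof -
  have ex: "exact (triples (UNIV \<times> Q)) blocks" using is_SQS_blocks is_SQS_iff_exact by blast
  have "b \<subseteq> UNIV \<times> Q" using is_SQS_blocks assms(1) unfolding is_SQS_def by blast
  then have P: "p \<in> UNIV \<times> Q" "q \<in> UNIV \<times> Q" "r \<in> UNIV \<times> Q" using assms by blast+
  have m: "{p, q, r, f p q r} \<in> blocks" unfolding blocks_def using P assms(5) by blast
  show "b = {p, q, r, f p q r}"
    by (rule exactD_unique[OF ex assms(1) m, of "{p, q, r}"]) (use assms in auto)
  show "f p q r \<notin> {p, q, r}" using skein[OF P assms(5)] by blast
qed

end

lemma four_points_two_sides:
  fixes b :: "(bool \<times> 'a) set"
  assumes "card b = 4"
  shows "(\<exists>s x y z. distinct [x, y, z] \<and> (s, x) \<in> b \<and> (s, y) \<in> b \<and> (s, z) \<in> b) \<or>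
    (\<exists>x y u v. x \<noteq> y \<and> u \<noteq> v \<and> (False, x) \<in> b \<and> (False, y) \<in> b \<and> (True, u) \<in> b \<and> (True, v) \<in> b)"
proof -
  define A where "A s = {x. (s, x) \<in> b}" for s
  have fb: "finite b" using assms card_ge_0_finite[of b] by simp
  have im: "Pair s ` A s \<subseteq> b" for s by (auto simp: A_def)
  have inj: "inj_on (Pair s) (A s)" for s by (simp add: inj_on_def)
  have finA: "finite (A s)" for s using finite_imageD[OF finite_subset[OF im fb] inj] .
  have "b = Pair False ` A False \<union> Pair True ` A True"
  proof (rule set_eqI)
    fix p show "p \<in> b \<longleftrightarrow> p \<in> Pair False ` A False \<union> Pair True ` A True" by (cases p; cases "fst p") (auto simp: A_def)
  qed
  moreover have "Pair False ` A False \<inter> Pair True ` A True = {}" by auto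
  ultimately have "card b = card (Pair False ` A False) + card (Pair True ` A True)"
    using finA by (metis card_Un_disjoint finite_imageI)
  then have sum: "card (A False) + card (A True) = 4" using assms inj by (simp add: card_image)
  show ?thesis
  proof (cases "\<exists>s. card (A s) \<ge> 3")
    case True
    then obtain s T where T: "T \<subseteq> A s" "card T = 3" by (metis obtain_subset_with_card_n)
    obtain x y z where "T = {x, y, z}" "x \<noteq> y" "x \<noteq> z" "y \<noteq> z" using T(2) by (rule card3_obtain)
    then have "distinct [x, y, z]" "(s, x) \<in> b" "(s, y) \<in> b" "(s, z) \<in> b" using T(1) by (auto simp: A_def)
    then show ?thesis by blast
  next
    case False
    then have "\<not> card (A False) \<ge> 3" "\<not> card (A True) \<ge> 3" by blast+
    then have "card (A False) = 2" "card (A True) = 2" using sum by linarith+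
    then obtain x y u v where xy: "A False = {x, y}" "x \<noteq> y" "A True = {u, v}" "u \<noteq> v" by (metis card_2_iff)
    then have "(False, x) \<in> b" "(False, y) \<in> b" "(True, u) \<in> b" "(True, v) \<in> b" by (auto simp: A_def)
    then show ?thesis using xy(2,4) by blast
  qed
qed

text \<open>A block has three points on one side or two on each. Three points determine it, so in a
  common block both systems complete them alike; this reduces disjointness to comparing
  \<open>g\<close> with \<open>g'\<close> and \<open>h\<close> with \<open>h'\<close>.\<close>

lemma common_block:
  assumes S: "two_sided_skein Q g h" and S': "two_sided_skein Q g' h'"
    and b: "b \<in> two_sided_skein.blocks Q g h" "b \<in> two_sided_skein.blocks Q g' h'"
  shows "(\<exists>s x y z. {x, y, z} \<subseteq> Q \<and> distinct [x, y, z] \<and> g s x y z = g' s x y z) \<or>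
    (\<exists>x y u v. {x, y, u, v} \<subseteq> Q \<and> x \<noteq> y \<and> u \<noteq> v \<and> h False x y u = (True, v) \<and> h' False x y u = (True, v))"
proof -
  interpret A: two_sided_skein Q g h by (rule S)
  interpret B: two_sided_skein Q g' h' by (rule S')
  have c4: "card b = 4" and sub: "b \<subseteq> UNIV \<times> Q" using A.is_SQS_blocks b(1) unfolding is_SQS_def by blast+
  have eq: "A.f p q r = B.f p q r" if "p \<in> b" "q \<in> b" "r \<in> b" "distinct [p, q, r]" for p q r
  proof -
    have "A.f p q r \<in> b" by (rule subsetD[OF equalityD2[OF A.block_eq(1)[OF b(1) that]]]) simp
    from subsetD[OF equalityD1[OF B.block_eq(1)[OF b(2) that]] this] show ?thesis
      using A.block_eq(2)[OF b(1) that] by simp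
  qed
  from four_points_two_sides[OF c4] show ?thesis
  proof
    assume "\<exists>s x y z. distinct [x, y, z] \<and> (s, x) \<in> b \<and> (s, y) \<in> b \<and> (s, z) \<in> b"
    then obtain s x y z where *: "distinct [x, y, z]" "(s, x) \<in> b" "(s, y) \<in> b" "(s, z) \<in> b" by blast
    then have "g s x y z = g' s x y z" using eq[of "(s, x)" "(s, y)" "(s, z)"] by (simp add: two_sided_def)
    moreover have "{x, y, z} \<subseteq> Q" using *(2-4) sub by auto
    ultimately show ?thesis using *(1) by blast
  next
    assume "\<exists>x y u v. x \<noteq> y \<and> u \<noteq> v \<and> (False, x) \<in> b \<and> (False, y) \<in> b \<and> (True, u) \<in> b \<and> (True, v) \<in> b"
    then obtain x y u v where *: "x \<noteq> y" "u \<noteq> v" "(False, x) \<in> b" "(False, y) \<in> b" "(True, u) \<in> b" "(True, v) \<in> b" by blast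
    let ?p = "(False, x)" and ?q = "(False, y)" and ?r = "(True, u)"
    have d: "distinct [?p, ?q, ?r]" using * by simp
    have h: "A.f ?p ?q ?r = h False x y u" "B.f ?p ?q ?r = h' False x y u" by (simp_all add: two_sided_def)
    have "h False x y u = (True, v)"
      using subsetD[OF equalityD1[OF A.block_eq(1)[OF b(1) *(3,4,5) d]] *(6)] *(2) unfolding h by simp
    moreover have "h' False x y u = (True, v)"
      using subsetD[OF equalityD1[OF B.block_eq(1)[OF b(2) *(3,4,5) d]] *(6)] *(2) unfolding h by simp
    moreover have "{x, y, u, v} \<subseteq> Q" using *(3-6) sub by auto
    ultimately show ?thesis using *(1,2) by blast
  qed
qed

text \<open>The side also selects the direction: \<open>\<alpha> (\<not> s)\<close> is meant to be
  the inverse of \<open>\<alpha> s\<close>.\<close>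

definition lindner_h :: "('a \<Rightarrow> 'a \<Rightarrow> 'a \<Rightarrow> 'a) \<Rightarrow> (bool \<Rightarrow> 'a \<Rightarrow> 'a) \<Rightarrow> bool \<Rightarrow> 'a \<Rightarrow> 'a \<Rightarrow> 'a \<Rightarrow> bool \<times> 'a" where
  "lindner_h q \<alpha> s x y u = (if u = \<alpha> s x then (\<not> s, \<alpha> s y) else if u = \<alpha> s y then (\<not> s, \<alpha> s x) else (s, q x y (\<alpha> (\<not> s) u)))"

text \<open>After the sides are identified by \<open>\<alpha>\<close>, the blocks are the blocks of
  \<open>q\<close> split three to one between the sides, and the pairs repeated on both
  sides.\<close>

lemma lindner_skein:
  assumes fin: "finite Q"
    and q: "\<And>x y z. x \<in> Q \<Longrightarrow> y \<in> Q \<Longrightarrow> z \<in> Q \<Longrightarrow> distinct [x, y, z] \<Longrightarrow>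
      q x y z \<in> Q - {x, y, z} \<and> q y x z = q x y z \<and> q x z y = q x y z \<and> q x y (q x y z) = z"
    and \<alpha>: "\<And>s x. x \<in> Q \<Longrightarrow> \<alpha> s x \<in> Q \<and> \<alpha> (\<not> s) (\<alpha> s x) = x"
  shows "two_sided_skein Q (\<lambda>s x y z. (\<not> s, \<alpha> s (q x y z))) (lindner_h q \<alpha>)"
proof
  have inj: "\<alpha> s x = \<alpha> s y \<longleftrightarrow> x = y" if "x \<in> Q" "y \<in> Q" for s x y using \<alpha> that by metis
  have flip: "u = \<alpha> s x \<longleftrightarrow> \<alpha> (\<not> s) u = x" if "x \<in> Q" "u \<in> Q" for s x u using \<alpha>[of x s] \<alpha>[of u "\<not> s"] that by auto
  show "finite Q" by (rule fin)
  fix s :: bool and x y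
  {
    fix z assume a: "x \<in> Q" "y \<in> Q" "z \<in> Q" "distinct [x, y, z]"
    note qa = q[OF a]
    show "(\<not> s, \<alpha> s (q y x z)) = (\<not> s, \<alpha> s (q x y z)) \<and> (\<not> s, \<alpha> s (q x z y)) = (\<not> s, \<alpha> s (q x y z))"
      using qa by simp
    fix w
    show "w \<in> Q - {x, y, z} \<and> (\<not> s, \<alpha> s (q x y w)) = (s, z)" if "(\<not> s, \<alpha> s (q x y z)) = (s, w)" using that by simp
    assume "(\<not> s, \<alpha> s (q x y z)) = (\<not> s, w)"
    then have w: "w = \<alpha> s (q x y z)" by simp
    have "w \<in> Q" "w \<noteq> \<alpha> s x" "w \<noteq> \<alpha> s y" "\<alpha> (\<not> s) w = q x y z"
      unfolding w using inj[of "q x y z"] qa a \<alpha>[of "q x y z" s] by auto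
    then show "w \<in> Q \<and> lindner_h q \<alpha> s x y w = (s, z)" using qa by (simp add: lindner_h_def)
  }
  fix u assume a: "x \<in> Q" "y \<in> Q" "u \<in> Q" "x \<noteq> y"
  define v where "v = \<alpha> (\<not> s) u"
  have v: "v \<in> Q" "\<alpha> s v = u" using \<alpha>[OF a(3), of "\<not> s"] by (auto simp: v_def)
  have ne: "\<alpha> s x \<noteq> \<alpha> s y" using inj a by simp
  show "lindner_h q \<alpha> s y x u = lindner_h q \<alpha> s x y u"
  proof (cases "u = \<alpha> s x \<or> u = \<alpha> s y")
    case True then show ?thesis using ne by (auto simp: lindner_h_def)
  next
    case False
    then have "distinct [x, y, v]" using v a(4) by auto
    then show ?thesis using False q[OF a(1,2) v(1)] by (simp add: lindner_h_def v_def[symmetric])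
  qed
  fix w
  {
    assume e: "lindner_h q \<alpha> s x y u = (s, w)"
    then have n: "u \<noteq> \<alpha> s x" "u \<noteq> \<alpha> s y" and w: "w = q x y v" by (auto simp: lindner_h_def v_def split: if_splits)
    have d: "distinct [x, y, v]" using n v a(4) by auto
    note qv = q[OF a(1,2) v(1) d]
    have wQ: "w \<in> Q - {x, y, v}" using qv w by simp
    have "\<alpha> s (q x y w) = u" using qv w v(2) by simp
    moreover have "u \<noteq> \<alpha> s w" using inj[of w v s] wQ v by auto
    moreover have "q x w v = y"
    proof -
      have "q x v y = w" using qv w by simp
      moreover have "q x v (q x v y) = y" using q[OF a(1) v(1) a(2)] d by auto
      moreover have "q x w v = q x v w" using q[OF a(1) v(1), of w] wQ d by auto
      ultimately show ?thesis by simp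
    qed
    ultimately show "w \<in> Q - {x, y} \<and> (\<not> s, \<alpha> s (q x y w)) = (\<not> s, u) \<and> lindner_h q \<alpha> s x w u = (s, y)"
      using wQ n(1) by (simp add: lindner_h_def v_def[symmetric])
  }
  assume e: "lindner_h q \<alpha> s x y u = (\<not> s, w)"
  then consider "u = \<alpha> s x" "w = \<alpha> s y" | "u = \<alpha> s y" "w = \<alpha> s x" by (auto simp: lindner_h_def split: if_splits)
  then show "w \<in> Q - {u} \<and> lindner_h q \<alpha> s x y w = (\<not> s, u) \<and> lindner_h q \<alpha> (\<not> s) u w x = (s, y)"
    using \<alpha>[OF a(1), of s] \<alpha>[OF a(2), of s] ne a(4) by cases (auto simp: lindner_h_def)
qed

text \<open>The colour rises by \<open>j\<close> from left to right, hence it falls by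
  \<open>j\<close> from right to left.\<close>

definition doubling_h :: "('a \<Rightarrow> 'a \<Rightarrow> int) \<Rightarrow> ('a \<Rightarrow> int \<Rightarrow> 'a) \<Rightarrow> int \<Rightarrow> int \<Rightarrow> bool \<Rightarrow> 'a \<Rightarrow> 'a \<Rightarrow> 'a \<Rightarrow> bool \<times> 'a" where
  "doubling_h \<kappa> \<mu> N j s x y u = (\<not> s, \<mu> u ((\<kappa> x y + (if s then - j else j)) mod N))"

lemma doubling_skein:
  assumes fin: "finite Q"
    and q: "\<And>x y z. x \<in> Q \<Longrightarrow> y \<in> Q \<Longrightarrow> z \<in> Q \<Longrightarrow> distinct [x, y, z] \<Longrightarrow>
      q x y z \<in> Q - {x, y, z} \<and> q y x z = q x y z \<and> q x z y = q x y z \<and> q x y (q x y z) = z"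
    and N: "N > 0" and \<kappa>: "\<And>x y. x \<in> Q \<Longrightarrow> y \<in> Q \<Longrightarrow> x \<noteq> y \<Longrightarrow> \<kappa> x y \<in> {0..<N} \<and> \<kappa> y x = \<kappa> x y \<and> \<mu> x (\<kappa> x y) = y"
    and \<mu>: "\<And>x c. x \<in> Q \<Longrightarrow> c \<in> {0..<N} \<Longrightarrow> \<mu> x c \<in> Q - {x} \<and> \<kappa> x (\<mu> x c) = c"
  shows "two_sided_skein Q (\<lambda>s x y z. (s, q x y z)) (doubling_h \<kappa> \<mu> N j)"
proof
  show "finite Q" by (rule fin)
  fix s :: bool and x y
  {
    fix z assume a: "x \<in> Q" "y \<in> Q" "z \<in> Q" "distinct [x, y, z]"
    note qa = q[OF a]
    show "(s, q y x z) = (s, q x y z) \<and> (s, q x z y) = (s, q x y z)" using qa by simp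
    fix w
    show "w \<in> Q - {x, y, z} \<and> (s, q x y w) = (s, z)" if "(s, q x y z) = (s, w)" using that qa by auto
    show "w \<in> Q \<and> doubling_h \<kappa> \<mu> N j s x y w = (s, z)" if "(s, q x y z) = (\<not> s, w)" using that by simp
  }
  fix u assume a: "x \<in> Q" "y \<in> Q" "u \<in> Q" "x \<noteq> y"
  note k = \<kappa>[OF a(1,2,4)]
  show "doubling_h \<kappa> \<mu> N j s y x u = doubling_h \<kappa> \<mu> N j s x y u" using k by (simp add: doubling_h_def)
  fix w
  show "w \<in> Q - {x, y} \<and> (s, q x y w) = (\<not> s, u) \<and> doubling_h \<kappa> \<mu> N j s x w u = (s, y)"
    if "doubling_h \<kappa> \<mu> N j s x y u = (s, w)" using that by (simp add: doubling_h_def)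
  assume e: "doubling_h \<kappa> \<mu> N j s x y u = (\<not> s, w)"
  define e where "e = (if s then - j else j)"
  define c where "c = (\<kappa> x y + e) mod N"
  have c: "c \<in> {0..<N}" using N by (simp add: c_def)
  have w: "w = \<mu> u c" using e by (simp add: doubling_h_def c_def e_def)
  have m: "w \<in> Q - {u}" "\<kappa> u w = c" using \<mu>[OF a(3) c] w by auto
  have "\<kappa> w u = c" "\<mu> w (\<kappa> w u) = u" using \<kappa>[of w u] \<kappa>[of u w] m a(3) by auto
  then have "\<mu> w c = u" by simp
  moreover have "(c - e) mod N = \<kappa> x y"
  proof -
    have "(c - e) mod N = (\<kappa> x y + e - e) mod N" unfolding c_def by (rule mod_diff_left_eq)
    then show ?thesis using k by simp
  qed
  moreover have "(if \<not> s then - j else j) = - e" by (simp add: e_def)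
  ultimately show "w \<in> Q - {u} \<and> doubling_h \<kappa> \<mu> N j s x y w = (\<not> s, u) \<and> doubling_h \<kappa> \<mu> N j (\<not> s) u w x = (s, y)"
    using m k unfolding doubling_h_def by (simp add: e_def[symmetric] c_def[symmetric])
qed

section \<open>A one-factorization of the complete graph on two copies of Z_n\<close>

section \<open>A near-invariant one-factorization\<close>

lemma odd_shift_proper:
  fixes n d x :: int
  assumes "0 < d" "2 * d < n" "x \<in> {0..<n}"
  shows "cyc n d x \<in> {0, 1, 2}" "cyc n d ((x - d) mod n) \<in> {0, 1, 2}" "cyc n d x \<noteq> cyc n d ((x - d) mod n)"
proof -
  note sf = shift_facts[OF assms(3,1,2)]
  show "cyc n d x \<in> {0, 1, 2}" using cyc_proper(2)[of d n x] assms by simp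
  show "cyc n d ((x - d) mod n) \<in> {0, 1, 2}" using cyc_proper(2)[of d n "(x - d) mod n"] assms sf(2) by simp
  show "cyc n d x \<noteq> cyc n d ((x - d) mod n)" using cyc_proper(1)[of d n "(x - d) mod n"] assms sf(2,4) by simp
qed

text \<open>The distances 1, 2, ... inside a copy get the even labels 0, 2, ..., n - 3, and a mixed
  pair has its sum as label. So an even label below \<open>n - 1\<close> combines one distance with
  one perfect matching between the copies.\<close>

definition lab :: "int \<Rightarrow> int \<times> bool \<Rightarrow> int \<times> bool \<Rightarrow> int" where
  "lab n p q = (if snd p = snd q then 2 * (min ((fst q - fst p) mod n) ((fst p - fst q) mod n) - 1) else (fst p + fst q) mod n)"

text \<open>The second copy is reflected so that a rung, a mixed pair with sum \<open>a\<close>,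
  joins points at equal positions, while distances inside the copy are kept.\<close>

definition pos :: "int \<Rightarrow> int \<Rightarrow> int \<times> bool \<Rightarrow> int" where
  "pos n a p = (if snd p then (a - fst p) mod n else fst p)"

text \<open>For even \<open>a < n - 1\<close> the pairs with label \<open>a\<close> form two cycles of step \<open>a div 2 + 1\<close> joined by the rungs
  \<open>x + y = a\<close>; they receive the three colours \<open>2 a, 2 a + 1, 2 a + 2\<close>. The other labels form perfect matchings.\<close>

definition colour :: "int \<Rightarrow> int \<times> bool \<Rightarrow> int \<times> bool \<Rightarrow> int" where
  "colour n p q = (let a = lab n p q; d = a div 2 + 1 in 2 * a +
     (if odd a then 1 else if a = n - 1 then 0
      else if snd p = snd q then cyc n d (if pos n a q = (pos n a p + d) mod n then pos n a p else pos n a q)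
      else 3 - cyc n d (pos n a p) - cyc n d ((pos n a p - d) mod n)))"

lemma lab_same:
  fixes n :: int
  assumes n: "odd n" and pq: "p \<in> {0..<n} \<times> UNIV" "q \<in> {0..<n} \<times> UNIV" "p \<noteq> q" "snd p = snd q"
  defines "a \<equiv> lab n p q" and "d \<equiv> lab n p q div 2 + 1"
  shows "even a" "0 \<le> a" "a < n - 1" "0 < d" "2 * d < n"
    "pos n a q = (pos n a p + d) mod n \<or> pos n a q = (pos n a p - d) mod n"
proof -
  obtain x l where p: "p = (x, l)" by (cases p)
  obtain y where q: "q = (y, l)" using pq(4) p by (cases q) auto
  have Z: "x \<in> {0..<n}" "y \<in> {0..<n}" "x \<noteq> y" using pq p q by auto
  define m where "m = (y - x) mod n"
  have npos: "0 < n" using Z by auto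
  have m0: "m \<noteq> 0"
  proof
    assume "m = 0"
    then have "y mod n = x mod n" unfolding m_def by (simp add: mod_eq_dvd_iff mod_0_imp_dvd)
    then show False using Z by simp
  qed
  have m: "0 < m" "m < n" using m0 npos pos_mod_sign[of n "y - x"] pos_mod_bound[of n "y - x"] unfolding m_def by linarith+
  have "(x - y) mod n = (- (y - x)) mod n" by simp
  also have "\<dots> = n - m" using m0 by (simp only: zmod_zminus1_eq_if m_def if_False)
  finally have m': "(x - y) mod n = n - m" .
  have a: "a = 2 * (min m (n - m) - 1)" unfolding a_def lab_def using p q m' by (simp add: m_def)
  have d: "d = min m (n - m)" using a unfolding d_def a_def by simp
  have ne: "2 * m \<noteq> n" using n by auto
  show "even a" "0 \<le> a" "0 < d" "2 * d < n" "a < n - 1" using a d m ne by (auto simp: min_def)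
  then have dn: "0 < d" "d < n" by auto
  have yc: "y = (x + d) mod n \<or> y = (x - d) mod n"
  proof (cases "m \<le> n - m")
    case True
    then have "d = m" using d by simp
    then show ?thesis using diff_mod_iff(1)[OF Z(1,2) dn] unfolding m_def by simp
  next
    case False
    then have "(x - y) mod n = d" using d m' by simp
    then show ?thesis using diff_mod_iff(3)[OF Z(1,2) dn] by simp
  qed
  show "pos n a q = (pos n a p + d) mod n \<or> pos n a q = (pos n a p - d) mod n"
  proof (cases l)
    case True
    have "(a - (x + d) mod n) mod n = ((a - x) mod n - d) mod n"
    proof -
      have "a - (x + d) = a - x - d" by simp
      then show ?thesis unfolding mod_diff_right_eq mod_diff_left_eq by (simp only:)
    qed
    moreover have "(a - (x - d) mod n) mod n = ((a - x) mod n + d) mod n"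
    proof -
      have "a - (x - d) = a - x + d" by simp
      then show ?thesis unfolding mod_diff_right_eq mod_add_left_eq by (simp only:)
    qed
    ultimately show ?thesis using yc True unfolding p q pos_def by auto
  next
    case False then show ?thesis using yc unfolding p q pos_def by simp
  qed
qed

lemma lab_diff:
  fixes n :: int
  assumes pq: "p \<in> {0..<n} \<times> UNIV" "q \<in> {0..<n} \<times> UNIV" "snd p \<noteq> snd q"
  shows "0 \<le> lab n p q" "lab n p q < n" "pos n (lab n p q) q = pos n (lab n p q) p"
proof -
  obtain x l where p: "p = (x, l)" by (cases p)
  obtain y where q: "q = (y, \<not> l)" using pq(3) p by (cases q) auto
  have Z: "x \<in> {0..<n}" "y \<in> {0..<n}" using pq p q by auto
  show "0 \<le> lab n p q" "lab n p q < n" using Z p q by (auto simp: lab_def)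
  have "((x + y) mod n - x) mod n = y" "((x + y) mod n - y) mod n = x" using Z by (simp_all add: mod_diff_left_eq)
  then show "pos n (lab n p q) q = pos n (lab n p q) p" unfolding p q lab_def pos_def by simp
qed

lemma pos_range: "p \<in> {0..<n} \<times> UNIV \<Longrightarrow> pos n a p \<in> {0..<n :: int}"
  by (auto simp: pos_def)

lemma pos_inj:
  assumes "p \<in> {0..<n} \<times> UNIV" "q \<in> {0..<n} \<times> UNIV" "snd p = snd q" "pos n a p = pos n a q"
  shows "p = q"
proof -
  have "fst p = fst q"
  proof (cases "snd q")
    case True
    then have "(a - fst p) mod n = (a - fst q) mod n" using assms(3,4) by (simp add: pos_def)
    then have "(a - (a - fst p)) mod n = (a - (a - fst q)) mod n" by (metis mod_diff_right_eq)
    then show ?thesis using assms(1,2) by auto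
  next
    case False then show ?thesis using assms(3,4) by (simp add: pos_def)
  qed
  then show ?thesis using assms(3) by (simp add: prod_eq_iff)
qed

lemma colour_cases:
  fixes n :: int
  assumes n: "odd n" and pq: "p \<in> {0..<n} \<times> UNIV" "q \<in> {0..<n} \<times> UNIV" "p \<noteq> q"
  defines "a \<equiv> lab n p q" and "d \<equiv> lab n p q div 2 + 1"
  obtains (odd) "snd p \<noteq> snd q" "odd a" "0 \<le> a" "a < n - 1" "colour n p q = 2 * a + 1"
  | (last) "snd p \<noteq> snd q" "even a" "a = n - 1" "colour n p q = 2 * a"
  | (rung) "even a" "0 \<le> a" "a < n - 1" "snd p \<noteq> snd q" "pos n a q = pos n a p"
      "colour n p q = 2 * a + (3 - cyc n d (pos n a p) - cyc n d ((pos n a p - d) mod n))"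
  | (up) "even a" "0 \<le> a" "a < n - 1" "snd p = snd q" "pos n a q = (pos n a p + d) mod n"
      "colour n p q = 2 * a + cyc n d (pos n a p)"
  | (down) "even a" "0 \<le> a" "a < n - 1" "snd p = snd q" "pos n a q = (pos n a p - d) mod n"
      "colour n p q = 2 * a + cyc n d ((pos n a p - d) mod n)"
proof (cases "snd p = snd q")
  case True
  note L = lab_same[OF n pq True, folded a_def d_def]
  have da: "a div 2 + 1 = d" by (simp add: a_def d_def)
  have an: "a \<noteq> n - 1" using L(3) by simp
  have c: "colour n p q = 2 * a + cyc n d (if pos n a q = (pos n a p + d) mod n then pos n a p else pos n a q)"
    unfolding colour_def Let_def a_def[symmetric] da using True L(1) an by simp
  show ?thesis
  proof (cases "pos n a q = (pos n a p + d) mod n")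
    case T: True
    show ?thesis by (rule up[OF L(1-3) True T]) (use c T in simp)
  next
    case F: False
    then have e: "pos n a q = (pos n a p - d) mod n" using L(6) by simp
    show ?thesis by (rule down[OF L(1-3) True e]) (use c F e in simp)
  qed
next
  case False
  note L = lab_diff[OF pq(1,2) False, folded a_def]
  have da: "a div 2 + 1 = d" by (simp add: a_def d_def)
  have c: "colour n p q = 2 * a + (if odd a then 1 else if a = n - 1 then 0 else 3 - cyc n d (pos n a p) - cyc n d ((pos n a p - d) mod n))"
    unfolding colour_def Let_def a_def[symmetric] da using False by simp
  consider "odd a" | "even a" "a = n - 1" | "even a" "a < n - 1" using L(2) by linarith
  then show ?thesis
  proof cases
    case 1
    then have "a \<noteq> n - 1" using n by auto
    then show ?thesis using odd[OF False 1 L(1)] L(2) c 1 by simp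
  next
    case 2 then show ?thesis using last[OF False] c by simp
  next
    case 3 then show ?thesis using rung[OF 3(1) L(1) 3(2) False L(3)] c by simp
  qed
qed

lemma lab_sym: "lab n q p = lab n p q"
  by (simp add: lab_def min.commute add.commute)

text \<open>Successive labels own successive ranges: an even label \<open>a\<close> below
  \<open>n - 1\<close> has \<open>2 a\<close> to \<open>2 a + 2\<close>, the odd label after it only
  \<open>2 a + 3\<close>, and the last label \<open>n - 1\<close> only \<open>2 n - 2\<close>. Both
  properness and the estimate of colour shifts rest on these offsets.\<close>

lemma colour_offset:
  fixes n :: int
  assumes n: "odd n" and pq: "p \<in> {0..<n} \<times> UNIV" "q \<in> {0..<n} \<times> UNIV" "p \<noteq> q"
  obtains k where "colour n p q = 2 * lab n p q + k" "0 \<le> lab n p q" "lab n p q < n"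
    "(if odd (lab n p q) then k = 1 else k = 0 \<or> k = 1 \<or> k = 2)" "lab n p q = n - 1 \<Longrightarrow> k = 0"
proof -
  define a where "a = lab n p q"
  define d where "d = lab n p q div 2 + 1"
  have da: "a div 2 + 1 = d" by (simp add: a_def d_def)
  have P: "0 < d \<and> 2 * d < n" if "even a" "0 \<le> a" "a < n - 1"
  proof -
    from that(1) obtain b where b: "a = 2 * b" by (rule evenE)
    obtain c where c: "n = 2 * c + 1" using n by (rule oddE)
    show ?thesis using b c that(2,3) unfolding d_def a_def[symmetric] by simp
  qed
  note C = odd_shift_proper[OF _ _ pos_range[OF pq(1), of a], of d]
  show ?thesis
  proof (rule colour_cases[OF n pq], unfold a_def[symmetric] da)
    assume "odd a" "0 \<le> a" "a < n - 1" "colour n p q = 2 * a + 1"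
    then show ?thesis using that[of 1] unfolding a_def by simp
  next
    assume "even a" "a = n - 1" "colour n p q = 2 * a"
    moreover have "0 < n" using pq(1) by auto
    ultimately show ?thesis using that[of 0] unfolding a_def by simp
  next
    assume a: "even a" "0 \<le> a" "a < n - 1"
      and c: "colour n p q = 2 * a + (3 - cyc n d (pos n a p) - cyc n d ((pos n a p - d) mod n))"
    define u v where "u = cyc n d (pos n a p)" and "v = cyc n d ((pos n a p - d) mod n)"
    have "u \<in> {0, 1, 2}" "v \<in> {0, 1, 2}" "u \<noteq> v" using C P[OF a] unfolding u_def v_def by blast+
    then have "3 - u - v = 0 \<or> 3 - u - v = 1 \<or> 3 - u - v = 2" by auto
    then show ?thesis using that[of "3 - u - v"] a c unfolding a_def[symmetric] u_def v_def by simp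
  next
    assume a: "even a" "0 \<le> a" "a < n - 1" and c: "colour n p q = 2 * a + cyc n d (pos n a p)"
    have "cyc n d (pos n a p) \<in> {0, 1, 2}" using C(1) P[OF a] by blast
    then show ?thesis using that[of "cyc n d (pos n a p)"] a c unfolding a_def[symmetric] by simp
  next
    assume a: "even a" "0 \<le> a" "a < n - 1" and c: "colour n p q = 2 * a + cyc n d ((pos n a p - d) mod n)"
    have "cyc n d ((pos n a p - d) mod n) \<in> {0, 1, 2}" using C(2) P[OF a] by blast
    then show ?thesis using that[of "cyc n d ((pos n a p - d) mod n)"] a c unfolding a_def[symmetric] by simp
  qed
qed

text \<open>The ranges of the labels are disjoint, so equal colours have equal labels. Inside one
  label the edges at \<open>p\<close> have distinct colours, and the position together with the copy
  determines the neighbour.\<close>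

lemma colour_proper:
  fixes n :: int
  assumes n: "odd n" and p: "p \<in> {0..<n} \<times> UNIV" and q: "q \<in> {0..<n} \<times> UNIV" "p \<noteq> q"
    and r: "r \<in> {0..<n} \<times> UNIV" "p \<noteq> r" and eq: "colour n p q = colour n p r"
  shows "q = r"
proof -
  define a where "a = lab n p q"
  define d where "d = lab n p q div 2 + 1"
  obtain k where k: "colour n p q = 2 * a + k" "if odd a then k = 1 else k = 0 \<or> k = 1 \<or> k = 2"
    using colour_offset[OF n p q] unfolding a_def by metis
  obtain k' where k': "colour n p r = 2 * lab n p r + k'" "if odd (lab n p r) then k' = 1 else k' = 0 \<or> k' = 1 \<or> k' = 2"
    using colour_offset[OF n p r] by metis
  have dec: "a' = b" if "2 * a' + k = 2 * b + k'" "if odd a' then k = 1 else k = 0 \<or> k = 1 \<or> k = 2"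
    "if odd b then k' = 1 else k' = 0 \<or> k' = 1 \<or> k' = 2" for a' b k k' :: int
    using that by presburger
  have "2 * a + k = 2 * lab n p r + k'" using k(1) k'(1) eq by linarith
  then have ra: "lab n p r = a" using dec[OF _ k(2) k'(2)] by simp
  have matching: "q = r" if "snd p \<noteq> snd q" "snd p \<noteq> snd r"
  proof -
    have "pos n a q = pos n a p" "pos n a r = pos n a p"
      using lab_diff(3)[OF p q(1) that(1)] lab_diff(3)[OF p r(1) that(2)] ra unfolding a_def by simp_all
    then show ?thesis using pos_inj[OF q(1) r(1), of a] that by simp
  qed
  show ?thesis
  proof (cases "snd p \<noteq> snd q \<and> snd p \<noteq> snd r")
    case True then show ?thesis using matching by blast
  next
    case False
    have P: "0 < d" "2 * d < n"
      using False lab_same(4,5)[OF n p q] lab_same(4,5)[OF n p r] ra unfolding d_def a_def by auto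
    have ea: "even a" "a \<noteq> n - 1"
      using False lab_same(1,3)[OF n p q] lab_same(1,3)[OF n p r] ra unfolding a_def by auto
    define u v where "u = cyc n d (pos n a p)" and "v = cyc n d ((pos n a p - d) mod n)"
    have uv: "u \<in> {0, 1, 2}" "v \<in> {0, 1, 2}" "u \<noteq> v" using odd_shift_proper[OF P pos_range[OF p, of a]] unfolding u_def v_def by blast+
    have three: "(colour n p z = 2 * a + (3 - u - v) \<and> snd p \<noteq> snd z) \<or> (colour n p z = 2 * a + u \<and> snd p = snd z \<and> pos n a z = (pos n a p + d) mod n) \<or>
      (colour n p z = 2 * a + v \<and> snd p = snd z \<and> pos n a z = (pos n a p - d) mod n)"
      if z: "z \<in> {0..<n} \<times> UNIV" "p \<noteq> z" "lab n p z = a" for z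
      by (rule colour_cases[OF n p z(1,2)]) (use ea in \<open>auto simp: z(3) u_def v_def d_def a_def[symmetric]\<close>)
    have "3 - u - v \<noteq> u" "3 - u - v \<noteq> v" using uv by auto
    then show ?thesis
      using three[OF q a_def[symmetric]] three[OF r ra] eq uv(3) matching pos_inj[OF q(1) r(1), of a] by auto
  qed
qed

lemma colour_sym:
  fixes n :: int
  assumes n: "odd n" and p: "p \<in> {0..<n} \<times> UNIV" and q: "q \<in> {0..<n} \<times> UNIV" "p \<noteq> q"
  shows "colour n q p = colour n p q"
proof -
  define a where "a = lab n p q"
  define d where "d = lab n p q div 2 + 1"
  have da: "a div 2 + 1 = d" by (simp add: a_def d_def)
  show ?thesis
  proof (cases "snd p = snd q")
    case False
    note L = lab_diff(3)[OF p q(1) False]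
    show ?thesis unfolding colour_def Let_def lab_sym[of n q p] using L False by simp
  next
    case True
    note L = lab_same[OF n p q True, folded a_def d_def]
    have an: "a \<noteq> n - 1" using L(3) by simp
    note sp = shift_facts[OF pos_range[OF p, of a] L(4,5)]
    have ex: "(pos n a p - d) mod n \<noteq> (pos n a p + d) mod n" using sp(4,5) by metis
    have c: "colour n p q = 2 * a + cyc n d (if pos n a q = (pos n a p + d) mod n then pos n a p else pos n a q)"
      "colour n q p = 2 * a + cyc n d (if pos n a p = (pos n a q + d) mod n then pos n a q else pos n a p)"
      unfolding colour_def Let_def lab_sym[of n q p] a_def[symmetric] da using True L(1) an by simp_all
    from L(6) show ?thesis
    proof
      assume e: "pos n a q = (pos n a p + d) mod n"
      then have "pos n a p \<noteq> (pos n a q + d) mod n" using sp(5) by simp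
      then show ?thesis unfolding c using e by simp
    next
      assume e: "pos n a q = (pos n a p - d) mod n"
      then have "pos n a p = (pos n a q + d) mod n" "pos n a q \<noteq> (pos n a p + d) mod n" using sp(4) ex by simp_all
      then show ?thesis unfolding c by simp
    qed
  qed
qed

text \<open>Counting: \<open>p\<close> has \<open>2 n - 1\<close> neighbours with distinct colours,
  and there are \<open>2 n - 1\<close> colours.\<close>

lemma colour_mate:
  fixes n :: int
  assumes n: "odd n" and p: "p \<in> {0..<n} \<times> UNIV"
  shows "colour n p ` ({0..<n} \<times> UNIV - {p}) = {0..<2 * n - 1}" "inj_on (colour n p) ({0..<n} \<times> UNIV - {p})"
proof -
  let ?X = "{0..<n} \<times> (UNIV :: bool set) - {p}"
  have np: "0 < n" using p by auto
  show inj: "inj_on (colour n p) ?X" using colour_proper[OF n p] by (intro inj_onI) auto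
  have sub: "colour n p ` ?X \<subseteq> {0..<2 * n - 1}"
  proof
    fix c assume "c \<in> colour n p ` ?X"
    then obtain q where q: "q \<in> {0..<n} \<times> UNIV" "p \<noteq> q" "c = colour n p q" by blast
    obtain k where k: "colour n p q = 2 * lab n p q + k" "0 \<le> lab n p q" "lab n p q < n"
      "if odd (lab n p q) then k = 1 else k = 0 \<or> k = 1 \<or> k = 2" "lab n p q = n - 1 \<Longrightarrow> k = 0"
      using colour_offset[OF n p q(1,2)] by metis
    have "0 \<le> k \<and> k \<le> 2" using k(4) by (auto split: if_splits)
    then show "c \<in> {0..<2 * n - 1}" using k(1-3,5) q(3) by (cases "lab n p q = n - 1") auto
  qed
  have "card ?X = 2 * nat n - 1" using p by (simp add: card_cartesian_product card_UNIV_bool)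
  also have "\<dots> = card {0..<2 * n - 1}" using np by simp
  finally have "card (colour n p ` ?X) = card {0..<2 * n - 1}" using card_image[OF inj] by simp
  then show "colour n p ` ?X = {0..<2 * n - 1}" using sub by (intro card_subset_eq) simp_all
qed

text \<open>The index is a translation \<open>t\<close> and a bit; \<open>s\<close> selects the
  inverse. With the bit set the copies are exchanged, the sum of a mixed pair is kept, and the map
  is an involution. Otherwise the copies are kept and the summand 1 raises that sum by 1. Each copy
  is translated as a whole, so distances inside it never change.\<close>

definition shift_perm :: "int \<Rightarrow> int \<times> bool \<Rightarrow> bool \<Rightarrow> int \<times> bool \<Rightarrow> int \<times> bool" where
  "shift_perm n i s p = (let t = fst i; l = snd p in
     if snd i then ((fst p + (if l then - t else t)) mod n, \<not> l)
     else ((fst p + (if s then if l then t - 1 else - t else if l then 1 - t else t)) mod n, l))"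

lemma shift_perm_inverse:
  assumes "p \<in> {0..<n :: int} \<times> UNIV"
  shows "shift_perm n i s p \<in> {0..<n} \<times> UNIV \<and> shift_perm n i (\<not> s) (shift_perm n i s p) = p"
proof -
  obtain x l where p: "p = (x, l)" by (cases p)
  have x: "0 \<le> x" "x < n" using assms p by auto
  have e: "((x + d) mod n + e) mod n = x" if "d + e = 0" for d e
  proof -
    have "x + d + e = x" using that by simp
    then have "((x + d) mod n + e) mod n = x mod n" unfolding mod_add_left_eq by (simp only:)
    then show ?thesis using x by simp
  qed
  have e1: "((x - d) mod n + d) mod n = x" "((x + d) mod n - d) mod n = x" for d using e[of "- d" d] e[of d "- d"] by simp_all
  show ?thesis using x unfolding p shift_perm_def Let_def by (cases "snd i"; cases s; cases l) (simp_all add: e e1)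
qed

lemma shift_perm_latin:
  assumes n: "n > (0 :: int)" and i: "i \<in> {0..<n} \<times> UNIV" "j \<in> {0..<n} \<times> UNIV" and eq: "shift_perm n i False p = shift_perm n j False p"
  shows "i = j"
proof -
  have s: "snd i = snd j" using eq by (auto simp: shift_perm_def Let_def split: if_splits)
  have "n dvd fst i - fst j"
    using eq s by (auto simp: shift_perm_def Let_def mod_eq_dvd_iff algebra_simps dvd_diff_commute split: if_splits)
  then have "fst i mod n = fst j mod n" by (simp add: mod_eq_dvd_iff)
  then show ?thesis using i s by (auto simp: prod_eq_iff)
qed

text \<open>For two points of one copy the equations give \<open>2 * (x - y) = 0\<close> modulo the
  odd number \<open>n\<close>. For a mixed pair, exactly one of the two permutations exchanges the
  copies, so the sums of the images differ by 1 although the images form the same pair.\<close>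

lemma shift_perm_swap:
  assumes n: "odd n" "n > (1 :: int)" and p: "p \<in> {0..<n} \<times> UNIV" and q: "q \<in> {0..<n} \<times> UNIV" "p \<noteq> q"
    and eq: "shift_perm n i False p = shift_perm n j False q" "shift_perm n i False q = shift_perm n j False p"
  shows False
proof -
  obtain x l where pl: "p = (x, l)" by (cases p)
  obtain y m where qm: "q = (y, m)" by (cases q)
  obtain t e where i: "i = (t, e)" by (cases i)
  obtain u f where j: "j = (u, f)" by (cases j)
  have E: "((x + (if e then if l then - t else t else if l then 1 - t else t)) mod n = (y + (if f then if m then - u else u else if m then 1 - u else u)) mod n)"
    "((y + (if e then if m then - t else t else if m then 1 - t else t)) mod n = (x + (if f then if l then - u else u else if l then 1 - u else u)) mod n)"
    "(if e then \<not> l else l) = (if f then \<not> m else m)"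
    using eq unfolding pl qm i j shift_perm_def Let_def by (auto split: if_splits)
  show False
  proof (cases "l = m")
    case True
    then have ef: "e = f" using E(3) by (auto split: if_splits)
    have "n dvd 2 * (x - y)"
    proof -
      define A where "A = (if e then if l then - t else t else if l then 1 - t else t)"
      define B where "B = (if e then if l then - u else u else if l then 1 - u else u)"
      have "(x + A) mod n = (y + B) mod n" using E(1) unfolding A_def B_def True ef .
      moreover have "(y + A) mod n = (x + B) mod n" using E(2) unfolding A_def B_def True ef .
      ultimately have "n dvd (x + A) - (y + B)" "n dvd (y + A) - (x + B)" by (simp_all only: mod_eq_dvd_iff)
      then have "n dvd ((x + A) - (y + B)) - ((y + A) - (x + B))" by (rule dvd_diff)
      then show ?thesis by (simp add: algebra_simps)
    qed
    moreover have "coprime n 2" using n(1) by simp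
    ultimately have "n dvd x - y" using coprime_dvd_mult_right_iff by blast
    then have "x mod n = y mod n" by (simp add: mod_eq_dvd_iff)
    then show False using p q True unfolding pl qm by auto
  next
    case False
    have "n dvd 1"
    proof -
      define A where "A = (if e then if l then - t else t else if l then 1 - t else t)"
      define A' where "A' = (if e then if m then - t else t else if m then 1 - t else t)"
      define B where "B = (if f then if m then - u else u else if m then 1 - u else u)"
      define B' where "B' = (if f then if l then - u else u else if l then 1 - u else u)"
      have "n dvd (x + A) - (y + B)" using E(1) unfolding A_def B_def mod_eq_dvd_iff .
      moreover have "n dvd (y + A') - (x + B')" using E(2) unfolding A'_def B'_def mod_eq_dvd_iff .
      ultimately have "n dvd ((x + A) - (y + B)) + ((y + A') - (x + B'))" by (rule dvd_add)
      moreover have "((x + A) - (y + B)) + ((y + A') - (x + B')) = 1 \<or> ((x + A) - (y + B)) + ((y + A') - (x + B')) = - 1"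
        using E(3) False unfolding A_def A'_def B_def B'_def by (auto split: if_splits)
      ultimately show ?thesis by auto
    qed
    then show False using n(2) by simp
  qed
qed

text \<open>The label stays or passes to its successor modulo \<open>n\<close>. If it stays, the
  offset changes by at most 2. If it passes on, one of the two labels is odd and the colour rises by
  1 to 3. From the last label, with its single colour \<open>2 n - 2\<close>, to label 0 the same
  holds modulo \<open>2 n - 1\<close>.\<close>

lemma shift_perm_colour:
  fixes n :: int and i :: "int \<times> bool"
  assumes n: "odd n" and p: "p \<in> {0..<n} \<times> UNIV" and q: "q \<in> {0..<n} \<times> UNIV" "p \<noteq> q"
  defines "p' \<equiv> shift_perm n i False p" and "q' \<equiv> shift_perm n i False q"
  shows "\<exists>v. - 2 \<le> v \<and> v \<le> 3 \<and> (2 * n - 1) dvd (colour n p' q' - colour n p q - v)"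
proof -
  have P: "p' \<in> {0..<n} \<times> UNIV" "q' \<in> {0..<n} \<times> UNIV" "p' \<noteq> q'"
    using shift_perm_inverse[OF p, of i False] shift_perm_inverse[OF q(1), of i False] q(2) unfolding p'_def q'_def by metis+
  obtain k where k: "colour n p q = 2 * lab n p q + k" "0 \<le> lab n p q" "lab n p q < n"
    "if odd (lab n p q) then k = 1 else k = 0 \<or> k = 1 \<or> k = 2" "lab n p q = n - 1 \<Longrightarrow> k = 0"
    using colour_offset[OF n p q] by metis
  obtain k' where k': "colour n p' q' = 2 * lab n p' q' + k'"
    "if odd (lab n p' q') then k' = 1 else k' = 0 \<or> k' = 1 \<or> k' = 2"
    using colour_offset[OF n P] by metis
  obtain x l where pl: "p = (x, l)" by (cases p)
  obtain y m where qm: "q = (y, m)" by (cases q)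
  obtain t e where i: "i = (t, e)" by (cases i)
  have md: "((a + c) mod n - (b + c) mod n) mod n = (a - b) mod n" for a b c :: int by (simp add: mod_diff_eq)
  have "lab n p' q' = lab n p q \<or> lab n p' q' = (lab n p q + 1) mod n"
  proof (cases "l = m")
    case True
    then have "lab n p' q' = lab n p q"
      unfolding p'_def q'_def pl qm i lab_def shift_perm_def Let_def by (simp add: md)
    then show ?thesis ..
  next
    case False
    define c where "c = (if e then if l then - t else t else if l then 1 - t else t)"
    define d where "d = (if e then if m then - t else t else if m then 1 - t else t)"
    have lq: "lab n p q = (x + y) mod n" using False unfolding pl qm lab_def by simp
    have "lab n p' q' = ((x + c) mod n + (y + d) mod n) mod n"
      using False unfolding p'_def q'_def pl qm i lab_def shift_perm_def Let_def c_def d_def by (cases e) simp_all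
    also have "\<dots> = (lab n p q + (c + d)) mod n"
    proof -
      have "x + c + (y + d) = x + y + (c + d)" by simp
      then show ?thesis unfolding lq mod_add_left_eq mod_add_right_eq by (simp only:)
    qed
    finally have l': "lab n p' q' = (lab n p q + (c + d)) mod n" .
    have "c + d = 0 \<or> c + d = 1" using False unfolding c_def d_def by auto
    then show ?thesis
    proof
      assume z: "c + d = 0"
      have "lab n p' q' = lab n p q" unfolding l' z lq by simp
      then show ?thesis ..
    next
      assume o: "c + d = 1"
      show ?thesis unfolding l' o by simp
    qed
  qed
  then consider (same) "lab n p' q' = lab n p q" | (succ) "lab n p' q' = lab n p q + 1" "lab n p q < n - 1"
    | (wrap) "lab n p' q' = 0" "lab n p q = n - 1"
  proof (elim disjE)
    assume *: "lab n p' q' = (lab n p q + 1) mod n"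
    show ?thesis
    proof (cases "lab n p q = n - 1")
      case True then show ?thesis using * wrap by simp
    next
      case False then show ?thesis using * succ k(2,3) by simp
    qed
  qed (rule same)
  then show ?thesis
  proof cases
    case same
    have "- 2 \<le> k' - k" "k' - k \<le> 3" using k(4) k'(2) by (auto split: if_splits)
    moreover have "colour n p' q' - colour n p q - (k' - k) = 0" using k(1) k'(1) same by simp
    ultimately show ?thesis by (metis dvd_0_right)
  next
    case succ
    have "- 2 \<le> 2 + k' - k" "2 + k' - k \<le> 3" using k(4) k'(2) unfolding succ(1) by (auto split: if_splits)
    moreover have "colour n p' q' - colour n p q - (2 + k' - k) = 0" using k(1) k'(1) succ by simp
    ultimately show ?thesis by (metis dvd_0_right)
  next
    case wrap
    have "k = 0" using k(5) wrap by simp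
    moreover have "- 2 \<le> k' + 1" "k' + 1 \<le> 3" using k'(2) by (auto split: if_splits)
    moreover have "colour n p' q' - colour n p q - (k' + 1) = - (2 * n - 1)" using k(1) k'(1) wrap \<open>k = 0\<close> by simp
    ultimately show ?thesis by (metis dvd_minus_iff dvd_refl)
  qed
qed

section \<open>Transport of disjoint families and the lower bound for D\<close>

section \<open>Large sets of disjoint systems\<close>

lemma disjoint_SQS_family_subset:
  assumes "disjoint_SQS_family P F"
  shows "F \<subseteq> Pow (Pow P)"
  using assms unfolding disjoint_SQS_family_def is_SQS_def by blast

lemma disjoint_SQS_family_image:
  assumes F: "disjoint_SQS_family P F" and h: "inj_on h P"
  shows "disjoint_SQS_family (h ` P) ((`) ((`) h) ` F)" "card ((`) ((`) h) ` F) = card F"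
proof -
  have sub: "F \<subseteq> Pow (Pow P)" using F by (rule disjoint_SQS_family_subset)
  have i1: "inj_on ((`) h) (Pow P)" using h by (rule inj_on_image_Pow)
  have "inj_on ((`) ((`) h)) F" using inj_on_subset[OF inj_on_image_Pow[OF i1] sub] .
  then show "card ((`) ((`) h) ` F) = card F" by (rule card_image)
  show "disjoint_SQS_family (h ` P) ((`) ((`) h) ` F)"
    unfolding disjoint_SQS_family_def
  proof (intro conjI ballI impI)
    fix B' assume "B' \<in> (`) ((`) h) ` F"
    then obtain B where "B \<in> F" "B' = (`) h ` B" by (rule imageE)
    then show "is_SQS (h ` P) B'" using F h is_SQS_image unfolding disjoint_SQS_family_def by blast
  next
    fix B1' B2' assume "B1' \<in> (`) ((`) h) ` F" "B2' \<in> (`) ((`) h) ` F" and ne: "B1' \<noteq> B2'"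
    then obtain B1 B2 where B: "B1 \<in> F" "B1' = (`) h ` B1" "B2 \<in> F" "B2' = (`) h ` B2" by (elim imageE)
    then have "B1 \<noteq> B2" using ne by auto
    then have "B1 \<inter> B2 = {}" using F B unfolding disjoint_SQS_family_def by blast
    moreover have "B1 \<subseteq> Pow P" "B2 \<subseteq> Pow P" using B sub by auto
    ultimately show "B1' \<inter> B2' = {}" unfolding B using inj_on_image_Int[OF i1, of B1 B2] by simp
  qed
qed

lemma finite_family_sizes:
  fixes m :: nat
  shows "finite {card F | F. disjoint_SQS_family {..<m} F}"
proof -
  have "{card F | F. disjoint_SQS_family {..<m} F} \<subseteq> card ` Pow (Pow (Pow {..<m}))"
    using disjoint_SQS_family_subset by blast
  then show ?thesis by (rule finite_subset) simp
qed

lemma D_ge: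
  assumes "disjoint_SQS_family P F" "finite P" "card P = m"
  shows "card F \<le> D m"
proof -
  obtain h where h: "bij_betw h P {0..<m}" using ex_bij_betw_finite_nat[OF assms(2)] assms(3) by blast
  then have i: "inj_on h P" "h ` P = {..<m}" by (auto simp: bij_betw_def)
  note im = disjoint_SQS_family_image[OF assms(1) i(1), unfolded i(2)]
  have "card ((`) ((`) h) ` F) \<in> {card F | F. disjoint_SQS_family {..<m} F}" using im(1) by blast
  then show ?thesis unfolding D_def im(2) by (rule Max_ge[OF finite_family_sizes])
qed

lemma D_attained:
  assumes "finite P" "card P = m"
  obtains F where "disjoint_SQS_family P F" "card F = D m" "finite F"
proof -
  have "disjoint_SQS_family {..<m} {}" by (simp add: disjoint_SQS_family_def)
  then have "{card F | F. disjoint_SQS_family {..<m} F} \<noteq> {}" by blast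
  then have "D m \<in> {card F | F. disjoint_SQS_family {..<m} F}" unfolding D_def by (rule Max_in[OF finite_family_sizes])
  then obtain F where F: "disjoint_SQS_family {..<m} F" "card F = D m" by auto
  obtain h where h: "bij_betw h {0..<m} P" using ex_bij_betw_nat_finite[OF assms(1)] assms(2) by blast
  then have i: "inj_on h {..<m}" "h ` {..<m} = P" by (auto simp: bij_betw_def atLeast0LessThan)
  note im = disjoint_SQS_family_image[OF F(1) i(1), unfolded i(2)]
  have "finite ((`) ((`) h) ` F)"
    using finite_subset[OF disjoint_SQS_family_subset[OF im(1)]] assms(1) by simp
  then show ?thesis using that im F(2) by simp
qed

theorem D_quadruple:
  fixes n :: nat
  assumes n: "n \<ge> 7" "odd n" and ex: "has_SQS (2 * n)"
  shows "D (4 * n) \<ge> 2 * n + min (D (2 * n)) (2 * n - 7)"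
proof -
  let ?n = "int n"
  define Q where "Q = {0..<?n} \<times> (UNIV :: bool set)"
  define N where "N = 2 * ?n - 1"
  define K where "K = min (D (2 * n)) (2 * n - 7)"
  \<comment> \<open>The shifts -2 to 3 are excluded modulo \<open>N = 2 n - 1\<close>. This leaves 4
    to \<open>N - 3\<close>, which are \<open>2 n - 7\<close> values; \<open>K\<close> of them are
    used.\<close>
  define J where "J = {4..<4 + int K}"
  have on: "odd ?n" "?n > 0" "?n > 1" using n by auto
  have Q: "finite Q" "card Q = 2 * n" by (simp_all add: Q_def card_cartesian_product card_UNIV_bool)
  have JN: "4 \<le> j \<and> j \<le> N - 3" if "j \<in> J" for j
  proof -
    have "int K \<le> 2 * ?n - 7" using n unfolding K_def by linarith
    then show ?thesis using that unfolding J_def N_def by simp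
  qed
  obtain B0 where "is_SQS Q B0" using ex has_SQS_iff[OF Q] by blast
  from is_SQS_obtain_skein[OF this] obtain q0 where q0: "\<forall>x\<in>Q. \<forall>y\<in>Q. \<forall>z\<in>Q. distinct [x, y, z] \<longrightarrow>
      q0 x y z \<in> Q - {x, y, z} \<and> q0 y x z = q0 x y z \<and> q0 x z y = q0 x y z \<and> q0 x y (q0 x y z) = z \<and> {x, y, z, q0 x y z} \<in> B0"
    by (elim exE)
  have q0': "q0 x y z \<in> Q - {x, y, z} \<and> q0 y x z = q0 x y z \<and> q0 x z y = q0 x y z \<and> q0 x y (q0 x y z) = z"
    if "x \<in> Q" "y \<in> Q" "z \<in> Q" "distinct [x, y, z]" for x y z using q0 that by blast
  obtain F where F: "disjoint_SQS_family Q F" "card F = D (2 * n)" "finite F" using Q by (rule D_attained)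
  have "card J \<le> card F" using F(2) by (simp add: J_def K_def)
  then obtain A where A: "A ` J \<subseteq> F" "inj_on A J"
    using card_le_inj[of J F] F(3) unfolding J_def by auto
  define q where "q j = (SOME f. \<forall>x\<in>Q. \<forall>y\<in>Q. \<forall>z\<in>Q. distinct [x, y, z] \<longrightarrow>
      f x y z \<in> Q - {x, y, z} \<and> f y x z = f x y z \<and> f x z y = f x y z \<and> f x y (f x y z) = z \<and> {x, y, z, f x y z} \<in> A j)" for j
  have qS: "\<forall>x\<in>Q. \<forall>y\<in>Q. \<forall>z\<in>Q. distinct [x, y, z] \<longrightarrow> q j x y z \<in> Q - {x, y, z} \<and> q j y x z = q j x y z \<and>
      q j x z y = q j x y z \<and> q j x y (q j x y z) = z \<and> {x, y, z, q j x y z} \<in> A j" if "j \<in> J" for j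
  proof -
    have "A j \<in> F" using A(1) that by auto
    then have "is_SQS Q (A j)" using F(1) unfolding disjoint_SQS_family_def by simp
    from is_SQS_obtain_skein[OF this] show ?thesis unfolding q_def by (rule someI_ex)
  qed
  have q': "q j x y z \<in> Q - {x, y, z} \<and> q j y x z = q j x y z \<and> q j x z y = q j x y z \<and> q j x y (q j x y z) = z"
    if "j \<in> J" "x \<in> Q" "y \<in> Q" "z \<in> Q" "distinct [x, y, z]" for j x y z using qS[OF that(1)] that(2-5) by blast
  have qA: "{x, y, z, q j x y z} \<in> A j"
    if "j \<in> J" "x \<in> Q" "y \<in> Q" "z \<in> Q" "distinct [x, y, z]" for j x y z using qS[OF that(1)] that(2-5) by blast
  define \<mu> where "\<mu> p = the_inv_into (Q - {p}) (colour ?n p)" for p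
  note cm = colour_mate[OF on(1), folded Q_def N_def]
  have \<mu>1: "colour ?n x y \<in> {0..<N} \<and> colour ?n y x = colour ?n x y \<and> \<mu> x (colour ?n x y) = y"
    if "x \<in> Q" "y \<in> Q" "x \<noteq> y" for x y
  proof -
    have y: "y \<in> Q - {x}" using that by simp
    have "colour ?n x y \<in> {0..<N}" unfolding cm(1)[OF that(1), symmetric] using y by (rule imageI)
    moreover have "\<mu> x (colour ?n x y) = y" unfolding \<mu>_def by (rule the_inv_into_f_f[OF cm(2)[OF that(1)] y])
    ultimately show ?thesis using colour_sym[OF on(1), folded Q_def, OF that] by simp
  qed
  have \<mu>2: "\<mu> x c \<in> Q - {x} \<and> colour ?n x (\<mu> x c) = c" if "x \<in> Q" "c \<in> {0..<N}" for x c
  proof -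
    have c: "c \<in> colour ?n x ` (Q - {x})" using that cm(1) by simp
    show ?thesis unfolding \<mu>_def
      using the_inv_into_into[OF cm(2)[OF that(1)] c order_refl] f_the_inv_into_f[OF cm(2)[OF that(1)] c] by simp
  qed
  define gL where "gL i = (\<lambda>s x y z. (\<not> s, shift_perm ?n i s (q0 x y z)))" for i
  define hL where "hL i = lindner_h q0 (shift_perm ?n i)" for i
  define gD where "gD j = (\<lambda>(s :: bool) x y z. (s, q j x y z))" for j
  define hD where "hD j = doubling_h (colour ?n) \<mu> N j" for j
  note sp = shift_perm_inverse[of _ ?n, folded Q_def]
  have L: "two_sided_skein Q (gL i) (hL i)" for i
    unfolding gL_def hL_def by (rule lindner_skein[OF Q(1)]) (use q0' sp in blast)+
  have Npos: "N > 0" using on unfolding N_def by simp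
  have Dd: "two_sided_skein Q (gD j) (hD j)" if "j \<in> J" for j
    unfolding gD_def hD_def by (rule doubling_skein[OF Q(1) _ Npos]) (use q'[OF that] \<mu>1 \<mu>2 in blast)+
  define I where "I = {0..<?n} \<times> (UNIV :: bool set)"
  define BB where "BB u = (case u of Inl i \<Rightarrow> two_sided_skein.blocks Q (gL i) (hL i) | Inr j \<Rightarrow> two_sided_skein.blocks Q (gD j) (hD j))"
    for u :: "(int \<times> bool) + int"
  have hLv: "u = shift_perm ?n i False x \<and> v = shift_perm ?n i False y \<or> u = shift_perm ?n i False y \<and> v = shift_perm ?n i False x"
    if "hL i False x y u = (True, v)" for i x y u v
    using that unfolding hL_def lindner_h_def by (auto split: if_splits)
  have LL: "BB (Inl i) \<inter> BB (Inl i') = {}" if i: "i \<in> I" "i' \<in> I" "i \<noteq> i'" for i i'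
  proof (rule ccontr)
    assume "BB (Inl i) \<inter> BB (Inl i') \<noteq> {}"
    then obtain b where "b \<in> two_sided_skein.blocks Q (gL i) (hL i)" "b \<in> two_sided_skein.blocks Q (gL i') (hL i')"
      unfolding BB_def by auto
    from common_block[OF L L this] show False
    proof (elim disjE exE conjE)
      fix s x y z assume a: "{x, y, z} \<subseteq> Q" "distinct [x, y, z]" "gL i s x y z = gL i' s x y z"
      define w where "w = q0 x y z"
      have w: "w \<in> Q" using q0'[of x y z] a(1,2) unfolding w_def by auto
      have e: "shift_perm ?n i s w = shift_perm ?n i' s w" using a(3) unfolding gL_def w_def by simp
      \<comment> \<open>If two inverse permutations agree at \<open>w\<close>, the permutations
        themselves agree at the common value.\<close>
      have "\<exists>v. shift_perm ?n i False v = shift_perm ?n i' False v"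
      proof (cases s)
        case True
        then show ?thesis using e sp[OF w, of i True] sp[OF w, of i' True] by (intro exI[of _ "shift_perm ?n i True w"]) simp
      next
        case False then show ?thesis using e by (intro exI[of _ w]) simp
      qed
      then show False using shift_perm_latin[OF on(2)] i unfolding I_def by blast
    next
      fix x y u v assume a: "{x, y, u, v} \<subseteq> Q" "x \<noteq> y" "hL i False x y u = (True, v)" "hL i' False x y u = (True, v)"
      have xy: "x \<in> {0..<?n} \<times> UNIV" "y \<in> {0..<?n} \<times> UNIV" using a(1) unfolding Q_def by blast+
      have lat: "shift_perm ?n i False p \<noteq> shift_perm ?n i' False p" for p
        using shift_perm_latin[OF on(2)] i unfolding I_def by blast
      have sw: "shift_perm ?n i False x = shift_perm ?n i' False y \<Longrightarrow> shift_perm ?n i False y \<noteq> shift_perm ?n i' False x"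
        using shift_perm_swap[OF on(1,3) xy a(2)] by blast
      \<comment> \<open>The images of \<open>x, y\<close> coincide either pointwise, which the Latin
        property forbids, or crosswise, which \<open>shift_perm_swap\<close> forbids.\<close>
      show False using hLv[OF a(3)] hLv[OF a(4)] lat[of x] lat[of y] sw by metis
    qed
  qed
  have LD: "BB (Inl i) \<inter> BB (Inr j) = {}" if j: "j \<in> J" for i j
  proof (rule ccontr)
    assume "BB (Inl i) \<inter> BB (Inr j) \<noteq> {}"
    then obtain b where "b \<in> two_sided_skein.blocks Q (gL i) (hL i)" "b \<in> two_sided_skein.blocks Q (gD j) (hD j)"
      unfolding BB_def by auto
    from common_block[OF L Dd[OF j] this] show False
    proof (elim disjE exE conjE)
      fix s x y z assume "gL i s x y z = gD j s x y z"
      then show False by (simp add: gL_def gD_def)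
    next
      fix x y u v assume a: "{x, y, u, v} \<subseteq> Q" "x \<noteq> y" "u \<noteq> v" "hL i False x y u = (True, v)" "hD j False x y u = (True, v)"
      have Qs: "x \<in> Q" "y \<in> Q" "u \<in> Q" "v \<in> Q" using a(1) by blast+
      define x' y' where "x' = shift_perm ?n i False x" and "y' = shift_perm ?n i False y"
      define c where "c = (colour ?n x y + j) mod N"
      have c: "c \<in> {0..<N}" using Npos by (simp add: c_def)
      have v: "v = \<mu> u c" using a(5) by (simp add: hD_def doubling_h_def c_def)
      have uv: "colour ?n u v = c" using \<mu>2[OF Qs(3) c] v by simp
      have "colour ?n v u = c" using uv \<mu>1[OF Qs(3,4) a(3)] by simp
      \<comment> \<open>\<open>u, v\<close> are the images of \<open>x, y\<close> in some order, so
        a common block would mean that the permutation raises the colour of the pair by exactly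
        \<open>j\<close>.\<close>
      then have k: "colour ?n x' y' = (colour ?n x y + j) mod N"
        using uv hLv[OF a(4)] unfolding c_def x'_def y'_def by auto
      obtain w where w: "- 2 \<le> w" "w \<le> 3" "N dvd (colour ?n x' y' - colour ?n x y - w)"
        using shift_perm_colour[OF on(1), of x y i] Qs(1,2) a(2) unfolding Q_def N_def x'_def y'_def by blast
      have "N dvd (colour ?n x y + j - colour ?n x' y')" using k by (metis dvd_minus_mod)
      then have "N dvd (colour ?n x y + j - colour ?n x' y') + (colour ?n x' y' - colour ?n x y - w)" using w(3) by (rule dvd_add)
      then have "N dvd j - w" by (simp add: algebra_simps)
      then have "N \<le> j - w" using JN[OF j] w(2) by (intro zdvd_imp_le) auto
      then show False using JN[OF j] w(1) by linarith
    qed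
  qed
  have DD: "BB (Inr j) \<inter> BB (Inr j') = {}" if j: "j \<in> J" "j' \<in> J" "j \<noteq> j'" for j j'
  proof (rule ccontr)
    assume "BB (Inr j) \<inter> BB (Inr j') \<noteq> {}"
    then obtain b where "b \<in> two_sided_skein.blocks Q (gD j) (hD j)" "b \<in> two_sided_skein.blocks Q (gD j') (hD j')"
      unfolding BB_def by auto
    from common_block[OF Dd[OF j(1)] Dd[OF j(2)] this] show False
    proof (elim disjE exE conjE)
      fix s x y z assume a: "{x, y, z} \<subseteq> Q" "distinct [x, y, z]" "gD j s x y z = gD j' s x y z"
      have e: "q j x y z = q j' x y z" using a(3) by (simp add: gD_def)
      \<comment> \<open>A block on one side would be shared by the members \<open>A j\<close> and
        \<open>A j'\<close> of the given disjoint family.\<close>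
      have "{x, y, z, q j x y z} \<in> A j \<inter> A j'" using qA[OF j(1), of x y z] qA[OF j(2), of x y z] a(1,2) e by simp
      moreover have "A j \<noteq> A j'" using A(2) j by (simp add: inj_on_eq_iff)
      moreover have "A j \<in> F" "A j' \<in> F" using A(1) j by auto
      ultimately show False using F(1) unfolding disjoint_SQS_family_def by blast
    next
      fix x y u v assume a: "{x, y, u, v} \<subseteq> Q" "hD j False x y u = (True, v)" "hD j' False x y u = (True, v)"
      have u: "u \<in> Q" using a(1) by blast
      define c c' where "c = (colour ?n x y + j) mod N" and "c' = (colour ?n x y + j') mod N"
      have c: "c \<in> {0..<N}" "c' \<in> {0..<N}" using Npos by (simp_all add: c_def c'_def)
      have "\<mu> u c = v" "\<mu> u c' = v" using a(2,3) by (simp_all add: hD_def doubling_h_def c_def c'_def)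
      then have "c = c'" using \<mu>2[OF u c(1)] \<mu>2[OF u c(2)] by simp
      then have "N dvd (colour ?n x y + j) - (colour ?n x y + j')" unfolding c_def c'_def by (simp only: mod_eq_dvd_iff)
      then have "j mod N = j' mod N" by (simp add: mod_eq_dvd_iff)
      then show False using JN[OF j(1)] JN[OF j(2)] j(3) by simp
    qed
  qed
  have sqs: "is_SQS (UNIV \<times> Q) (BB u)" if "u \<in> I <+> J" for u
    using that two_sided_skein.is_SQS_blocks[OF L] two_sided_skein.is_SQS_blocks[OF Dd] unfolding BB_def by auto
  have disj: "BB u \<inter> BB u' = {}" if "u \<in> I <+> J" "u' \<in> I <+> J" "u \<noteq> u'" for u u'
  proof (cases u)
    case (Inl i)
    then have i: "i \<in> I" using that(1) by auto
    show ?thesis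
    proof (cases u')
      case u': (Inl i') then show ?thesis using LL[OF i, of i'] that(2,3) Inl by auto
    next
      case (Inr j) then show ?thesis using LD[of j i] that(2) Inl by auto
    qed
  next
    case (Inr j)
    then have j: "j \<in> J" using that(1) by auto
    show ?thesis
    proof (cases u')
      case u': (Inl i) then show ?thesis using LD[OF j, of i] Inr by auto
    next
      case u': (Inr j') then show ?thesis using DD[OF j, of j'] that(2,3) Inr by auto
    qed
  qed
  \<comment> \<open>Systems with distinct indices are disjoint; being non-empty they are also
    distinct, so counting indices counts systems.\<close>
  have nonempty: "BB u \<noteq> {}" if "u \<in> I <+> J" for u
  proof -
    let ?T = "{(False, 0, False), (True, 0, False), (False, 0, True)} :: (bool \<times> int \<times> bool) set"
    have T: "?T \<subseteq> UNIV \<times> Q \<and> card ?T = 3" using on by (simp add: Q_def)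
    note S = sqs[OF that, unfolded is_SQS_def, THEN conjunct2, THEN conjunct2, THEN spec, of ?T, THEN mp, OF T]
    from ex1_implies_ex[OF S] obtain b where "b \<in> BB u" by (elim exE conjE)
    then show ?thesis by auto
  qed
  have inj: "inj_on BB (I <+> J)"
  proof (rule inj_onI, rule ccontr)
    fix u u' assume a: "u \<in> I <+> J" "u' \<in> I <+> J" "BB u = BB u'" "u \<noteq> u'"
    then show False using disj[OF a(1,2,4)] nonempty[OF a(1)] by simp
  qed
  have "disjoint_SQS_family (UNIV \<times> Q) (BB ` (I <+> J))"
    unfolding disjoint_SQS_family_def
  proof (intro conjI ballI impI)
    fix B assume "B \<in> BB ` (I <+> J)"
    then show "is_SQS (UNIV \<times> Q) B" using sqs by (elim imageE) simp
  next
    fix B1 B2 assume a: "B1 \<in> BB ` (I <+> J)" "B2 \<in> BB ` (I <+> J)" "B1 \<noteq> B2"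
    from a(1) obtain u where u: "u \<in> I <+> J" "B1 = BB u" by (elim imageE)
    from a(2) obtain u' where u': "u' \<in> I <+> J" "B2 = BB u'" by (elim imageE)
    show "B1 \<inter> B2 = {}" using disj[OF u(1) u'(1)] a(3) u(2) u'(2) by blast
  qed
  moreover have "finite (UNIV \<times> Q :: (bool \<times> int \<times> bool) set)" using Q(1) by simp
  moreover have "card (UNIV \<times> Q :: (bool \<times> int \<times> bool) set) = 4 * n"
    using Q(2) by (simp add: card_cartesian_product card_UNIV_bool)
  ultimately have "card (BB ` (I <+> J)) \<le> D (4 * n)" by (rule D_ge)
  moreover have "card (BB ` (I <+> J)) = 2 * n + K"
    unfolding card_image[OF inj] by (simp add: card_Plus I_def J_def card_cartesian_product card_UNIV_bool)
  ultimately show ?thesis by (simp add: K_def)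
qed

theorem theorem1:
  fixes n :: nat
  assumes "n \<ge> 7" and "n mod 6 = 1 \<or> n mod 6 = 5"
  shows "D (4 * n) \<ge> 2 * n + min (D (2 * n)) (2 * n - 7)"
proof (rule D_quadruple[OF assms(1)])
  show "odd n" using assms(2) by presburger
  \<comment> \<open>Residues 1 and 5 modulo 6 double to 2 and 4.\<close>
  show "has_SQS (2 * n)" by (rule has_SQS_hanani) (use assms(2) in presburger)
qed

end
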